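(* There exists a deterministic dynamic data structure which stores an arbitrary initial state $X_0\in Q^V$ and an arbitrary execution-log $((v_t,c_t))_{t=1}^T\in(V\times Q)^T$ using $O(T+|V|)$ memory words, each of $O(\log T+\log|V|+\log|Q|)$ bits, such that each of the operations $\mathsf{Insert}(t,v,c)$, $\mathsf{Remove}(t)$, $\mathsf{Update}(t,c)$, $\mathsf{Eval}(t,v)$ and $\mathsf{Successor}(t,v)$ can be performed in time $O(\log^2T+\log|V|)$.
   Context: Given $X_0\in Q^V$ and the log $((v_t,c_t))_{t=1}^T$, define $X_t\in Q^V$ for $0\le t\le T$ by $X_t(v)=c_i$ for the largest $i\le t$ with $v_i=v$, and $X_t(v)=X_0(v)$ if no such $i$ exists (so the log records the transitions of a single-site chain with $X_t(v_t)=c_t$). Operations: $\mathsf{Insert}(t,v,c)$ inserts the pair $(v,c)$ immediately after the $(t-1)$-th pair (shifting later indices by one); $\mathsf{Remove}(t)$ deletes the $t$-th pair (shifting later indices); $\mathsf{Update}(t,c)$ replaces the $t$-th pair $(v_t,c_t)$ by $(v_t,c)$; $\mathsf{Eval}(t,v)$ returns $X_t(v)$ for arbitrary $t$ and $v$; $\mathsf{Successor}(t,v)$ returns the smallest $i>t$ with $v_i=v$, or $\perp$ if none exists. The vertex set $V$ may change dynamically. Model: word-RAM. *)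

theory Defs
  imports Complex_Main "HOL-Library.FuncSet"
begin

section \<open>Word-RAM\<close>

text \<open>
  A word is a natural number below \<open>2 ^ w\<close>. The word length \<open>w\<close> is a parameter of the
  semantics and not of the programs, so it may vary with the problem size.
  A configuration consists of the registers and of the memory. A program mentions only
  finitely many registers; the data structure lives in memory. Control flow is structured
  (a special case of jumps).
\<close>

datatype binop = ADD | SUB | MUL | DIV | MOD | AND | OR | XOR | SHL | SHR

datatype instr =
    Const nat nat
  | Move nat nat
  | Binop binop nat nat nat
  | Load nat nat
  | Store nat nat

datatype test = EQ nat nat | NEQ nat nat | LT nat nat

datatype com =
    Basic instr
  | Seq com com
  | If test com com
  | While test com

type_synonym config = "(nat \<Rightarrow> nat) \<times> (nat \<Rightarrow> nat)"

fun binop_val :: "nat \<Rightarrow> binop \<Rightarrow> nat \<Rightarrow> nat \<Rightarrow> nat" where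
  "binop_val w ADD x y = (x + y) mod 2 ^ w"
| "binop_val w SUB x y = nat ((int x - int y) mod 2 ^ w)"
| "binop_val w MUL x y = (x * y) mod 2 ^ w"
| "binop_val w DIV x y = x div y"
| "binop_val w MOD x y = x mod y"
| "binop_val w AND x y = Bit_Operations.and x y"
| "binop_val w OR x y = Bit_Operations.or x y"
| "binop_val w XOR x y = Bit_Operations.xor x y"
| "binop_val w SHL x y = push_bit y x mod 2 ^ w"
| "binop_val w SHR x y = drop_bit y x"

text \<open>
  Only the memory words with addresses below \<open>m\<close> are available: any other access is a fault,
  from which there is no execution.
\<close>

fun step :: "nat \<Rightarrow> nat \<Rightarrow> instr \<Rightarrow> config \<Rightarrow> config option" where
  "step w m (Const r n) (R, M) = Some (R(r := n mod 2 ^ w), M)"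
| "step w m (Move r a) (R, M) = Some (R(r := R a), M)"
| "step w m (Binop f r a b) (R, M) = Some (R(r := binop_val w f (R a) (R b)), M)"
| "step w m (Load r a) (R, M) = (if R a < m then Some (R(r := M (R a)), M) else None)"
| "step w m (Store a r) (R, M) = (if R a < m then Some (R, M(R a := R r)) else None)"

fun test_val :: "test \<Rightarrow> config \<Rightarrow> bool" where
  "test_val (EQ a b) (R, M) \<longleftrightarrow> R a = R b"
| "test_val (NEQ a b) (R, M) \<longleftrightarrow> R a \<noteq> R b"
| "test_val (LT a b) (R, M) \<longleftrightarrow> R a < R b"

text \<open>
  \<open>exec w m c \<sigma> k \<sigma>'\<close>: started in \<open>\<sigma>\<close>, the program \<open>c\<close> halts in \<open>\<sigma>'\<close> after \<open>k\<close> time units.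
  Every instruction and every evaluation of a test takes one unit.
\<close>

inductive exec :: "nat \<Rightarrow> nat \<Rightarrow> com \<Rightarrow> config \<Rightarrow> nat \<Rightarrow> config \<Rightarrow> bool" for w m where
  exec_Basic: "step w m i \<sigma> = Some \<sigma>' \<Longrightarrow> exec w m (Basic i) \<sigma> 1 \<sigma>'"
| exec_Seq: "exec w m c \<sigma> k \<sigma>' \<Longrightarrow> exec w m d \<sigma>' l \<sigma>'' \<Longrightarrow> exec w m (Seq c d) \<sigma> (k + l) \<sigma>''"
| exec_IfTrue: "test_val b \<sigma> \<Longrightarrow> exec w m c \<sigma> k \<sigma>' \<Longrightarrow> exec w m (If b c d) \<sigma> (Suc k) \<sigma>'"
| exec_IfFalse: "\<not> test_val b \<sigma> \<Longrightarrow> exec w m d \<sigma> k \<sigma>' \<Longrightarrow> exec w m (If b c d) \<sigma> (Suc k) \<sigma>'"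
| exec_WhileFalse: "\<not> test_val b \<sigma> \<Longrightarrow> exec w m (While b c) \<sigma> 1 \<sigma>"
| exec_WhileTrue: "test_val b \<sigma> \<Longrightarrow> exec w m c \<sigma> k \<sigma>' \<Longrightarrow> exec w m (While b c) \<sigma>' l \<sigma>'' \<Longrightarrow>
    exec w m (While b c) \<sigma> (Suc (k + l)) \<sigma>''"

lemma exec_deterministic:
  assumes "exec w m c \<sigma> k \<sigma>'" and "exec w m c \<sigma> l \<sigma>''"
  shows "l = k \<and> \<sigma>'' = \<sigma>'"
  using assms
proof (induction arbitrary: l \<sigma>'' rule: exec.induct)
  case (exec_Basic i \<sigma> \<sigma>')
  from exec_Basic.prems exec_Basic.hyps show ?case
    by (cases rule: exec.cases) auto
next
  case (exec_Seq c \<sigma> k \<sigma>' d l' \<sigma>1)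
  from exec_Seq.prems show ?case
    by (cases rule: exec.cases) (use exec_Seq.IH in blast)+
next
  case (exec_IfTrue b \<sigma> c k \<sigma>' d)
  from exec_IfTrue.prems show ?case
    by (cases rule: exec.cases) (use exec_IfTrue in blast)+
next
  case (exec_IfFalse b \<sigma> d k \<sigma>' c)
  from exec_IfFalse.prems show ?case
    by (cases rule: exec.cases) (use exec_IfFalse in blast)+
next
  case (exec_WhileFalse b \<sigma> c)
  from exec_WhileFalse.prems exec_WhileFalse.hyps show ?case
    by (cases rule: exec.cases) auto
next
  case (exec_WhileTrue b \<sigma> c k \<sigma>' l' \<sigma>1)
  from exec_WhileTrue.prems show ?case
    by (cases rule: exec.cases) (use exec_WhileTrue in blast)+
qed


section \<open>Initial states, execution-logs and the operations on them\<close>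

text \<open>Vertices and spin values are identified with the words that name them.\<close>

record instance_data =
  spins :: "nat set"
  verts :: "nat set"
  init :: "nat \<Rightarrow> nat"
  entries :: "(nat \<times> nat) list"

definition valid :: "instance_data \<Rightarrow> bool" where
  "valid s \<longleftrightarrow> finite (spins s) \<and> finite (verts s) \<and>
     init s \<in> verts s \<rightarrow>\<^sub>E spins s \<and> set (entries s) \<subseteq> verts s \<times> spins s"

definition len :: "instance_data \<Rightarrow> nat" where
  "len s = length (entries s)"

text \<open>The pairs of the log are numbered from 1.\<close>

definition vtx :: "instance_data \<Rightarrow> nat \<Rightarrow> nat" where
  "vtx s i = fst (entries s ! (i - 1))"

definition spin :: "instance_data \<Rightarrow> nat \<Rightarrow> nat" where
  "spin s i = snd (entries s ! (i - 1))"

definition state_at :: "instance_data \<Rightarrow> nat \<Rightarrow> nat \<Rightarrow> nat" where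
  "state_at s t v =
     (if \<exists>i\<in>{1..t}. vtx s i = v then spin s (Max {i\<in>{1..t}. vtx s i = v}) else init s v)"

definition successor :: "instance_data \<Rightarrow> nat \<Rightarrow> nat \<Rightarrow> nat option" where
  "successor s t v =
     (if \<exists>i\<in>{t<..len s}. vtx s i = v then Some (Min {i\<in>{t<..len s}. vtx s i = v}) else None)"

text \<open>
  \<open>AddVertex v c\<close> and \<open>RemoveVertex v\<close> are the dynamic changes of the vertex set: a new vertex
  comes with its initial value \<open>c\<close>, and a vertex can be removed once the log does not mention it.
\<close>

datatype operation =
    Insert nat nat nat
  | Remove nat
  | Update nat nat
  | Eval nat nat
  | Successor nat nat
  | AddVertex nat nat
  | RemoveVertex nat

fun admissible :: "instance_data \<Rightarrow> operation \<Rightarrow> bool" where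
  "admissible s (Insert t v c) \<longleftrightarrow> t \<in> {1..len s + 1} \<and> v \<in> verts s \<and> c \<in> spins s"
| "admissible s (Remove t) \<longleftrightarrow> t \<in> {1..len s}"
| "admissible s (Update t c) \<longleftrightarrow> t \<in> {1..len s} \<and> c \<in> spins s"
| "admissible s (Eval t v) \<longleftrightarrow> t \<in> {0..len s} \<and> v \<in> verts s"
| "admissible s (Successor t v) \<longleftrightarrow> t \<in> {0..len s} \<and> v \<in> verts s"
| "admissible s (AddVertex v c) \<longleftrightarrow> v \<notin> verts s \<and> c \<in> spins s"
| "admissible s (RemoveVertex v) \<longleftrightarrow> v \<in> verts s \<and> v \<notin> fst ` set (entries s)"

fun perform :: "operation \<Rightarrow> instance_data \<Rightarrow> instance_data" where
  "perform (Insert t v c) s =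
     s\<lparr>entries := take (t - 1) (entries s) @ (v, c) # drop (t - 1) (entries s)\<rparr>"
| "perform (Remove t) s = s\<lparr>entries := take (t - 1) (entries s) @ drop t (entries s)\<rparr>"
| "perform (Update t c) s = s\<lparr>entries := (entries s)[t - 1 := (vtx s t, c)]\<rparr>"
| "perform (Eval t v) s = s"
| "perform (Successor t v) s = s"
| "perform (AddVertex v c) s = s\<lparr>verts := insert v (verts s), init := (init s)(v := c)\<rparr>"
| "perform (RemoveVertex v) s = s\<lparr>verts := verts s - {v}, init := (init s)(v := undefined)\<rparr>"


lemma valid_perform:
  assumes "valid s" and "admissible s p"
  shows "valid (perform p s)"
proof -
  have s: "finite (spins s)" "finite (verts s)" "init s \<in> verts s \<rightarrow>\<^sub>E spins s"
    and log: "set (entries s) \<subseteq> verts s \<times> spins s"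
    using assms(1) by (simp_all add: valid_def)
  have log_upd: "valid (s\<lparr>entries := xs\<rparr>)" if "set xs \<subseteq> verts s \<times> spins s" for xs
    using s that by (simp add: valid_def)
  have take: "set (take n (entries s)) \<subseteq> verts s \<times> spins s" for n
    using set_take_subset log by (rule subset_trans)
  have drop: "set (drop n (entries s)) \<subseteq> verts s \<times> spins s" for n
    using set_drop_subset log by (rule subset_trans)
  show ?thesis
  proof (cases p)
    case (Insert t v c)
    then show ?thesis
      using assms(2) take drop by (simp add: log_upd)
  next
    case (Remove t)
    then show ?thesis
      using take drop by (simp add: log_upd)
  next
    case (Update t c)
    then have "t - 1 < length (entries s)" and c: "c \<in> spins s"
      using assms(2) by (auto simp: len_def)
    then have "entries s ! (t - 1) \<in> verts s \<times> spins s"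
      using log nth_mem by (meson subsetD)
    then have "insert (vtx s t, c) (set (entries s)) \<subseteq> verts s \<times> spins s"
      using c log by (simp add: vtx_def mem_Times_iff)
    with set_update_subset_insert
    have "set ((entries s)[t - 1 := (vtx s t, c)]) \<subseteq> verts s \<times> spins s"
      by (rule subset_trans)
    then show ?thesis
      unfolding Update perform.simps by (rule log_upd)
  next
    case (AddVertex v c)
    then have "(init s)(v := c) \<in> insert v (verts s) \<rightarrow>\<^sub>E spins s"
      using assms(2) s(3) PiE_fun_upd[of c "\<lambda>_. spins s" v "init s" "verts s"] by simp
    moreover have "set (entries s) \<subseteq> insert v (verts s) \<times> spins s"
      using log by (rule subset_trans) (rule Sigma_mono, rule subset_insertI, rule subset_refl)
    ultimately show ?thesis
      using s AddVertex by (simp add: valid_def)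
  next
    case (RemoveVertex v)
    have "(init s)(v := undefined) \<in> verts s - {v} \<rightarrow>\<^sub>E spins s"
      using s(3) unfolding PiE_iff extensional_def by simp
    moreover have "set (entries s) \<subseteq> (verts s - {v}) \<times> spins s"
    proof
      fix x
      assume x: "x \<in> set (entries s)"
      then have "fst x \<noteq> v"
        using assms(2) RemoveVertex by auto
      with x log show "x \<in> (verts s - {v}) \<times> spins s"
        by (metis DiffI mem_Times_iff singletonD subsetD)
    qed
    ultimately show ?thesis
      using s RemoveVertex by (simp add: valid_def)
  qed (use assms(1) in simp_all)
qed

text \<open>The answer \<open>\<bottom>\<close> is returned as the word 0, which is not the number of a pair.\<close>

fun answer :: "operation \<Rightarrow> instance_data \<Rightarrow> nat option" where
  "answer (Eval t v) s = Some (state_at s t v)"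
| "answer (Successor t v) s = Some (case successor s t v of None \<Rightarrow> 0 | Some i \<Rightarrow> i)"
| "answer _ s = None"

datatype opkind = INSERT | REMOVE | UPDATE | EVAL | SUCCESSOR | ADD_VERTEX | REMOVE_VERTEX

fun kind :: "operation \<Rightarrow> opkind" where
  "kind (Insert t v c) = INSERT"
| "kind (Remove t) = REMOVE"
| "kind (Update t c) = UPDATE"
| "kind (Eval t v) = EVAL"
| "kind (Successor t v) = SUCCESSOR"
| "kind (AddVertex v c) = ADD_VERTEX"
| "kind (RemoveVertex v) = REMOVE_VERTEX"

fun args :: "operation \<Rightarrow> nat list" where
  "args (Insert t v c) = [t, v, c]"
| "args (Remove t) = [t]"
| "args (Update t c) = [t, c]"
| "args (Eval t v) = [t, v]"
| "args (Successor t v) = [t, v]"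
| "args (AddVertex v c) = [v, c]"
| "args (RemoveVertex v) = [v]"

definition input_regs :: "operation \<Rightarrow> nat \<Rightarrow> nat" where
  "input_regs p r = (if r < length (args p) then args p ! r else 0)"


section \<open>Resource bounds\<close>

text \<open>
  The shift by 2 makes the bounds meaningful for arguments 0 and 1;
  \<open>lg n\<close> is of the same order as \<open>log 2 n\<close> for \<open>n \<ge> 2\<close>.
\<close>

definition lg :: "nat \<Rightarrow> real" where
  "lg n = log 2 (real n + 2)"

definition word_budget :: "nat \<Rightarrow> instance_data \<Rightarrow> nat" where
  "word_budget K s = K * (len s + card (verts s) + 1)"

definition time_budget :: "nat \<Rightarrow> instance_data \<Rightarrow> real" where
  "time_budget K s = real K * ((lg (len s))\<^sup>2 + lg (card (verts s)))"

text \<open>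
  The word lengths \<open>w\<close> that have to suffice: those with at least
  \<open>K * (lg T + lg \<bar>V\<bar> + lg \<bar>Q\<bar>)\<close> bits for which the names of the vertices and of the spin
  values are words at all. If these names have \<open>O(log T + log \<bar>V\<bar> + log \<bar>Q\<bar>)\<close> bits, then so
  has the least such \<open>w\<close>.
\<close>

definition word_length_ok :: "nat \<Rightarrow> instance_data \<Rightarrow> nat \<Rightarrow> bool" where
  "word_length_ok K s w \<longleftrightarrow>
     real K * (lg (len s) + lg (card (verts s)) + lg (card (spins s))) \<le> real w \<and>
     verts s \<union> spins s \<subseteq> {..<2 ^ w}"


section \<open>Dynamic data structures\<close>

text \<open>The list \<open>ws\<close> of words is stored at the addresses \<open>0, 1, \<dots>\<close> of the memory.\<close>

definition stored :: "nat list \<Rightarrow> (nat \<Rightarrow> nat) \<Rightarrow> bool" where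
  "stored ws M \<longleftrightarrow> (\<forall>a<length ws. M a = ws ! a)"

text \<open>
  \<open>rep s ws\<close>: the words \<open>ws\<close> are a representation of \<open>s\<close>. An instance may have several
  representations, since they may depend on the history of the operations.
\<close>

definition stores_within ::
  "nat \<Rightarrow> (instance_data \<Rightarrow> nat list \<Rightarrow> bool) \<Rightarrow> bool" where
  "stores_within K rep \<longleftrightarrow>
     (\<forall>s. valid s \<longrightarrow> (\<exists>ws. rep s ws)) \<and>
     (\<forall>s ws. valid s \<longrightarrow> rep s ws \<longrightarrow>
        length ws \<le> word_budget K s \<and>
        (\<forall>w. word_length_ok K s w \<longrightarrow> set ws \<subseteq> {..<2 ^ w}))"

text \<open>
  The memory outside of the representation holds arbitrary words initially, and the working
  space of an operation is subject to the space bound as well (via the second argument of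
  \<open>exec\<close>). Arguments are passed in the registers \<open>0, 1, 2\<close>, the answer is returned in
  register \<open>0\<close>.
\<close>

definition performs_within ::
  "nat \<Rightarrow> (instance_data \<Rightarrow> nat list \<Rightarrow> bool) \<Rightarrow> (opkind \<Rightarrow> com) \<Rightarrow> bool" where
  "performs_within K rep prog \<longleftrightarrow>
     (\<forall>s p w ws M. let s' = perform p s in
        valid s \<longrightarrow> admissible s p \<longrightarrow> word_length_ok K s w \<longrightarrow> word_length_ok K s' w \<longrightarrow>
        rep s ws \<longrightarrow> stored ws M \<longrightarrow> range M \<subseteq> {..<2 ^ w} \<longrightarrow>
        (\<exists>k R' M' ws'.
           exec w (max (word_budget K s) (word_budget K s')) (prog (kind p))
             (input_regs p, M) k (R', M') \<and>
           real k \<le> time_budget K s \<and>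
           rep s' ws' \<and> stored ws' M' \<and>
           (\<forall>y. answer p s = Some y \<longrightarrow> R' 0 = y)))"

end

(*
The vertices and the log entries are stored in one array of records of ten words. A record belongs
to at most two weight-balanced trees with parent pointers and subtree sizes: the tree G holds the
log entries in the order of the log, and the tree D holds all records, ordered by vertex and then by
position, where the record of a vertex carries its initial value and counts as position 0. The
position of a log entry is not stored; it is computed on the way up to the root of G.

Eval and Successor are searches in D for a pair (v, t). A comparison takes constant time unless the
record belongs to v itself, when it takes time O(log T) for computing a position. By the weight
balance, only O(log T) records of v lie on a search path, although the path has length
O(log (T + |V|)); hence the bound O(log^2 T + log |V|). Apart from such a search, the other
operations insert or delete nodes of the trees in time O(log (T + |V|)). After a deletion, the last record of the array moves into
the gap, so that the records always occupy an initial segment of the memory.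
*)

theory Submission
  imports Defs "HOL-Library.Tree"
begin

section \<open>A language of records and its compilation\<close>

text \<open>Vertex names are arbitrary words, so a table indexed by vertices would break the space
  bound. Ordering D by vertex makes it a dictionary as well: the record with the initial value of
  \<open>v\<close> has position 0 and therefore qualifies in every search for \<open>(v, t)\<close>.
  Positions cannot be stored, because one insertion into the log would shift linearly many of them.
  The records of one vertex form a block of D with at most \<open>T + 1\<close> members (log entries
  plus the initial value), so the number of expensive comparisons depends on \<open>T\<close> alone
  and the factor for computing a position never multiplies \<open>log |V|\<close>. Programs are
  written over natural numbers in a small language, verified with weakest preconditions that carry
  time bounds, and compiled. Overflow is confined to one side condition: sums stay below
  \<open>16 * N\<close>, which covers the addresses \<open>10 * a + f\<close> and the sums in the
  balance tests. The shape of the trees and the numbering of the records depend on the history, so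
  the representation is a relation. That every instance has a representation is obtained by running
  the verified operations themselves from the empty instance.\<close>

datatype exp = Num nat | Reg nat | Fld exp nat | Plus exp exp | Minus exp exp

datatype bexp = Less exp exp | Equal exp exp | Unequal exp exp

datatype cmd =
    Skip
  | Assign nat exp
  | Put exp nat exp
  | Then cmd cmd  (infixr ";;" 60)
  | Cond bexp cmd cmd
  | Loop bexp cmd

type_synonym heap = "nat \<Rightarrow> nat \<Rightarrow> nat"

definition flat :: "heap \<Rightarrow> nat \<Rightarrow> nat" where
  "flat h x = h (x div 10) (x mod 10)"

definition setf :: "heap \<Rightarrow> nat \<Rightarrow> nat \<Rightarrow> nat \<Rightarrow> heap" where
  "setf h a f x = h(a := (h a)(f := x))"

lemma setf_apply: "setf h a f x b g = (if b = a \<and> g = f then x else h b g)"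
  by (simp add: setf_def)

lemma flat_at: "f < 10 \<Longrightarrow> flat h (a * 10 + f) = h a f"
  by (simp add: flat_def)

lemma flat_setf:
  assumes "f < 10"
  shows "(flat h)(a * 10 + f := x) = flat (setf h a f x)"
proof
  fix y
  have "y div 10 = a \<and> y mod 10 = f \<longleftrightarrow> y = a * 10 + f"
  proof
    assume "y div 10 = a \<and> y mod 10 = f"
    then show "y = a * 10 + f" using div_mult_mod_eq[of y 10] by simp
  qed (use assms in simp)
  then show "((flat h)(a * 10 + f := x)) y = flat (setf h a f x) y"
    unfolding flat_def setf_apply by simp
qed

fun ev :: "exp \<Rightarrow> (nat \<Rightarrow> nat) \<Rightarrow> heap \<Rightarrow> nat" where
  "ev (Num n) R h = n"
| "ev (Reg r) R h = R r"
| "ev (Fld e f) R h = h (ev e R h) f"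
| "ev (Plus a b) R h = ev a R h + ev b R h"
| "ev (Minus a b) R h = ev a R h - ev b R h"

fun evb :: "bexp \<Rightarrow> (nat \<Rightarrow> nat) \<Rightarrow> heap \<Rightarrow> bool" where
  "evb (Less a b) R h \<longleftrightarrow> ev a R h < ev b R h"
| "evb (Equal a b) R h \<longleftrightarrow> ev a R h = ev b R h"
| "evb (Unequal a b) R h \<longleftrightarrow> ev a R h \<noteq> ev b R h"

text \<open>
  Registers below 100 hold program variables; \<open>compE e t\<close> leaves the value of \<open>e\<close> in register
  \<open>t\<close> and uses the registers from \<open>t\<close> on as an evaluation stack.
\<close>

fun compE :: "exp \<Rightarrow> nat \<Rightarrow> com" where
  "compE (Num n) t = Basic (Const t n)"
| "compE (Reg r) t = Basic (Move t r)"
| "compE (Fld e f) t =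
     Seq (compE e t) (Seq (Basic (Const (t + 1) 10)) (Seq (Basic (Binop MUL t t (t + 1)))
       (Seq (Basic (Const (t + 1) f)) (Seq (Basic (Binop ADD t t (t + 1))) (Basic (Load t t))))))"
| "compE (Plus a b) t = Seq (compE a t) (Seq (compE b (t + 1)) (Basic (Binop ADD t t (t + 1))))"
| "compE (Minus a b) t = Seq (compE a t) (Seq (compE b (t + 1)) (Basic (Binop SUB t t (t + 1))))"

fun costE :: "exp \<Rightarrow> nat" where
  "costE (Num n) = 1"
| "costE (Reg r) = 1"
| "costE (Fld e f) = costE e + 5"
| "costE (Plus a b) = costE a + costE b + 1"
| "costE (Minus a b) = costE a + costE b + 1"

fun compB :: "bexp \<Rightarrow> com" where
  "compB (Less a b) = Seq (compE a 100) (compE b 101)"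
| "compB (Equal a b) = Seq (compE a 100) (compE b 101)"
| "compB (Unequal a b) = Seq (compE a 100) (compE b 101)"

fun testB :: "bexp \<Rightarrow> test" where
  "testB (Less a b) = LT 100 101"
| "testB (Equal a b) = EQ 100 101"
| "testB (Unequal a b) = NEQ 100 101"

fun costB :: "bexp \<Rightarrow> nat" where
  "costB (Less a b) = costE a + costE b"
| "costB (Equal a b) = costE a + costE b"
| "costB (Unequal a b) = costE a + costE b"

fun compC :: "cmd \<Rightarrow> com" where
  "compC Skip = Basic (Move 100 100)"
| "compC (Assign r e) = Seq (compE e 100) (Basic (Move r 100))"
| "compC (Put a f e) =
     Seq (compE a 100) (Seq (compE e 101) (Seq (Basic (Const 102 10)) (Seq (Basic (Binop MUL 100 100 102))
       (Seq (Basic (Const 102 f)) (Seq (Basic (Binop ADD 100 100 102)) (Basic (Store 100 101)))))))"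
| "compC (c ;; d) = Seq (compC c) (compC d)"
| "compC (Cond b c d) = Seq (compB b) (If (testB b) (compC c) (compC d))"
| "compC (Loop b c) = Seq (compB b) (While (testB b) (Seq (compC c) (compB b)))"

text \<open>The value for a loop is a dummy: \<open>vc\<close> never lets a loop be executed, and
  loops get their time bounds from \<open>wp_Loop_end\<close> and
  \<open>wp_Loop_step\<close>.\<close>

fun cost :: "cmd \<Rightarrow> nat" where
  "cost Skip = 1"
| "cost (Assign r e) = costE e + 1"
| "cost (Put a f e) = costE a + costE e + 5"
| "cost (c ;; d) = cost c + cost d"
| "cost (Cond b c d) = costB b + 1 + max (cost c) (cost d)"
| "cost (Loop b c) = 0"

text \<open>Here \<open>N\<close> bounds the number of records, and hence also all sizes and record numbers.\<close>

locale ram =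
  fixes w m N :: nat
  assumes mem: "10 * N \<le> m" and word: "16 * N \<le> 2 ^ w" and N_gt_1: "1 < N"
begin

text \<open>Sufficient for the evaluation over natural numbers to agree with modular word
  arithmetic. Only sums and minuends are bounded. Registers and fields may hold any word, since
  vertex names and spin values are merely moved and compared.\<close>

fun safe :: "exp \<Rightarrow> (nat \<Rightarrow> nat) \<Rightarrow> heap \<Rightarrow> bool" where
  "safe (Num n) R h \<longleftrightarrow> n \<le> 16"
| "safe (Reg r) R h \<longleftrightarrow> r < 100"
| "safe (Fld e f) R h \<longleftrightarrow> safe e R h \<and> ev e R h < N \<and> f < 10"
| "safe (Plus a b) R h \<longleftrightarrow> safe a R h \<and> safe b R h \<and> ev a R h + ev b R h < 16 * N"
| "safe (Minus a b) R h \<longleftrightarrow> safe a R h \<and> safe b R h \<and> ev b R h \<le> ev a R h \<and> ev a R h < 16 * N"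

fun safeB :: "bexp \<Rightarrow> (nat \<Rightarrow> nat) \<Rightarrow> heap \<Rightarrow> bool" where
  "safeB (Less a b) R h \<longleftrightarrow> safe a R h \<and> safe b R h"
| "safeB (Equal a b) R h \<longleftrightarrow> safe a R h \<and> safe b R h"
| "safeB (Unequal a b) R h \<longleftrightarrow> safe a R h \<and> safe b R h"

definition agree :: "(nat \<Rightarrow> nat) \<Rightarrow> (nat \<Rightarrow> nat) \<Rightarrow> bool" where
  "agree R R' \<longleftrightarrow> (\<forall>r<100. R r = R' r)"

section \<open>Correctness of the compilation\<close>

lemma small_const: "n \<le> 16 \<Longrightarrow> n < (2::nat) ^ w"
  using word N_gt_1 by linarith

lemma field_address:
  assumes "a < N" "f < 10"
  shows "a * 10 < 2 ^ w" "a * 10 + f < 2 ^ w" "a * 10 + f < m"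
  using assms mem word N_gt_1 by linarith+

lemma exec_Seq': "exec w m c \<sigma> k \<sigma>' \<Longrightarrow> exec w m d \<sigma>' l \<sigma>'' \<Longrightarrow> n = k + l \<Longrightarrow> exec w m (Seq c d) \<sigma> n \<sigma>''"
  using exec_Seq by blast

lemma exec_result:
  "exec w m c \<sigma> k (R1, H) \<Longrightarrow> R1 t = x \<Longrightarrow> \<forall>r<t. R1 r = R0 r \<Longrightarrow>
   \<exists>R1. exec w m c \<sigma> k (R1, H) \<and> R1 t = x \<and> (\<forall>r<t. R1 r = R0 r)"
  by blast

text \<open>The register \<open>t\<close> is arbitrary because a second operand is evaluated one
  register higher, on top of the first. Preservation of all registers below \<open>t\<close>
  protects both the first operand and the program variables.\<close>

lemma exec_compE:
  assumes "safe e R h" "agree R0 R" "100 \<le> t"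
  shows "\<exists>R1. exec w m (compE e t) (R0, flat h) (costE e) (R1, flat h) \<and> R1 t = ev e R h \<and> (\<forall>r<t. R1 r = R0 r)"
  using assms
proof (induction e arbitrary: R0 t)
  case (Num n)
  have "exec w m (compE (Num n) t) (R0, flat h) (costE (Num n)) (R0(t := ev (Num n) R h), flat h)"
    unfolding compE.simps costE.simps by (rule exec_Basic) (use Num in \<open>simp add: small_const\<close>)
  then show ?case by (rule exec_result) simp_all
next
  case (Reg r)
  have "exec w m (compE (Reg r) t) (R0, flat h) (costE (Reg r)) (R0(t := ev (Reg r) R h), flat h)"
    unfolding compE.simps costE.simps by (rule exec_Basic) (use Reg in \<open>simp add: agree_def\<close>)
  then show ?case by (rule exec_result) simp_all
next
  case (Fld e f)
  then obtain R1 where R1: "exec w m (compE e t) (R0, flat h) (costE e) (R1, flat h)"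
    "R1 t = ev e R h" "\<forall>r<t. R1 r = R0 r"
    by fastforce
  have b: "ev e R h < N" "f < 10" using Fld.prems by auto
  note fa = field_address[OF b]
  have c: "10 < (2::nat) ^ w" "f < 2 ^ w" using b by (auto intro!: small_const)
  let ?R = "R1(t := ev (Fld e f) R h, t + 1 := f)"
  have e: "exec w m (compE (Fld e f) t) (R0, flat h) (costE (Fld e f)) (?R, flat h)"
    unfolding compE.simps costE.simps
    apply (rule exec_Seq'[OF R1(1)])
     apply (rule exec_Seq', rule exec_Basic, simp)+
        apply (rule exec_Basic)
        apply (simp add: R1(2) fa c fun_upd_twist flat_at[OF b(2)])
       apply simp_all
    done
  show ?case by (rule exec_result[OF e]) (use R1(3) in auto)
next
  case (Plus a b)
  then have s: "safe a R h" "safe b R h" "100 \<le> t + 1" by auto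
  obtain R1 where R1: "exec w m (compE a t) (R0, flat h) (costE a) (R1, flat h)"
    "R1 t = ev a R h" "\<forall>r<t. R1 r = R0 r"
    using Plus.IH(1)[OF s(1) Plus.prems(2,3)] by blast
  have "agree R1 R" using R1(3) Plus.prems by (auto simp: agree_def)
  then obtain R2 where R2: "exec w m (compE b (t + 1)) (R1, flat h) (costE b) (R2, flat h)"
    "R2 (t + 1) = ev b R h" "\<forall>r<t + 1. R2 r = R1 r"
    using Plus.IH(2)[OF s(2) \<open>agree R1 R\<close> s(3)] by blast
  have r: "R2 t = ev a R h" "R2 (t + 1) = ev b R h" using R1(2) R2(2,3) by auto
  have "ev a R h + ev b R h < 2 ^ w" using Plus.prems word by (simp add: less_le_trans)
  with r have "step w m (Binop ADD t t (t + 1)) (R2, flat h) = Some (R2(t := ev (Plus a b) R h), flat h)"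
    by simp
  then have e: "exec w m (compE (Plus a b) t) (R0, flat h) (costE a + (costE b + 1)) (R2(t := ev (Plus a b) R h), flat h)"
    unfolding compE.simps by (intro exec_Seq[OF R1(1)] exec_Seq[OF R2(1)] exec_Basic)
  have c: "costE (Plus a b) = costE a + (costE b + 1)" by simp
  show ?case unfolding c by (rule exec_result[OF e]) (use R1(3) R2(3) in simp_all)
next
  case (Minus a b)
  then have s: "safe a R h" "safe b R h" "100 \<le> t + 1" by auto
  obtain R1 where R1: "exec w m (compE a t) (R0, flat h) (costE a) (R1, flat h)"
    "R1 t = ev a R h" "\<forall>r<t. R1 r = R0 r"
    using Minus.IH(1)[OF s(1) Minus.prems(2,3)] by blast
  have "agree R1 R" using R1(3) Minus.prems by (auto simp: agree_def)
  then obtain R2 where R2: "exec w m (compE b (t + 1)) (R1, flat h) (costE b) (R2, flat h)"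
    "R2 (t + 1) = ev b R h" "\<forall>r<t + 1. R2 r = R1 r"
    using Minus.IH(2)[OF s(2) \<open>agree R1 R\<close> s(3)] by blast
  have r: "R2 t = ev a R h" "R2 (t + 1) = ev b R h" using R1(2) R2(2,3) by auto
  have lt: "ev a R h < 2 ^ w" and le: "ev b R h \<le> ev a R h"
    using Minus.prems word by (simp_all add: less_le_trans)
  have "int (ev a R h) < 2 ^ w" using lt by (metis of_nat_less_iff of_nat_numeral of_nat_power)
  then have "(int (ev a R h) - int (ev b R h)) mod 2 ^ w = int (ev a R h) - int (ev b R h)"
    using le by (intro mod_pos_pos_trivial) linarith+
  then have "nat ((int (ev a R h) - int (ev b R h)) mod 2 ^ w) = ev a R h - ev b R h"
    using le by simp
  with r have "step w m (Binop SUB t t (t + 1)) (R2, flat h) = Some (R2(t := ev (Minus a b) R h), flat h)"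
    by simp
  then have e: "exec w m (compE (Minus a b) t) (R0, flat h) (costE a + (costE b + 1)) (R2(t := ev (Minus a b) R h), flat h)"
    unfolding compE.simps by (intro exec_Seq[OF R1(1)] exec_Seq[OF R2(1)] exec_Basic)
  have c: "costE (Minus a b) = costE a + (costE b + 1)" by simp
  show ?case unfolding c by (rule exec_result[OF e]) (use R1(3) R2(3) in simp_all)
qed

lemma exec_compE2:
  assumes "safe a R h" "safe b R h" "agree R0 R"
  shows "\<exists>R1. exec w m (Seq (compE a 100) (compE b 101)) (R0, flat h) (costE a + costE b) (R1, flat h) \<and>
    R1 100 = ev a R h \<and> R1 101 = ev b R h \<and> agree R1 R"
proof -
  obtain R1 where R1: "exec w m (compE a 100) (R0, flat h) (costE a) (R1, flat h)"
    "R1 100 = ev a R h" "\<forall>r<100. R1 r = R0 r"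
    using exec_compE[OF assms(1,3), of 100] by auto
  have "agree R1 R" using R1(3) assms(3) by (auto simp: agree_def)
  then obtain R2 where R2: "exec w m (compE b 101) (R1, flat h) (costE b) (R2, flat h)"
    "R2 101 = ev b R h" "\<forall>r<101. R2 r = R1 r"
    using exec_compE[OF assms(2), of R1 101] by auto
  have "exec w m (Seq (compE a 100) (compE b 101)) (R0, flat h) (costE a + costE b) (R2, flat h)"
    using R1(1) R2(1) by (rule exec_Seq)
  moreover have "agree R2 R" "R2 100 = ev a R h" using R1 R2 assms(3) by (auto simp: agree_def)
  ultimately show ?thesis using R2(2) by blast
qed

lemma exec_compB:
  assumes "safeB b R h" "agree R0 R"
  shows "\<exists>R1. exec w m (compB b) (R0, flat h) (costB b) (R1, flat h) \<and>
    (test_val (testB b) (R1, flat h) \<longleftrightarrow> evb b R h) \<and> agree R1 R"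
  using assms by (cases b) (use exec_compE2[OF _ _ assms(2)] in fastforce)+

section \<open>A program logic with time bounds\<close>

abbreviation runs :: "cmd \<Rightarrow> nat \<Rightarrow> (nat \<Rightarrow> nat) \<Rightarrow> heap \<Rightarrow> ((nat \<Rightarrow> nat) \<Rightarrow> heap \<Rightarrow> bool) \<Rightarrow> bool" where
  "runs c k R0 h Q \<equiv> \<exists>k' R1 R' h'.
     exec w m (compC c) (R0, flat h) k' (R1, flat h') \<and> k' \<le> k \<and> agree R1 R' \<and> Q R' h'"

text \<open>Total correctness within \<open>k\<close> time units. Initial and final registers matter
  only up to \<open>agree\<close>, so the evaluation stack above register 100 is invisible and
  \<open>Q\<close> can speak about exact register files.\<close>

definition wp :: "cmd \<Rightarrow> nat \<Rightarrow> ((nat \<Rightarrow> nat) \<Rightarrow> heap \<Rightarrow> bool) \<Rightarrow> (nat \<Rightarrow> nat) \<Rightarrow> heap \<Rightarrow> bool" where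
  "wp c k Q R h \<longleftrightarrow> (\<forall>R0. agree R0 R \<longrightarrow> runs c k R0 h Q)"

lemma wp_mono:
  assumes "wp c k Q R h" "k \<le> k'" "\<And>R h. Q R h \<Longrightarrow> Q' R h"
  shows "wp c k' Q' R h"
  using assms unfolding wp_def by (meson le_trans)

lemma wp_Then:
  assumes "wp c k (\<lambda>R h. wp d l Q R h) R h" "k + l \<le> n"
  shows "wp (c ;; d) n Q R h"
  unfolding wp_def
proof (intro allI impI)
  fix R0 assume "agree R0 R"
  then obtain k' R1 R' h' where 1: "exec w m (compC c) (R0, flat h) k' (R1, flat h')" "k' \<le> k"
    "agree R1 R'" "wp d l Q R' h'"
    using assms(1) unfolding wp_def[of c] by blast
  then obtain l' R2 R'' h'' where 2: "exec w m (compC d) (R1, flat h') l' (R2, flat h'')" "l' \<le> l"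
    "agree R2 R''" "Q R'' h''"
    unfolding wp_def[of d] by blast
  have "exec w m (compC (c ;; d)) (R0, flat h) (k' + l') (R2, flat h'')"
    using 1(1) 2(1) by (simp add: exec_Seq)
  moreover have "k' + l' \<le> n" using 1(2) 2(2) assms(2) by linarith
  ultimately show "runs (c ;; d) n R0 h Q"
    using 2 by blast
qed

lemma wp_Cond:
  assumes "safeB b R h" "evb b R h \<Longrightarrow> wp c k Q R h" "\<not> evb b R h \<Longrightarrow> wp d k Q R h"
    "costB b + 1 + k \<le> n"
  shows "wp (Cond b c d) n Q R h"
  unfolding wp_def
proof (intro allI impI)
  fix R0 assume "agree R0 R"
  then obtain R1 where 1: "exec w m (compB b) (R0, flat h) (costB b) (R1, flat h)"
    "test_val (testB b) (R1, flat h) \<longleftrightarrow> evb b R h" "agree R1 R"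
    using exec_compB assms(1) by blast
  have "\<exists>k' R2 R' h'. exec w m (If (testB b) (compC c) (compC d)) (R1, flat h) (Suc k') (R2, flat h') \<and>
      k' \<le> k \<and> agree R2 R' \<and> Q R' h'"
  proof (cases "evb b R h")
    case True
    then show ?thesis using assms(2) 1(2,3) exec_IfTrue unfolding wp_def by meson
  next
    case False
    then show ?thesis using assms(3) 1(2,3) exec_IfFalse unfolding wp_def by meson
  qed
  then obtain k' R2 R' h' where
    2: "exec w m (If (testB b) (compC c) (compC d)) (R1, flat h) (Suc k') (R2, flat h')"
      "k' \<le> k" "agree R2 R'" "Q R' h'" by blast
  have "exec w m (compC (Cond b c d)) (R0, flat h) (costB b + Suc k') (R2, flat h')"
    unfolding compC.simps using 1(1) 2(1) by (rule exec_Seq)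
  moreover have "costB b + Suc k' \<le> n" using 2(2) assms(4) by linarith
  ultimately show "runs (Cond b c d) n R0 h Q"
    using 2 by blast
qed

lemma wp_Loop_end:
  assumes "safeB b R h" "\<not> evb b R h" "Q R h" "costB b + 1 \<le> n"
  shows "wp (Loop b c) n Q R h"
  unfolding wp_def
proof (intro allI impI)
  fix R0 assume "agree R0 R"
  then obtain R1 where 1: "exec w m (compB b) (R0, flat h) (costB b) (R1, flat h)"
    "test_val (testB b) (R1, flat h) \<longleftrightarrow> evb b R h" "agree R1 R"
    using exec_compB assms(1) by blast
  have "exec w m (compC (Loop b c)) (R0, flat h) (costB b + 1) (R1, flat h)"
    using 1(1,2) assms(2) by (simp add: exec_Seq exec_WhileFalse del: One_nat_def add_Suc_right)
  then show "runs (Loop b c) n R0 h Q"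
    using 1(3) assms(3,4) by blast
qed

lemma wp_Loop_step:
  assumes "safeB b R h" "evb b R h" "wp c k (\<lambda>R h. wp (Loop b c) l Q R h) R h"
    "costB b + 1 + k + l \<le> n"
  shows "wp (Loop b c) n Q R h"
  unfolding wp_def
proof (intro allI impI)
  fix R0 assume "agree R0 R"
  then obtain R1 where 1: "exec w m (compB b) (R0, flat h) (costB b) (R1, flat h)"
    "test_val (testB b) (R1, flat h)" "agree R1 R"
    using exec_compB assms(1,2) by blast
  then obtain k' R2 R' h' where 2: "exec w m (compC c) (R1, flat h) k' (R2, flat h')" "k' \<le> k"
    "agree R2 R'" "wp (Loop b c) l Q R' h'"
    using assms(3) unfolding wp_def[of c] by blast
  then obtain l' R3 R'' h'' where 3: "exec w m (compC (Loop b c)) (R2, flat h') l' (R3, flat h'')"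
    "l' \<le> l" "agree R3 R''" "Q R'' h''"
    unfolding wp_def by blast
  \<comment> \<open>The compiled loop evaluates its guard once in front and again at the end of each
    body. The leading evaluation of the remaining loop is split off here and regrouped as the end of
    the first body.\<close>
  from 3(1) obtain l1 l2 \<sigma> where 4: "exec w m (compB b) (R2, flat h') l1 \<sigma>"
    "exec w m (While (testB b) (Seq (compC c) (compB b))) \<sigma> l2 (R3, flat h'')" "l' = l1 + l2"
    by (auto elim: exec.cases)
  have "exec w m (compC (Loop b c)) (R0, flat h) (costB b + Suc ((k' + l1) + l2)) (R3, flat h'')"
    using exec_Seq[OF 1(1) exec_WhileTrue[OF 1(2) exec_Seq[OF 2(1) 4(1)] 4(2)]] by simp
  moreover have "costB b + Suc ((k' + l1) + l2) \<le> n" using 2(2) 3(2) 4(3) assms(4) by linarith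
  ultimately show "runs (Loop b c) n R0 h Q"
    using 3 by blast
qed

lemma wp_Skip: "Q R h \<Longrightarrow> wp Skip 1 Q R h"
  unfolding wp_def
proof (intro allI impI)
  fix R0 assume "Q R h" "agree R0 R"
  moreover have "exec w m (compC Skip) (R0, flat h) 1 (R0, flat h)"
    by (simp only: compC.simps) (rule exec_Basic, simp)
  ultimately show "runs Skip 1 R0 h Q"
    by blast
qed

lemma wp_Assign:
  assumes "r < 100" "safe e R h" "Q (R(r := ev e R h)) h"
  shows "wp (Assign r e) (costE e + 1) Q R h"
  unfolding wp_def
proof (intro allI impI)
  fix R0 assume a: "agree R0 R"
  then obtain R1 where 1: "exec w m (compE e 100) (R0, flat h) (costE e) (R1, flat h)"
    "R1 100 = ev e R h" "\<forall>r<100. R1 r = R0 r"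
    using exec_compE[OF assms(2), of R0 100] by auto
  have "exec w m (compC (Assign r e)) (R0, flat h) (costE e + 1) (R1(r := ev e R h), flat h)"
    unfolding compC.simps by (rule exec_Seq[OF 1(1)], rule exec_Basic) (simp add: 1)
  moreover have "agree (R1(r := ev e R h)) (R(r := ev e R h))" using 1 a by (simp add: agree_def)
  ultimately show "runs (Assign r e) (costE e + 1) R0 h Q"
    using assms(3) by blast
qed

lemma wp_Put:
  assumes "safe a R h" "safe e R h" "ev a R h < N" "f < 10" "Q R (setf h (ev a R h) f (ev e R h))"
  shows "wp (Put a f e) (costE a + costE e + 5) Q R h"
  unfolding wp_def
proof (intro allI impI)
  fix R0 assume a: "agree R0 R"
  obtain R1 where 1: "exec w m (compE a 100) (R0, flat h) (costE a) (R1, flat h)"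
    "R1 100 = ev a R h" "\<forall>r<100. R1 r = R0 r"
    using exec_compE[OF assms(1) a, of 100] by auto
  have "agree R1 R" using 1(3) a by (auto simp: agree_def)
  then obtain R2 where 2: "exec w m (compE e 101) (R1, flat h) (costE e) (R2, flat h)"
    "R2 101 = ev e R h" "\<forall>r<101. R2 r = R1 r"
    using exec_compE[OF assms(2), of R1 101] by auto
  note fa = field_address[OF assms(3,4)]
  have c: "10 < (2::nat) ^ w" "f < 2 ^ w" using assms(4) by (auto intro!: small_const)
  have r: "R2 100 = ev a R h" using 1 2 by simp
  let ?R = "R2(100 := ev a R h * 10 + f, 102 := f)"
  have "exec w m (compC (Put a f e)) (R0, flat h) (costE a + costE e + 5)
      (?R, (flat h)(ev a R h * 10 + f := ev e R h))"
    unfolding compC.simps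
    apply (rule exec_Seq'[OF 1(1)], rule exec_Seq'[OF 2(1)])
      apply (rule exec_Seq', rule exec_Basic, simp)+
         apply (rule exec_Basic)
         apply (simp add: r 2(2) fa c fun_upd_twist)
        apply simp_all
    done
  then have "exec w m (compC (Put a f e)) (R0, flat h) (costE a + costE e + 5)
      (?R, flat (setf h (ev a R h) f (ev e R h)))"
    by (simp only: flat_setf[OF assms(4)])
  moreover have "agree ?R R" using 1 2 a by (simp add: agree_def)
  ultimately show "runs (Put a f e) (costE a + costE e + 5) R0 h Q"
    using assms(5) by blast
qed

text \<open>For code that runs through no loop, the condition is computed by simplification and the
  time bound is simply \<open>cost\<close>. Loops are rejected because they need an
  induction.\<close>

fun vc :: "cmd \<Rightarrow> ((nat \<Rightarrow> nat) \<Rightarrow> heap \<Rightarrow> bool) \<Rightarrow> (nat \<Rightarrow> nat) \<Rightarrow> heap \<Rightarrow> bool" where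
  "vc Skip Q R h \<longleftrightarrow> Q R h"
| "vc (Assign r e) Q R h \<longleftrightarrow> r < 100 \<and> safe e R h \<and> Q (R(r := ev e R h)) h"
| "vc (Put a f e) Q R h \<longleftrightarrow> safe a R h \<and> safe e R h \<and> ev a R h < N \<and> f < 10 \<and>
     Q R (setf h (ev a R h) f (ev e R h))"
| "vc (c ;; d) Q R h \<longleftrightarrow> vc c (\<lambda>R h. vc d Q R h) R h"
| "vc (Cond b c d) Q R h \<longleftrightarrow> safeB b R h \<and> (evb b R h \<longrightarrow> vc c Q R h) \<and> (\<not> evb b R h \<longrightarrow> vc d Q R h)"
| "vc (Loop b c) Q R h \<longleftrightarrow> False"

lemma vc_mono: "vc c Q R h \<Longrightarrow> (\<And>R h. Q R h \<Longrightarrow> Q' R h) \<Longrightarrow> vc c Q' R h"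
proof (induction c arbitrary: Q Q' R h)
  case (Then c d)
  show ?case
    using Then.IH(1)[OF Then.prems(1)[simplified]] Then.IH(2)[OF _ Then.prems(2)] by simp
next
  case (Cond b c d)
  show ?case
    using Cond.prems(1) Cond.IH(1)[where Q = Q and Q' = Q'] Cond.IH(2)[where Q = Q and Q' = Q'] Cond.prems(2)
    unfolding vc.simps by blast
qed auto

lemma vc_wp: "vc c Q R h \<Longrightarrow> wp c (cost c) Q R h"
proof (induction c arbitrary: Q R h)
  case Skip
  then show ?case using wp_Skip by simp
next
  case (Assign r e)
  then show ?case using wp_Assign by simp
next
  case (Put a f e)
  then show ?case using wp_Put by simp
next
  case (Then c d)
  have "wp c (cost c) (\<lambda>R h. vc d Q R h) R h" using Then by simp
  then have "wp c (cost c) (\<lambda>R h. wp d (cost d) Q R h) R h"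
    by (rule wp_mono) (use Then.IH(2) in auto)
  then show ?case by (rule wp_Then) simp
next
  case (Cond b c d)
  show ?case
  proof (rule wp_Cond[where k = "max (cost c) (cost d)"])
    show "safeB b R h" using Cond.prems by simp
    show "wp c (max (cost c) (cost d)) Q R h" if "evb b R h"
      using Cond.IH(1)[of Q R h] Cond.prems that by (auto elim: wp_mono)
    show "wp d (max (cost c) (cost d)) Q R h" if "\<not> evb b R h"
      using Cond.IH(2)[of Q R h] Cond.prems that by (auto elim: wp_mono)
  qed simp
qed simp

lemma vc_wp': "vc c Q R h \<Longrightarrow> cost c \<le> k \<Longrightarrow> wp c k Q R h"
  using vc_wp wp_mono by blast

end

section \<open>Trees and their contexts\<close>

type_synonym frame = "bool \<times> nat \<times> nat tree"

text \<open>
  A frame \<open>(d, a, s)\<close> is a step from a subtree to its parent \<open>a\<close>, the sibling being \<open>s\<close>;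
  \<open>d\<close> says that the subtree is the left child.
\<close>

fun plug :: "nat tree \<Rightarrow> frame list \<Rightarrow> nat tree" where
  "plug t [] = t"
| "plug t ((d, a, s) # c) = plug (if d then Node t a s else Node s a t) c"

fun before :: "frame list \<Rightarrow> nat list" where
  "before [] = []"
| "before ((d, a, s) # c) = before c @ (if d then [] else inorder s @ [a])"

fun after :: "frame list \<Rightarrow> nat list" where
  "after [] = []"
| "after ((d, a, s) # c) = (if d then a # inorder s else []) @ after c"

fun nodes :: "frame list \<Rightarrow> nat set" where
  "nodes [] = {}"
| "nodes ((d, a, s) # c) = insert a (set_tree s \<union> nodes c)"

fun parent :: "frame list \<Rightarrow> nat" where
  "parent [] = 0"
| "parent ((d, a, s) # c) = a"

fun rt :: "nat tree \<Rightarrow> nat" where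
  "rt Leaf = 0"
| "rt (Node l a r) = a"

fun proper :: "frame list \<Rightarrow> bool" where
  "proper [] \<longleftrightarrow> True"
| "proper ((d, a, s) # c) \<longleftrightarrow> a \<noteq> 0 \<and> a \<notin> set_tree s \<and> a \<notin> nodes c \<and> distinct (inorder s) \<and>
     0 \<notin> set_tree s \<and> set_tree s \<inter> nodes c = {} \<and> proper c"

lemma inorder_plug: "inorder (plug t c) = before c @ inorder t @ after c"
  by (induction t c rule: plug.induct) auto

lemma nodes_eq: "nodes c = set (before c) \<union> set (after c)"
  by (induction c rule: nodes.induct) auto

lemma zero_notin_nodes: "proper c \<Longrightarrow> 0 \<notin> nodes c"
  by (induction c rule: proper.induct) auto

lemma distinct_plug:
  "distinct (0 # inorder (plug t c)) \<longleftrightarrow> distinct (0 # inorder t) \<and> proper c \<and> set_tree t \<inter> nodes c = {}"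
proof (induction t c rule: plug.induct)
  case (2 t d a s c)
  then show ?case using zero_notin_nodes[of c] by (cases d) auto
qed auto

lemma set_plug: "set_tree (plug t c) = set_tree t \<union> nodes c"
  by (induction t c rule: plug.induct) auto

lemma plug_exists:
  assumes "a \<in> set_tree t"
  obtains l r c where "t = plug (Node l a r) c"
proof -
  have "\<exists>l r c. plug t c0 = plug (Node l a r) c" for c0
    using assms
  proof (induction t arbitrary: c0)
    case (Node l b r)
    consider "a = b" | "a \<in> set_tree l" | "a \<in> set_tree r" using Node.prems by auto
    then show ?case
    proof cases
      case 2
      then show ?thesis using Node.IH(1)[of "(True, b, r) # c0"] by auto
    next
      case 3
      then show ?thesis using Node.IH(2)[of "(False, b, l) # c0"] by auto
    qed blast
  qed simp
  from this[of "[]"] that show ?thesis by auto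
qed

lemma height_plug: "height t + length c \<le> height (plug t c)"
proof (induction t c rule: plug.induct)
  case (2 t d a s c)
  then show ?case by (cases d) auto
qed auto

section \<open>Weight balance\<close>

definition near :: "nat \<Rightarrow> nat \<Rightarrow> bool" where
  "near x y \<longleftrightarrow> x \<le> 3 * y \<and> y \<le> 3 * x"

fun bal :: "nat tree \<Rightarrow> bool" where
  "bal Leaf \<longleftrightarrow> True"
| "bal (Node l a r) \<longleftrightarrow> near (size1 l) (size1 r) \<and> bal l \<and> bal r"

text \<open>The size \<open>n\<close> of the subtree in the hole is a separate parameter, so that it
  can remain the size from before an update that has added or removed a node there.\<close>

fun cbal :: "frame list \<Rightarrow> nat \<Rightarrow> bool" where
  "cbal [] n \<longleftrightarrow> True"
| "cbal ((d, a, s) # c) n \<longleftrightarrow> near (n + 1) (size1 s) \<and> bal s \<and> cbal c (n + 1 + size s)"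

lemma near_commute: "near x y \<longleftrightarrow> near y x"
  by (auto simp: near_def)

lemma bal_plug: "bal (plug t c) \<longleftrightarrow> bal t \<and> cbal c (size t)"
proof (induction t c rule: plug.induct)
  case (2 t d a s c)
  then show ?case
    by (cases d) (auto simp: size1_size near_commute[of "Suc (size s)"] add_ac)
qed simp

fun rotl :: "nat tree \<Rightarrow> nat tree" where
  "rotl (Node l a (Node m b r)) = Node (Node l a m) b r"
| "rotl t = t"

fun rotr :: "nat tree \<Rightarrow> nat tree" where
  "rotr (Node (Node l b m) a r) = Node l b (Node m a r)"
| "rotr t = t"

text \<open>
  The parameters 3 (in \<open>near\<close>) and 2 are those of Hirai and Yamamoto: with them the rotations restore
  the balance after insertions as well as after deletions.
\<close>

definition rebal :: "nat tree \<Rightarrow> nat \<Rightarrow> nat tree \<Rightarrow> nat tree" where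
  "rebal l a r =
    (if 3 * size1 l < size1 r then
       rotl (Node l a (if size1 (left r) < 2 * size1 (right r) then r else rotr r))
     else if 3 * size1 r < size1 l then
       rotr (Node (if size1 (right l) < 2 * size1 (left l) then l else rotl l) a r)
     else Node l a r)"

lemma inorder_rotl [simp]: "inorder (rotl t) = inorder t"
  by (induction t rule: rotl.induct) auto

lemma inorder_rotr [simp]: "inorder (rotr t) = inorder t"
  by (induction t rule: rotr.induct) auto

lemma inorder_rebal [simp]: "inorder (rebal l a r) = inorder l @ a # inorder r"
  by (simp add: rebal_def)

lemma size_rebal [simp]: "size (rebal l a r) = size l + size r + 1"
  using arg_cong[OF inorder_rebal, of length l a r] by (simp del: inorder_rebal)

text \<open>Here \<open>x\<close> and \<open>y\<close> are the weights before the update; only one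
  side has changed, and by at most one. Once the nodes moved by the single or double rotation are
  exposed, all conditions are linear inequalities between sizes.\<close>

lemma bal_rebal:
  assumes "bal l" "bal r"
    and "near x y" "x \<le> size1 l + 1" "size1 l \<le> x + 1" "y = size1 r \<or> x = size1 l"
      "y \<le> size1 r + 1" "size1 r \<le> y + 1"
  shows "bal (rebal l a r)"
proof -
  consider "3 * size1 l < size1 r" | "3 * size1 r < size1 l" | "near (size1 l) (size1 r)"
    by (force simp: near_def)
  then show ?thesis
  proof cases
    case 1
    then obtain m b r' where r: "r = Node m b r'" by (cases r) (auto simp: size1_size)
    show ?thesis
    proof (cases "size1 m < 2 * size1 r'")
      case True
      then show ?thesis using 1 assms unfolding r rebal_def near_def by (auto simp: near_def size1_size)
    next
      case False
      then obtain u d v where m: "m = Node u d v" using r by (cases m) (auto simp: size1_size)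
      show ?thesis
        using False 1 assms unfolding r m rebal_def by (auto simp: near_def size1_size)
    qed
  next
    case 2
    then obtain m b l' where l: "l = Node l' b m" by (cases l) (auto simp: size1_size)
    show ?thesis
    proof (cases "size1 m < 2 * size1 l'")
      case True
      then show ?thesis using 2 assms unfolding l rebal_def near_def by (auto simp: near_def size1_size)
    next
      case False
      then obtain u d v where m: "m = Node u d v" using l by (cases m) (auto simp: size1_size)
      show ?thesis
        using False 2 assms unfolding l m rebal_def by (auto simp: near_def size1_size)
    qed
  next
    case 3
    then show ?thesis using assms by (auto simp: rebal_def near_def)
  qed
qed

fun fix_up :: "nat tree \<Rightarrow> frame list \<Rightarrow> nat tree" where
  "fix_up t [] = t"
| "fix_up t ((d, a, s) # c) = fix_up (if d then rebal t a s else rebal s a t) c"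

lemma inorder_fix_up [simp]: "inorder (fix_up t c) = before c @ inorder t @ after c"
  by (induction t c rule: fix_up.induct) auto

text \<open>\<open>rebal\<close> keeps the number of nodes, so the discrepancy of at most one
  between old and new size is handed on unchanged from frame to frame.\<close>

lemma bal_fix_up:
  "bal t \<Longrightarrow> cbal c n \<Longrightarrow> size t \<le> n + 1 \<Longrightarrow> n \<le> size t + 1 \<Longrightarrow> bal (fix_up t c)"
proof (induction t c arbitrary: n rule: fix_up.induct)
  case (2 t d a s c)
  have n: "near (n + 1) (size1 s)" "bal s" and c: "cbal c (n + 1 + size s)"
    using "2.prems" by auto
  let ?t = "if d then rebal t a s else rebal s a t"
  have "bal ?t"
    using "2.prems" n near_commute
      bal_rebal[of t s "n + 1" "size1 s" a] bal_rebal[of s t "size1 s" "n + 1" a]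
    by (auto simp: size1_size)
  moreover have "size ?t = size t + 1 + size s" by simp
  ultimately show ?case
    using "2.IH"[OF _ c] "2.prems" by simp
qed simp

text \<open>By \<open>near\<close>, a child has at most 3/4 of the weight of its parent, and
  \<open>(4/3) ^ 3 = 64/27\<close> exceeds 2. So the cube of the weight at least doubles with every
  level.\<close>

lemma bal_height: "bal t \<Longrightarrow> 2 ^ height t \<le> real (size1 t) ^ 3"
proof (induction t)
  case (Node l a r)
  have *: "2 * real x ^ 3 \<le> real (x + y) ^ 3" if "near x y" for x y
  proof -
    have "4 * real x \<le> 3 * real (x + y)" using that by (simp add: near_def)
    then have "(4 * real x) ^ 3 \<le> (3 * real (x + y)) ^ 3" by (intro power_mono) auto
    then have "64 * real x ^ 3 \<le> 27 * real (x + y) ^ 3"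
      unfolding power_mult_distrib by simp
    moreover have "0 \<le> real x ^ 3" by simp
    ultimately show ?thesis by linarith
  qed
  have n: "near (size1 l) (size1 r)" using Node.prems by simp
  have "2 * real (size1 l) ^ 3 \<le> real (size1 l + size1 r) ^ 3"
    "2 * real (size1 r) ^ 3 \<le> real (size1 l + size1 r) ^ 3"
    using *[OF n] *[of "size1 r" "size1 l"] n by (simp_all add: near_commute add.commute)
  then show ?case
    using Node.IH Node.prems by (auto simp: max_def)
qed simp

text \<open>Rounded down to a natural number, since the time bounds of the program logic are natural
  numbers.\<close>

definition hbound :: "nat \<Rightarrow> nat" where
  "hbound n = nat \<lfloor>3 * log 2 (real n + 1)\<rfloor>"

lemma hbound_mono: "m \<le> n \<Longrightarrow> hbound m \<le> hbound n"
  unfolding hbound_def by (intro nat_mono floor_mono) simp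

lemma height_le_hbound:
  assumes "bal t"
  shows "height t \<le> hbound (size t)"
proof -
  have "2 powr real (height t) \<le> real (size1 t) ^ 3" using bal_height[OF assms] by (simp add: powr_realpow)
  then have "real (height t) \<le> log 2 (real (size1 t) ^ 3)"
    by (subst le_log_iff) (auto simp: size1_size)
  also have "\<dots> = 3 * log 2 (real (size1 t))" by (subst log_nat_power) (auto simp: size1_size)
  finally show ?thesis unfolding hbound_def by (intro le_nat_floor) (simp add: size1_size add.commute)
qed

section \<open>Trees in memory\<close>

text \<open>
  The fields \<open>k\<close>, \<open>k + 1\<close>, \<open>k + 2\<close>, \<open>k + 3\<close> of a record hold the left child, the right child, the
  parent and the size. Record 0 plays the role of the empty tree, whose size is read from its
  field \<open>k + 3\<close>, and at the same time that of the parent of the root, which is the left child of 0.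
  Its parent field is scratch space, which makes it unnecessary to test whether a child exists.
\<close>

fun tr :: "nat \<Rightarrow> heap \<Rightarrow> nat tree \<Rightarrow> nat \<Rightarrow> bool" where
  "tr k h Leaf q \<longleftrightarrow> True"
| "tr k h (Node l a r) q \<longleftrightarrow> h a k = rt l \<and> h a (k + 1) = rt r \<and> h a (k + 2) = q \<and>
     h a (k + 3) = size l + size r + 1 \<and> tr k h l a \<and> tr k h r a"

text \<open>
  During an update, the links of the context are intact, but the sizes stored there are those for
  the previous size of the subtree; hence \<open>csz\<close> is separate from \<open>cx\<close>.
\<close>

fun cx :: "nat \<Rightarrow> heap \<Rightarrow> frame list \<Rightarrow> nat \<Rightarrow> bool" where
  "cx k h [] b \<longleftrightarrow> h 0 k = b \<and> h 0 (k + 3) = 0"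
| "cx k h ((d, a, s) # c) b \<longleftrightarrow> h a k = (if d then b else rt s) \<and> h a (k + 1) = (if d then rt s else b) \<and>
     h a (k + 2) = parent c \<and> tr k h s a \<and> cx k h c a"

fun csz :: "nat \<Rightarrow> heap \<Rightarrow> frame list \<Rightarrow> nat \<Rightarrow> bool" where
  "csz k h [] n \<longleftrightarrow> True"
| "csz k h ((d, a, s) # c) n \<longleftrightarrow> h a (k + 3) = n + 1 + size s \<and> csz k h c (n + 1 + size s)"

text \<open>The conditions on record 0 on the left are the base case of \<open>cx\<close>. A tree
  and its zipper are thus interchangeable in memory, and an update can be verified at its focus
  alone.\<close>

lemma tr_plug:
  "tr k h (plug t c) 0 \<and> h 0 k = rt (plug t c) \<and> h 0 (k + 3) = 0 \<longleftrightarrow>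
   tr k h t (parent c) \<and> cx k h c (rt t) \<and> csz k h c (size t)"
proof (induction t c rule: plug.induct)
  case (2 t d a s c)
  then show ?case by (cases d) (auto simp: add_ac)
qed auto

text \<open>Hides the shape: towards the operations a balanced tree is just the list of its
  nodes.\<close>

definition seq :: "nat \<Rightarrow> heap \<Rightarrow> nat list \<Rightarrow> bool" where
  "seq k h xs \<longleftrightarrow> distinct (0 # xs) \<and> (\<exists>t. tr k h t 0 \<and> h 0 k = rt t \<and> h 0 (k + 3) = 0 \<and> bal t \<and> inorder t = xs)"

lemma seq_plug:
  "seq k h (before c @ inorder t @ after c)" 
  if "tr k h t (parent c)" "cx k h c (rt t)" "csz k h c (size t)" "bal t" "cbal c (size t)"
    "distinct (0 # inorder t)" "proper c" "set_tree t \<inter> nodes c = {}"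
  unfolding seq_def using that tr_plug distinct_plug bal_plug inorder_plug by metis

lemma seq_zipper:
  assumes "seq k h xs" "a \<in> set xs"
  obtains l r c where "xs = before c @ inorder l @ a # inorder r @ after c"
    "tr k h (Node l a r) (parent c)" "cx k h c a" "csz k h c (size (Node l a r))"
    "bal (Node l a r)" "cbal c (size (Node l a r))" "distinct (0 # inorder (Node l a r))" "proper c"
    "set_tree (Node l a r) \<inter> nodes c = {}" "height (Node l a r) + length c \<le> hbound (length xs)"
proof -
  obtain t where t: "tr k h t 0 \<and> h 0 k = rt t \<and> h 0 (k + 3) = 0" "bal t" "inorder t = xs" "distinct (0 # xs)"
    using assms(1) unfolding seq_def by blast
  then have "a \<in> set_tree t" using assms(2) set_inorder by metis
  then obtain l r c where p: "t = plug (Node l a r) c" by (rule plug_exists)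
  show thesis
  proof (rule that[of c l r])
    show "xs = before c @ inorder l @ a # inorder r @ after c" using t(3) p inorder_plug by simp
    show "tr k h (Node l a r) (parent c)" "cx k h c a" "csz k h c (size (Node l a r))"
      using t(1) unfolding p tr_plug by simp_all
    show "bal (Node l a r)" "cbal c (size (Node l a r))" using t(2) unfolding p bal_plug by simp_all
    show "distinct (0 # inorder (Node l a r))" "proper c" "set_tree (Node l a r) \<inter> nodes c = {}"
      using t(4) unfolding t(3)[symmetric] p distinct_plug by simp_all
    have "height (Node l a r) + length c \<le> height t" unfolding p by (rule height_plug)
    also have "\<dots> \<le> hbound (length xs)" using height_le_hbound[OF t(2)] t(3) by (metis length_inorder)
    finally show "height (Node l a r) + length c \<le> hbound (length xs)" .
  qed
qed

definition same :: "nat \<Rightarrow> heap \<Rightarrow> heap \<Rightarrow> nat \<Rightarrow> bool" where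
  "same k h h' x \<longleftrightarrow> h' x k = h x k \<and> h' x (k + 1) = h x (k + 1) \<and> h' x (k + 2) = h x (k + 2) \<and>
     h' x (k + 3) = h x (k + 3)"

lemma tr_cong: "\<forall>x\<in>set_tree t. same k h h' x \<Longrightarrow> tr k h' t q \<longleftrightarrow> tr k h t q"
  by (induction t arbitrary: q) (auto simp: same_def)

lemma csz_cong: "\<forall>x\<in>nodes c. h' x (k + 3) = h x (k + 3) \<Longrightarrow> csz k h' c n \<longleftrightarrow> csz k h c n"
  by (induction k h c n rule: csz.induct) auto

lemma cx_cong:
  "\<forall>x\<in>nodes c. same k h h' x \<Longrightarrow> h' 0 k = h 0 k \<Longrightarrow> h' 0 (k + 3) = h 0 (k + 3) \<Longrightarrow> cx k h' c b \<longleftrightarrow> cx k h c b"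
proof (induction k h c b rule: cx.induct)
  case (2 k h d a s c b)
  then show ?case using tr_cong[of s k h h' a] by (simp add: same_def)
qed auto

lemma seq_cong:
  assumes "seq k h xs" "\<forall>x\<in>set xs. same k h h' x" "h' 0 k = h 0 k" "h' 0 (k + 3) = h 0 (k + 3)"
  shows "seq k h' xs"
  using assms unfolding seq_def by (metis set_inorder tr_cong)

lemma tr_parent:
  assumes "tr k h t q" "\<forall>x\<in>set_tree t - {rt t}. same k h h' x"
    "h' (rt t) k = h (rt t) k" "h' (rt t) (k + 1) = h (rt t) (k + 1)" "h' (rt t) (k + 3) = h (rt t) (k + 3)"
    "h' (rt t) (k + 2) = q'" "distinct (inorder t)"
  shows "tr k h' t q'"
proof (cases t)
  case (Node l a r)
  have "\<forall>x\<in>set_tree l. same k h h' x" "\<forall>x\<in>set_tree r. same k h h' x"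
    using assms(2,7) Node by auto
  then have "tr k h' l a = tr k h l a" "tr k h' r a = tr k h r a" by (simp_all add: tr_cong)
  then show ?thesis using assms Node by simp
qed simp

lemma rt_in: "t \<noteq> Leaf \<Longrightarrow> rt t \<in> set_tree t"
  by (cases t) auto

lemma rt_cases: "rt t = 0 \<or> rt t \<in> set_tree t"
  by (cases t) auto

lemma parent_cases: "parent c = 0 \<or> parent c \<in> nodes c"
  by (cases c) auto

definition relink :: "nat \<Rightarrow> heap \<Rightarrow> nat \<Rightarrow> nat \<Rightarrow> nat \<Rightarrow> heap" where
  "relink k h p x y = setf h p (if h p k = x then k else k + 1) y"

text \<open>\<open>relink\<close> inspects the left link only. This identifies the side, because the
  root of the sibling cannot be \<open>x\<close>, which is nonzero and outside of the context; and
  at the top the left link of record 0 is the root.\<close>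

lemma cx_relink:
  assumes "cx k h c x" "x \<noteq> 0" "x \<notin> nodes c" "proper c"
  shows "cx k (relink k h (parent c) x y) c y"
proof (cases c)
  case Nil
  then show ?thesis using assms by (simp add: relink_def setf_apply)
next
  case (Cons f c')
  obtain d a s where f: "f = (d, a, s)" by (cases f)
  let ?h = "relink k h (parent c) x y"
  have a: "rt s \<noteq> x" using assms Cons f rt_cases[of s] by auto
  have "\<forall>z\<in>set_tree s \<union> nodes c'. same k h ?h z" "?h 0 k = h 0 k" "?h 0 (k + 3) = h 0 (k + 3)"
    using assms Cons f by (auto simp: relink_def setf_apply same_def)
  then have "tr k ?h s a = tr k h s a" "cx k ?h c' a = cx k h c' a"
    by (simp_all add: tr_cong cx_cong)
  then show ?thesis
    using assms a Cons f by (auto simp: relink_def setf_apply)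
qed

section \<open>Rotations\<close>

text \<open>The footprint of an operation on the tree at offset \<open>k\<close>. The exempted
  fields of record 0 are the root link and the scratch parent field; the size of the empty tree must
  survive.\<close>

definition frame_of :: "nat \<Rightarrow> nat set \<Rightarrow> heap \<Rightarrow> heap \<Rightarrow> bool" where
  "frame_of k A h h' \<longleftrightarrow>
     (\<forall>y f. y \<in> A \<and> k \<le> f \<and> f < k + 4 \<or> y = 0 \<and> (f = k \<or> f = k + 2) \<or> h' y f = h y f)"

definition keeps :: "nat set \<Rightarrow> (nat \<Rightarrow> nat) \<Rightarrow> (nat \<Rightarrow> nat) \<Rightarrow> bool" where
  "keeps S R R' \<longleftrightarrow> (\<forall>r. r \<notin> S \<longrightarrow> R' r = R r)"

lemma frame_refl: "frame_of k A h h"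
  by (simp add: frame_of_def)

lemma frame_trans:
  "frame_of k A h h' \<Longrightarrow> frame_of k B h' h'' \<Longrightarrow> A \<subseteq> C \<Longrightarrow> B \<subseteq> C \<Longrightarrow> frame_of k C h h''"
  unfolding frame_of_def by (metis subsetD)

lemma keeps_trans: "keeps S R R' \<Longrightarrow> keeps T R' R'' \<Longrightarrow> S \<subseteq> U \<Longrightarrow> T \<subseteq> U \<Longrightarrow> keeps U R R''"
  unfolding keeps_def by (metis subsetD)

definition set_child :: "nat \<Rightarrow> exp \<Rightarrow> exp \<Rightarrow> exp \<Rightarrow> cmd" where
  "set_child k p x y = Cond (Equal (Fld p k) x) (Put p k y) (Put p (k + 1) y)"

definition size_exp :: "nat \<Rightarrow> exp \<Rightarrow> exp" where
  "size_exp k x = Plus (Plus (Fld (Fld x k) (k + 3)) (Fld (Fld x (k + 1)) (k + 3))) (Num 1)"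

text \<open>With \<open>f = k\<close> and \<open>g = k + 1\<close> this is a rotation to the left, and with \<open>f\<close> and \<open>g\<close> exchanged
  one to the right.\<close>

definition rotate :: "nat \<Rightarrow> nat \<Rightarrow> nat \<Rightarrow> nat \<Rightarrow> cmd" where
  "rotate k f g x =
     (Assign 24 (Fld (Reg x) g) ;; Assign 25 (Fld (Reg 24) f) ;; Assign 26 (Fld (Reg x) (k + 2)) ;;
      Put (Reg x) g (Reg 25) ;; Put (Reg 25) (k + 2) (Reg x) ;;
      Put (Reg 24) f (Reg x) ;; Put (Reg x) (k + 2) (Reg 24) ;; Put (Reg 24) (k + 2) (Reg 26)) ;;
     set_child k (Reg 26) (Reg x) (Reg 24) ;;
     Put (Reg x) (k + 3) (size_exp k (Reg x)) ;; Put (Reg 24) (k + 3) (size_exp k (Reg 24))"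

abbreviation turn_child :: "nat \<Rightarrow> nat \<Rightarrow> nat \<Rightarrow> nat \<Rightarrow> cmd" where
  "turn_child k f g y \<equiv>
     Cond (Less (Plus (Fld (Fld (Reg y) f) (k + 3)) (Num 1))
             (Plus (Plus (Fld (Fld (Reg y) g) (k + 3)) (Num 1)) (Plus (Fld (Fld (Reg y) g) (k + 3)) (Num 1))))
       Skip (rotate k g f y)"

text \<open>The parent is saved in register 29 beforehand, since a rotation changes it. The weights
  are read from the children because the size stored at the node may be stale; every branch rewrites
  it.\<close>

definition rebalance :: "nat \<Rightarrow> cmd" where
  "rebalance k =
     (Assign 21 (Fld (Reg 20) k) ;; Assign 22 (Fld (Reg 20) (k + 1)) ;;
      Assign 23 (Plus (Fld (Reg 21) (k + 3)) (Num 1)) ;; Assign 27 (Plus (Fld (Reg 22) (k + 3)) (Num 1)) ;;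
      Assign 29 (Fld (Reg 20) (k + 2))) ;;
     Cond (Less (Plus (Reg 23) (Plus (Reg 23) (Reg 23))) (Reg 27))
       (turn_child k k (k + 1) 22 ;;
        rotate k k (k + 1) 20)
       (Cond (Less (Plus (Reg 27) (Plus (Reg 27) (Reg 27))) (Reg 23))
          (turn_child k (k + 1) k 21 ;;
           rotate k (k + 1) k 20)
          (Put (Reg 20) (k + 3) (Minus (Plus (Reg 23) (Reg 27)) (Num 1)))) ;;
     Assign 20 (Reg 29)"

definition fix_loop :: "nat \<Rightarrow> cmd" where
  "fix_loop k = Loop (Unequal (Reg 20) (Num 0)) (rebalance k)"

lemma tr_size: "tr k h t q \<Longrightarrow> h 0 (k + 3) = 0 \<Longrightarrow> h (rt t) (k + 3) = size t"
  by (cases t) auto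

lemma rt_neq: "x \<noteq> 0 \<Longrightarrow> x \<notin> set_tree t \<Longrightarrow> rt t \<noteq> x"
  using rt_cases[of t] by auto

lemma parent_neq: "x \<noteq> 0 \<Longrightarrow> x \<notin> nodes c \<Longrightarrow> parent c \<noteq> x"
  using parent_cases[of c] by auto

lemma rt_less: "set_tree t \<subseteq> {..<n} \<Longrightarrow> 0 < n \<Longrightarrow> rt t < n"
  using rt_cases[of t] by auto

lemma parent_less: "nodes c \<subseteq> {..<n} \<Longrightarrow> 0 < n \<Longrightarrow> parent c < n"
  using parent_cases[of c] by auto

lemma cx_zero_size: "cx k h c b \<Longrightarrow> h 0 (k + 3) = 0"
  by (induction k h c b rule: cx.induct) auto

context ram
begin

lemma vc_set_child:
  assumes "safe p R h" "safe x R h" "safe y R h" "ev p R h < N" "k + 1 < 10"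
    "Q R (relink k h (ev p R h) (ev x R h) (ev y R h))"
  shows "vc (set_child k p x y) Q R h"
  using assms by (cases "h (ev p R h) k = ev x R h") (simp_all add: set_child_def relink_def)

lemma vc_Then:
  assumes "vc c (\<lambda>S g. S = R' \<and> g = h') R h" "vc d Q R' h'"
  shows "vc (c ;; d) Q R h"
  using vc_mono[OF assms(1), of "\<lambda>S g. vc d Q S g"] assms(2) by simp

lemma vc_CondI:
  "safeB b R h \<Longrightarrow> (evb b R h \<Longrightarrow> vc c Q R h) \<Longrightarrow> (\<not> evb b R h \<Longrightarrow> vc d Q R h) \<Longrightarrow> vc (Cond b c d) Q R h"
  by simp

text \<open>Covers both directions: \<open>f\<close> and \<open>g\<close> are the two child fields
  in either order, and \<open>u\<close> is the subtree that passes from \<open>b\<close> to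
  \<open>a\<close>. Nothing is assumed about the sizes stored at \<open>a\<close> and
  \<open>b\<close>, as both are recomputed.\<close>

lemma vc_rotate:
  assumes R: "R x = a" "x < 100" "x \<notin> {24, 25, 26}" and k: "k \<le> 6"
    and fg: "f = k \<and> g = k + 1 \<or> f = k + 1 \<and> g = k"
    and a: "h a f = rt l" "h a g = b" "h a (k + 2) = parent c"
    and bf: "h b f = rt u" "h b g = rt r"
    and t: "tr k h l a" "tr k h u b" "tr k h r b" "cx k h c a"
    and d: "distinct (0 # a # b # inorder l @ inorder u @ inorder r)" "proper c"
      "(insert a (insert b (set_tree l \<union> set_tree u \<union> set_tree r))) \<inter> nodes c = {}"
    and N: "insert a (insert b (set_tree l \<union> set_tree u \<union> set_tree r)) \<union> nodes c \<subseteq> {..<N}"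
      "size l + size u + size r + 2 < N"
    and Q: "\<And>R' h'. keeps {24, 25, 26} R R' \<Longrightarrow> tr k h' l a \<Longrightarrow> tr k h' u a \<Longrightarrow> tr k h' r b \<Longrightarrow>
      h' b f = a \<Longrightarrow> h' b g = rt r \<Longrightarrow> h' b (k + 2) = parent c \<Longrightarrow> h' b (k + 3) = size l + size u + size r + 2 \<Longrightarrow>
      h' a f = rt l \<Longrightarrow> h' a g = rt u \<Longrightarrow> h' a (k + 2) = b \<Longrightarrow> h' a (k + 3) = size l + size u + 1 \<Longrightarrow>
      cx k h' c b \<Longrightarrow>
      frame_of k (insert a (insert b (set_tree l \<union> set_tree u \<union> set_tree r)) \<union> nodes c) h h' \<Longrightarrow> Q R' h'"
  shows "vc (rotate k f g x) Q R h"
proof -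
  let ?A = "insert a (insert b (set_tree l \<union> set_tree u \<union> set_tree r)) \<union> nodes c"
  define h1 where "h1 = setf (setf (setf (setf (setf h a g (rt u)) (rt u) (k + 2) a) b f a)
    a (k + 2) b) b (k + 2) (parent c)"
  define h2 where "h2 = relink k h1 (parent c) a b"
  define h4 where "h4 = setf (setf h2 a (k + 3) (size l + size u + 1)) b (k + 3) (size l + size u + size r + 2)"
  note defs = h4_def h2_def h1_def relink_def setf_apply
  have "f \<noteq> g" "f \<noteq> k + 2" "f \<noteq> k + 3" "g \<noteq> k + 2" "g \<noteq> k + 3" using fg by auto
  note nfg = this this[symmetric] this[simplified] this[symmetric, simplified]
  have fg10: "f < 10" "g < 10" using fg k by auto
  have ab: "a \<noteq> 0" "b \<noteq> 0" "a \<noteq> b" using d by auto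
  have out: "a \<notin> set_tree l" "a \<notin> set_tree u" "a \<notin> set_tree r" "a \<notin> nodes c"
    "b \<notin> set_tree l" "b \<notin> set_tree u" "b \<notin> set_tree r" "b \<notin> nodes c"
    using d by auto
  have disj: "set_tree l \<inter> set_tree u = {}" "set_tree l \<inter> set_tree r = {}" "set_tree u \<inter> set_tree r = {}"
    "set_tree l \<inter> nodes c = {}" "set_tree u \<inter> nodes c = {}" "set_tree r \<inter> nodes c = {}"
    "0 \<notin> set_tree l" "0 \<notin> set_tree u" "0 \<notin> set_tree r" "0 \<notin> nodes c" "distinct (inorder u)"
    using d zero_notin_nodes by auto
  have "rt u \<noteq> a" "rt u \<noteq> b" "rt l \<noteq> a" "rt l \<noteq> b" "rt r \<noteq> a" "rt r \<noteq> b" "parent c \<noteq> a" "parent c \<noteq> b"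
    using ab out by (simp_all add: rt_neq parent_neq)
  note ne = ab this ab[symmetric] this[symmetric]
  have lt: "a < N" "b < N" "rt l < N" "rt u < N" "rt r < N" "parent c < N"
    using N(1) N_gt_1 by (simp_all add: rt_less parent_less)
  have z: "h 0 (k + 3) = 0" using t(4) by (rule cx_zero_size)
  have sz: "h (rt l) (k + 3) = size l" "h (rt u) (k + 3) = size u" "h (rt r) (k + 3) = size r"
    using tr_size[OF t(1) z] tr_size[OF t(2) z] tr_size[OF t(3) z] .
  have unch: "y \<notin> {a, b, rt u, parent c} \<Longrightarrow> same k h h4 y" for y
    by (auto simp: same_def defs)
  have "tr k h4 l a = tr k h l a"
    by (rule tr_cong, intro ballI unch) (use out disj rt_cases[of u] parent_cases[of c] in auto)
  then have tl: "tr k h4 l a" using t(1) by simp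
  have "tr k h4 r b = tr k h r b"
    by (rule tr_cong, intro ballI unch) (use out disj rt_cases[of u] parent_cases[of c] in auto)
  then have trr: "tr k h4 r b" using t(3) by simp
  have p: "rt u \<noteq> parent c" if "u \<noteq> Leaf"
    using rt_in[OF that] disj parent_cases[of c] by auto
  have tm: "tr k h4 u a"
  proof (cases "u = Leaf")
    case False
    show ?thesis
    proof (rule tr_parent[OF t(2)])
      show "\<forall>y\<in>set_tree u - {rt u}. same k h h4 y"
        by (intro ballI unch) (use out disj parent_cases[of c] in auto)
    qed (use ne out disj p[OF False] in \<open>simp_all add: defs\<close>)
  qed simp
  have "y \<notin> {a, b, rt u} \<Longrightarrow> same k h h1 y" for y by (simp add: same_def h1_def setf_apply)
  moreover have "y \<notin> {a, b, rt u}" if "y \<in> nodes c" for y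
    using that out disj rt_cases[of u] by auto
  ultimately have "cx k h1 c a = cx k h c a"
    by (intro cx_cong ballI) (use ab in \<open>auto simp: h1_def setf_apply\<close>)
  then have c1: "cx k h1 c a" using t(4) by simp
  have c2: "cx k h2 c b" unfolding h2_def by (rule cx_relink[OF c1]) (use ne out d(2) in simp_all)
  have "y \<notin> {a, b} \<Longrightarrow> same k h2 h4 y" for y by (simp add: same_def h4_def setf_apply)
  moreover have "y \<notin> {a, b}" if "y \<in> nodes c" for y using that out by auto
  ultimately have "cx k h4 c b = cx k h2 c b"
    by (intro cx_cong ballI) (use ab in \<open>auto simp: h4_def setf_apply\<close>)
  then have c4: "cx k h4 c b" using c2 by simp
  have T: "h4 b f = a" "h4 b g = rt r" "h4 b (k + 2) = parent c" "h4 b (k + 3) = size l + size u + size r + 2"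
    "h4 a f = rt l" "h4 a g = rt u" "h4 a (k + 2) = b" "h4 a (k + 3) = size l + size u + 1"
    by (simp_all add: defs a bf ne nfg del: One_nat_def)
  have F: "frame_of k ?A h h4"
    unfolding frame_of_def
  proof (intro allI)
    fix y e
    consider "y = 0" | "y \<in> ?A" | "y \<noteq> 0" "y \<notin> ?A" by blast
    then show "y \<in> ?A \<and> k \<le> e \<and> e < k + 4 \<or> y = 0 \<and> (e = k \<or> e = k + 2) \<or> h4 y e = h y e"
    proof cases
      case 1
      \<comment> \<open>A rotation at the root must redirect the root link and not field
        \<open>k + 1\<close> of record 0, which \<open>frame_of\<close> does not exempt.\<close>
      have "parent c = 0 \<Longrightarrow> h1 0 k = a" using c1 d(2) by (cases c) auto
      then have "h4 0 e = h 0 e" if "e \<notin> {k, k + 2}"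
        using that ne(1,2) by (auto simp: h4_def h2_def relink_def setf_apply h1_def)
      with 1 show ?thesis by auto
    next
      case 2
      then have "h4 y e = h y e" if "e \<notin> {k, k + 1, k + 2, k + 3}"
        using that fg by (auto simp: defs)
      moreover have "e \<notin> {k, k + 1, k + 2, k + 3}" if "\<not> (k \<le> e \<and> e < k + 4)" using that by auto
      ultimately show ?thesis using 2 by blast
    next
      case 3
      then have "y \<notin> {a, b, rt u, parent c}" using rt_cases[of u] parent_cases[of c] by auto
      then show ?thesis by (simp add: defs)
    qed
  qed
  let ?R = "R(24 := b, 25 := rt u, 26 := parent c)"
  have K: "keeps {24, 25, 26} R ?R"
    by (simp add: keeps_def)
  have xn: "x \<noteq> 24" "x \<noteq> 25" "x \<noteq> 26" using R(3) by auto
  have x: "?R x = a" "?R 24 = b" "?R 25 = rt u" "?R 26 = parent c" using R by auto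
  have h2: "h2 a f = rt l" "h2 a g = rt u" "h2 b f = a" "h2 b g = rt r" "h2 y (k + 3) = h y (k + 3)" for y
    by (simp_all add: h2_def h1_def relink_def setf_apply a bf ne nfg del: One_nat_def)
  \<comment> \<open>\<open>size_exp\<close> is symmetric in the two children, so both orientations
    yield the same sizes.\<close>
  from fg h2(1-4) have
    "h2 a k = rt l \<and> h2 a (k + 1) = rt u \<and> h2 b k = a \<and> h2 b (k + 1) = rt r \<or>
     h2 a k = rt u \<and> h2 a (k + 1) = rt l \<and> h2 b k = rt r \<and> h2 b (k + 1) = a" by blast
  then have se: "ev (size_exp k (Reg x)) ?R h2 = size l + size u + 1 \<and>
      ev (size_exp k (Reg 24)) ?R (setf h2 a (k + 3) (size l + size u + 1)) = size l + size u + size r + 2 \<and>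
      safe (size_exp k (Reg x)) ?R h2 \<and>
      safe (size_exp k (Reg 24)) ?R (setf h2 a (k + 3) (size l + size u + 1))"
    using k N(2) by (elim disjE conjE) (simp_all add: size_exp_def R(1,2) xn lt ne sz setf_apply h2(5))
  show "vc (rotate k f g x) Q R h"
    unfolding rotate_def
  proof (rule vc_Then[where R' = ?R and h' = h1], goal_cases)
    case 1
    show ?case using k unfolding h1_def
      by (simp add: R(1,2) xn lt a bf ne nfg setf_apply fg10 del: One_nat_def add_2_eq_Suc')
  next
    case 2
    show ?case
    proof (rule vc_Then[where R' = ?R and h' = h2], goal_cases)
      case 1
      show ?case unfolding h2_def
        by (rule vc_set_child) (use k R(1,2) xn lt in simp_all)
    next
      case 2
      have "Q ?R h4" using Q K T F c4 tl tm trr by blast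
      then show ?case using k R(1,2) xn lt se unfolding h4_def by simp
    qed
  qed
qed

text \<open>Stated through the inorder list only, hence invariant under rotations and independent of
  the point of focus.\<close>

definition fits :: "nat tree \<Rightarrow> frame list \<Rightarrow> bool" where
  "fits t c \<longleftrightarrow> distinct (0 # inorder (plug t c)) \<and> set (inorder (plug t c)) \<subseteq> {..<N}"

lemma fitsD:
  assumes "fits t c"
  shows "distinct (0 # inorder t)" "proper c" "set_tree t \<inter> nodes c = {}"
    "set_tree t \<union> nodes c \<subseteq> {..<N}" "size t < N"
proof -
  from assms show "distinct (0 # inorder t)" "proper c" "set_tree t \<inter> nodes c = {}"
    unfolding fits_def distinct_plug by simp_all
  show *: "set_tree t \<union> nodes c \<subseteq> {..<N}"
    using assms by (simp add: fits_def set_plug)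
  \<comment> \<open>Counting the null record 0 among the distinct numbers below \<open>N\<close>
    makes the bound strict.\<close>
  have "size t + 1 = length (0 # inorder t)" by simp
  also have "\<dots> = card (set (0 # inorder t))"
    using \<open>distinct (0 # inorder t)\<close> by (metis distinct_card)
  also have "\<dots> \<le> card {..<N}" using * N_gt_1 by (intro card_mono) auto
  finally show "size t < N" by simp
qed

definition linked :: "nat \<Rightarrow> heap \<Rightarrow> nat tree \<Rightarrow> frame list \<Rightarrow> bool" where
  "linked k h t c \<longleftrightarrow> tr k h t (parent c) \<and> cx k h c (rt t) \<and> fits t c"

text \<open>As \<open>linked\<close>, but the size stored at the root of the subtree may be wrong.\<close>

definition hole :: "nat \<Rightarrow> heap \<Rightarrow> nat tree \<Rightarrow> nat \<Rightarrow> nat tree \<Rightarrow> frame list \<Rightarrow> bool" where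
  "hole k h l a r c \<longleftrightarrow> h a k = rt l \<and> h a (k + 1) = rt r \<and> h a (k + 2) = parent c \<and>
     tr k h l a \<and> tr k h r a \<and> cx k h c a \<and> fits (Node l a r) c"

lemma hole_right: "hole k h l a (Node u b r) c \<Longrightarrow> hole k h u b r ((False, a, l) # c)"
  by (simp add: hole_def fits_def)

lemma hole_left: "hole k h (Node l b u) a r c \<Longrightarrow> hole k h l b u ((True, a, r) # c)"
  by (simp add: hole_def fits_def)

lemma linked_right: "linked k h r ((False, a, l) # c) \<Longrightarrow> hole k h l a r c"
  by (simp add: hole_def linked_def fits_def)

lemma linked_left: "linked k h l ((True, a, r) # c) \<Longrightarrow> hole k h l a r c"
  by (simp add: hole_def linked_def fits_def)

lemma vc_rotl:
  assumes "R x = a" "x < 100" "x \<notin> {24, 25, 26}" "k \<le> 6" "hole k h l a (Node u b r) c"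
    and Q: "\<And>R' h'. keeps {24, 25, 26} R R' \<Longrightarrow> linked k h' (Node (Node l a u) b r) c \<Longrightarrow>
      frame_of k (set_tree (Node l a (Node u b r)) \<union> nodes c) h h' \<Longrightarrow> Q R' h'"
  shows "vc (rotate k k (k + 1) x) Q R h"
proof (rule vc_rotate)
  note H = assms(5)[unfolded hole_def]
  then have F: "fits (Node l a (Node u b r)) c" by simp
  note fitsD = fitsD[OF F]
  show "R x = a" "x < 100" "x \<notin> {24, 25, 26}" "k \<le> 6" "k = k \<and> k + 1 = k + 1 \<or> k = k + 1 \<and> k + 1 = k"
    using assms by auto
  show "h a k = rt l" "h a (k + 1) = b" "h a (k + 2) = parent c" "h b k = rt u" "h b (k + 1) = rt r"
    "tr k h l a" "tr k h u b" "tr k h r b" "cx k h c a"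
    using H by auto
  show "proper c" by (rule fitsD)
  show "distinct (0 # a # b # inorder l @ inorder u @ inorder r)" using fitsD(1) by auto
  show "insert a (insert b (set_tree l \<union> set_tree u \<union> set_tree r)) \<inter> nodes c = {}" using fitsD(3) by auto
  show "insert a (insert b (set_tree l \<union> set_tree u \<union> set_tree r)) \<union> nodes c \<subseteq> {..<N}" using fitsD(4) by auto
  show "size l + size u + size r + 2 < N" using fitsD(5) by simp
  have F': "fits (Node (Node l a u) b r) c" using F by (simp add: fits_def inorder_plug)
  fix R' h'
  assume 1: "keeps {24, 25, 26} R R'" "tr k h' l a" "tr k h' u a" "tr k h' r b"
      "h' b k = a" "h' b (k + 1) = rt r" "h' b (k + 2) = parent c" "h' b (k + 3) = size l + size u + size r + 2"
      "h' a k = rt l" "h' a (k + 1) = rt u" "h' a (k + 2) = b" "h' a (k + 3) = size l + size u + 1"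
      "cx k h' c b"
  assume "frame_of k (insert a (insert b (set_tree l \<union> set_tree u \<union> set_tree r)) \<union> nodes c) h h'"
  moreover have "insert a (insert b (set_tree l \<union> set_tree u \<union> set_tree r)) = set_tree (Node l a (Node u b r))"
    by auto
  moreover have "linked k h' (Node (Node l a u) b r) c"
    using 1 F' by (simp add: linked_def)
  ultimately show "Q R' h'" using Q[OF 1(1)] by simp
qed

lemma vc_rotr:
  assumes "R x = a" "x < 100" "x \<notin> {24, 25, 26}" "k \<le> 6" "hole k h (Node l b u) a r c"
    and Q: "\<And>R' h'. keeps {24, 25, 26} R R' \<Longrightarrow> linked k h' (Node l b (Node u a r)) c \<Longrightarrow>
      frame_of k (set_tree (Node (Node l b u) a r) \<union> nodes c) h h' \<Longrightarrow> Q R' h'"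
  shows "vc (rotate k (k + 1) k x) Q R h"
proof (rule vc_rotate)
  note H = assms(5)[unfolded hole_def]
  then have F: "fits (Node (Node l b u) a r) c" by simp
  note fitsD = fitsD[OF F]
  show "R x = a" "x < 100" "x \<notin> {24, 25, 26}" "k \<le> 6" "k + 1 = k \<and> k = k + 1 \<or> k + 1 = k + 1 \<and> k = k"
    using assms by auto
  show "h a (k + 1) = rt r" "h a k = b" "h a (k + 2) = parent c" "h b (k + 1) = rt u" "h b k = rt l"
    "tr k h r a" "tr k h u b" "tr k h l b" "cx k h c a"
    using H by auto
  show "proper c" by (rule fitsD)
  show "distinct (0 # a # b # inorder r @ inorder u @ inorder l)" using fitsD(1) by auto
  show "insert a (insert b (set_tree r \<union> set_tree u \<union> set_tree l)) \<inter> nodes c = {}" using fitsD(3) by auto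
  show "insert a (insert b (set_tree r \<union> set_tree u \<union> set_tree l)) \<union> nodes c \<subseteq> {..<N}" using fitsD(4) by auto
  show "size r + size u + size l + 2 < N" using fitsD(5) by simp
  have F': "fits (Node l b (Node u a r)) c" using F by (simp add: fits_def inorder_plug)
  fix R' h'
  assume 1: "keeps {24, 25, 26} R R'" "tr k h' r a" "tr k h' u a" "tr k h' l b"
      "h' b (k + 1) = a" "h' b k = rt l" "h' b (k + 2) = parent c" "h' b (k + 3) = size r + size u + size l + 2"
      "h' a (k + 1) = rt r" "h' a k = rt u" "h' a (k + 2) = b" "h' a (k + 3) = size r + size u + 1"
      "cx k h' c b"
  assume "frame_of k (insert a (insert b (set_tree r \<union> set_tree u \<union> set_tree l)) \<union> nodes c) h h'"
  moreover have "insert a (insert b (set_tree r \<union> set_tree u \<union> set_tree l)) = set_tree (Node (Node l b u) a r)"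
    by auto
  moreover have "linked k h' (Node l b (Node u a r)) c"
    using 1 F' by (simp add: linked_def)
  ultimately show "Q R' h'" using Q[OF 1(1)] by simp
qed

lemma vc_rebalance:
  assumes R: "R 20 = a" and k: "k \<le> 6" and H: "hole k h l a r c"
    and Q: "\<And>R' h'. keeps {20..29} R R' \<Longrightarrow> R' 20 = parent c \<Longrightarrow> linked k h' (rebal l a r) c \<Longrightarrow>
      frame_of k (set_tree (Node l a r) \<union> nodes c) h h' \<Longrightarrow> Q R' h'"
  shows "vc (rebalance k) Q R h"
proof -
  let ?A = "set_tree (Node l a r) \<union> nodes c"
  let ?R = "R(21 := rt l, 22 := rt r, 23 := size l + 1, 27 := size r + 1, 29 := parent c)"
  note h = H[unfolded hole_def]
  then have F: "fits (Node l a r) c" by simp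
  note fitsD = fitsD[OF F]
  have z: "h 0 (k + 3) = 0" using h cx_zero_size by blast
  have sz: "h (rt l) (k + 3) = size l" "h (rt r) (k + 3) = size r"
    using h tr_size[where k = k and h = h] z by blast+
  have lt: "a < N" "rt l < N" "rt r < N" "size l + size r + 1 < N"
    using fitsD(4,5) N_gt_1 rt_less[of l N] rt_less[of r N] by auto
  have fin: "vc (Assign 20 (Reg 29)) Q R' h'"
    if "keeps {24, 25, 26} ?R R'" "linked k h' (rebal l a r) c" "frame_of k ?A h h'" for R' h'
  proof -
    have "keeps {20..29} R (R'(20 := parent c))" using that(1) by (auto simp: keeps_def)
    moreover have "R' 29 = parent c" using that(1) by (simp add: keeps_def)
    ultimately show ?thesis using Q that(2,3) by simp
  qed
  let ?L = "turn_child k k (k + 1) 22"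
  let ?M = "turn_child k (k + 1) k 21"
  have left: "vc (?L ;; rotate k k (k + 1) 20) (\<lambda>R h. vc (Assign 20 (Reg 29)) Q R h) ?R h"
    if c1: "3 * size1 l < size1 r"
  proof -
    obtain u b r' where r: "r = Node u b r'" using c1 by (cases r) (auto simp: size1_size)
    have hb: "h b k = rt u" "h b (k + 1) = rt r'" "tr k h u b" "tr k h r' b" using h r by auto
    have sb: "h (rt u) (k + 3) = size u" "h (rt r') (k + 3) = size r'"
      using hb tr_size[where k = k and h = h] z by blast+
    have ltb: "b < N" "rt u < N" "rt r' < N" "size u + size r' + 2 < N"
      using fitsD(4,5) N_gt_1 rt_less[of u N] rt_less[of r' N] unfolding r by auto
    let ?r = "if size1 (left r) < 2 * size1 (right r) then r else rotr r"
    have "vc ?L (\<lambda>R' h'. keeps {24, 25, 26} ?R R' \<and> hole k h' l a ?r c \<and> frame_of k ?A h h') ?R h"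
    proof (cases "size1 u < 2 * size1 r'")
      case True
      then show ?thesis using k H ltb
        by (simp add: r ltb hb[simplified] sb[simplified] size1_size frame_refl keeps_def)
    next
      case False
      then obtain p d v where u: "u = Node p d v" using r by (cases u) (auto simp: size1_size)
      \<comment> \<open>The inner rotation of a double rotation takes place at the child
        \<open>b\<close>, in the context extended by the frame of \<open>a\<close>. Afterwards the
        focus returns to \<open>a\<close>, where \<open>hole\<close> tolerates the stale
        size.\<close>
      have "vc (rotate k (k + 1) k 22)
        (\<lambda>R' h'. keeps {24, 25, 26} ?R R' \<and> hole k h' l a ?r c \<and> frame_of k ?A h h') ?R h"
      proof (rule vc_rotr[where a = b and l = p and b = d and u = v and r = r' and c = "(False, a, l) # c"])
        show "hole k h \<langle>p, d, v\<rangle> b r' ((False, a, l) # c)" using H hole_right unfolding r u by blast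
        fix R' h'
        assume 1: "keeps {24, 25, 26} ?R R'" "linked k h' \<langle>p, d, \<langle>v, b, r'\<rangle>\<rangle> ((False, a, l) # c)"
          "frame_of k (set_tree \<langle>\<langle>p, d, v\<rangle>, b, r'\<rangle> \<union> nodes ((False, a, l) # c)) h h'"
        have "hole k h' l a ?r c" using linked_right[OF 1(2)] False by (simp add: r u)
        moreover have "set_tree \<langle>\<langle>p, d, v\<rangle>, b, r'\<rangle> \<union> nodes ((False, a, l) # c) = ?A"
          by (auto simp: r u)
        ultimately show "keeps {24, 25, 26} ?R R' \<and> hole k h' l a ?r c \<and> frame_of k ?A h h'"
          using 1 by simp
      qed (use k r in auto)
      then show ?thesis using k False ltb
        by (simp add: r ltb hb[simplified] sb[simplified] size1_size)
    qed
    moreover have "vc (rotate k k (k + 1) 20) (\<lambda>R h. vc (Assign 20 (Reg 29)) Q R h) R1 h1"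
      if 1: "keeps {24, 25, 26} ?R R1" "hole k h1 l a ?r c" "frame_of k ?A h h1" for R1 h1
    proof -
      obtain u1 b1 r1 where r1: "?r = Node u1 b1 r1"
        by (cases "size1 u < 2 * size1 r'"; cases u) (auto simp: r size1_size)
      have A: "set_tree (Node l a (Node u1 b1 r1)) = set_tree (Node l a r)"
      proof -
        have "inorder (Node u1 b1 r1) = inorder r" unfolding r1[symmetric] by simp
        then have "set_tree (Node u1 b1 r1) = set_tree r" by (metis set_inorder)
        then show ?thesis by simp
      qed
      have rb: "rebal l a r = Node (Node l a u1) b1 r1" using c1 r1 by (simp add: rebal_def)
      show ?thesis
      proof (rule vc_rotl)
        show "hole k h1 l a (Node u1 b1 r1) c" using 1(2) r1 by simp
        show "R1 20 = a" using 1(1) R by (simp add: keeps_def)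
        fix R2 h2 assume 2: "keeps {24, 25, 26} R1 R2" "linked k h2 (Node (Node l a u1) b1 r1) c"
          "frame_of k (set_tree (Node l a (Node u1 b1 r1)) \<union> nodes c) h1 h2"
        show "vc (Assign 20 (Reg 29)) Q R2 h2"
          by (rule fin) (use 1 2 A rb in \<open>auto intro: keeps_trans frame_trans\<close>)
      qed (use k in auto)
    qed
    ultimately show ?thesis unfolding vc.simps(4) by (elim vc_mono conjE)
  qed
  have right: "vc (?M ;; rotate k (k + 1) k 20) (\<lambda>R h. vc (Assign 20 (Reg 29)) Q R h) ?R h"
    if c1: "3 * size1 r < size1 l"
  proof -
    obtain l' b u where l: "l = Node l' b u" using c1 by (cases l) (auto simp: size1_size)
    have hb: "h b k = rt l'" "h b (k + 1) = rt u" "tr k h l' b" "tr k h u b" using h l by auto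
    have sb: "h (rt u) (k + 3) = size u" "h (rt l') (k + 3) = size l'"
      using hb tr_size[where k = k and h = h] z by blast+
    have ltb: "b < N" "rt u < N" "rt l' < N" "size u + size l' + 2 < N"
      using fitsD(4,5) N_gt_1 rt_less[of u N] rt_less[of l' N] unfolding l by auto
    let ?l = "if size1 (right l) < 2 * size1 (left l) then l else rotl l"
    have "vc ?M (\<lambda>R' h'. keeps {24, 25, 26} ?R R' \<and> hole k h' ?l a r c \<and> frame_of k ?A h h') ?R h"
    proof (cases "size1 u < 2 * size1 l'")
      case True
      then show ?thesis using k H ltb
        by (simp add: l ltb hb[simplified] sb[simplified] size1_size frame_refl keeps_def)
    next
      case False
      then obtain p d v where u: "u = Node p d v" using l by (cases u) (auto simp: size1_size)
      have "vc (rotate k k (k + 1) 21)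
        (\<lambda>R' h'. keeps {24, 25, 26} ?R R' \<and> hole k h' ?l a r c \<and> frame_of k ?A h h') ?R h"
      proof (rule vc_rotl[where a = b and l = l' and u = p and b = d and r = v and c = "(True, a, r) # c"])
        show "hole k h l' b \<langle>p, d, v\<rangle> ((True, a, r) # c)" using H hole_left unfolding l u by blast
        fix R' h'
        assume 1: "keeps {24, 25, 26} ?R R'" "linked k h' \<langle>\<langle>l', b, p\<rangle>, d, v\<rangle> ((True, a, r) # c)"
          "frame_of k (set_tree \<langle>l', b, \<langle>p, d, v\<rangle>\<rangle> \<union> nodes ((True, a, r) # c)) h h'"
        have "hole k h' ?l a r c" using linked_left[OF 1(2)] False by (simp add: l u)
        moreover have "set_tree \<langle>l', b, \<langle>p, d, v\<rangle>\<rangle> \<union> nodes ((True, a, r) # c) = ?A"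
          by (auto simp: l u)
        ultimately show "keeps {24, 25, 26} ?R R' \<and> hole k h' ?l a r c \<and> frame_of k ?A h h'"
          using 1 by simp
      qed (use k l in auto)
      then show ?thesis using k False ltb
        by (simp add: l ltb hb[simplified] sb[simplified] size1_size)
    qed
    moreover have "vc (rotate k (k + 1) k 20) (\<lambda>R h. vc (Assign 20 (Reg 29)) Q R h) R1 h1"
      if 1: "keeps {24, 25, 26} ?R R1" "hole k h1 ?l a r c" "frame_of k ?A h h1" for R1 h1
    proof -
      obtain l1 b1 u1 where l1: "?l = Node l1 b1 u1"
        by (cases "size1 u < 2 * size1 l'"; cases u) (auto simp: l size1_size)
      have A: "set_tree (Node (Node l1 b1 u1) a r) = set_tree (Node l a r)"
      proof -
        have "inorder (Node l1 b1 u1) = inorder l" unfolding l1[symmetric] by simp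
        then have "set_tree (Node l1 b1 u1) = set_tree l" by (metis set_inorder)
        then show ?thesis by simp
      qed
      have "\<not> 3 * size1 l < size1 r" using c1 by simp
      then have rb: "rebal l a r = Node l1 b1 (Node u1 a r)" using c1 l1 by (simp add: rebal_def)
      show ?thesis
      proof (rule vc_rotr)
        show "hole k h1 (Node l1 b1 u1) a r c" using 1(2) l1 by simp
        show "R1 20 = a" using 1(1) R by (simp add: keeps_def)
        fix R2 h2 assume 2: "keeps {24, 25, 26} R1 R2" "linked k h2 (Node l1 b1 (Node u1 a r)) c"
          "frame_of k (set_tree (Node (Node l1 b1 u1) a r) \<union> nodes c) h1 h2"
        show "vc (Assign 20 (Reg 29)) Q R2 h2"
          by (rule fin) (use 1 2 A rb in \<open>auto intro: keeps_trans frame_trans\<close>)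
      qed (use k in auto)
    qed
    ultimately show ?thesis unfolding vc.simps(4) by (elim vc_mono conjE)
  qed
  have mid: "vc (Put (Reg 20) (k + 3) (Minus (Plus (Reg 23) (Reg 27)) (Num 1)))
      (\<lambda>R h. vc (Assign 20 (Reg 29)) Q R h) ?R h"
    if "\<not> 3 * size1 l < size1 r" "\<not> 3 * size1 r < size1 l"
  proof -
    let ?h = "setf h a (k + 3) (size l + size r + 1)"
    have rb: "rebal l a r = Node l a r" using that by (simp add: rebal_def)
    have nin: "a \<notin> set_tree l" "a \<notin> set_tree r" "a \<notin> nodes c" "a \<noteq> 0"
      using fitsD by auto
    have "\<forall>x\<in>set_tree l. same k h ?h x" "\<forall>x\<in>set_tree r. same k h ?h x" "\<forall>x\<in>nodes c. same k h ?h x"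
      using nin by (auto simp: same_def setf_apply)
    then have "linked k ?h (Node l a r) c"
      using h nin F by (simp add: linked_def tr_cong cx_cong setf_apply)
    then have "vc (Assign 20 (Reg 29)) Q ?R ?h"
      by (intro fin) (auto simp: keeps_def frame_of_def setf_apply rb)
    then show ?thesis using k lt R by simp
  qed
  have "vc (Assign 21 (Fld (Reg 20) k) ;; Assign 22 (Fld (Reg 20) (k + 1)) ;;
     Assign 23 (Plus (Fld (Reg 21) (k + 3)) (Num 1)) ;; Assign 27 (Plus (Fld (Reg 22) (k + 3)) (Num 1)) ;;
     Assign 29 (Fld (Reg 20) (k + 2))) (\<lambda>R' h'. R' = ?R \<and> h' = h) R h"
    using k h R lt by (simp add: sz)
  moreover have "vc (Cond (Less (Plus (Reg 23) (Plus (Reg 23) (Reg 23))) (Reg 27))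
       (?L ;; rotate k k (k + 1) 20)
       (Cond (Less (Plus (Reg 27) (Plus (Reg 27) (Reg 27))) (Reg 23))
          (?M ;; rotate k (k + 1) k 20)
          (Put (Reg 20) (k + 3) (Minus (Plus (Reg 23) (Reg 27)) (Num 1)))))
      (\<lambda>R h. vc (Assign 20 (Reg 29)) Q R h) ?R h"
  proof (rule vc_CondI, goal_cases)
    case 2
    then show ?case by (intro left) (simp add: size1_size)
  next
    case 3
    then have 3: "\<not> 3 * size1 l < size1 r" by (simp add: size1_size)
    show ?case
    proof (rule vc_CondI, goal_cases)
      case 2
      then show ?case by (intro right) (simp add: size1_size)
    next
      case q: 3
      then show ?case by (intro mid 3) (simp add: size1_size)
    qed (use lt in simp)
  qed (use lt in simp)
  ultimately show ?thesis unfolding rebalance_def by (rule vc_Then[OF _ vc.simps(4)[THEN iffD2]])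
qed

end

section \<open>Insertion, deletion and ranks\<close>

text \<open>The offset of the link that leads to the hole; in the empty context this is the root
  link of record 0.\<close>

definition dir :: "frame list \<Rightarrow> nat" where
  "dir c = (case c of [] \<Rightarrow> 0 | (d, _) # _ \<Rightarrow> if d then 0 else 1)"

text \<open>An empty position cannot be located by comparing links as in \<open>relink\<close>,
  because both links of its parent may be 0. So the side is given explicitly;
  \<open>insert_at\<close> records it in register 12.\<close>

lemma cx_put:
  assumes "cx k h c x" "proper c"
  shows "cx k (setf h (parent c) (k + dir c) y) c y"
proof (cases c)
  case Nil
  then show ?thesis using assms by (simp add: dir_def setf_apply)
next
  case (Cons f c')
  obtain d a s where f: "f = (d, a, s)" by (cases f)
  let ?h = "setf h (parent c) (k + dir c) y"
  have "\<forall>z\<in>set_tree s \<union> nodes c'. same k h ?h z" "?h 0 k = h 0 k" "?h 0 (k + 3) = h 0 (k + 3)"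
    using assms Cons f by (auto simp: setf_apply same_def)
  then have "tr k ?h s a = tr k h s a" "cx k ?h c' a = cx k h c' a"
    by (simp_all add: tr_cong cx_cong)
  then show ?thesis
    using assms Cons f by (auto simp: dir_def setf_apply)
qed

text \<open>
  Calling conventions: \<open>insert_at\<close> expects a node in register 10 and its future index in register 11;
  \<open>splice_out\<close> expects a node with at most one child in register 18; \<open>replace\<close> puts the node in
  register 16 in the place of the one in register 15; \<open>delete\<close> expects a node in register 15;
  \<open>node_at\<close> takes an index from register 11 to the node in register 15; \<open>rank\<close> takes a node from
  register 30 to its index, counted from 1, in register 31.
\<close>

abbreviation insert_step :: "nat \<Rightarrow> cmd" where
  "insert_step k \<equiv>
     Assign 14 (Fld (Fld (Reg 13) k) (k + 3)) ;; Assign 20 (Reg 13) ;;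
     Cond (Less (Reg 14) (Reg 11))
       (Assign 11 (Minus (Reg 11) (Plus (Reg 14) (Num 1))) ;; Assign 12 (Num 1) ;;
        Assign 13 (Fld (Reg 13) (k + 1)))
       (Assign 12 (Num 0) ;; Assign 13 (Fld (Reg 13) k))"

abbreviation attach :: "nat \<Rightarrow> cmd" where
  "attach k \<equiv>
     Cond (Equal (Reg 12) (Num 0)) (Put (Reg 20) k (Reg 10)) (Put (Reg 20) (k + 1) (Reg 10)) ;;
     Put (Reg 10) k (Num 0) ;; Put (Reg 10) (k + 1) (Num 0) ;; Put (Reg 10) (k + 2) (Reg 20) ;;
     Put (Reg 10) (k + 3) (Num 1)"

definition insert_at :: "nat \<Rightarrow> cmd" where
  "insert_at k =
     (Assign 20 (Num 0) ;; Assign 12 (Num 0) ;; Assign 13 (Fld (Num 0) k)) ;;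
     Loop (Unequal (Reg 13) (Num 0))
       (insert_step k) ;;
     attach k ;;
     fix_loop k"

abbreviation unlink :: "nat \<Rightarrow> cmd" where
  "unlink k \<equiv>
     (Cond (Equal (Fld (Reg 18) k) (Num 0)) (Assign 17 (Fld (Reg 18) (k + 1))) (Assign 17 (Fld (Reg 18) k)) ;;
      Assign 20 (Fld (Reg 18) (k + 2))) ;;
     set_child k (Reg 20) (Reg 18) (Reg 17) ;; Put (Reg 17) (k + 2) (Reg 20)"

definition splice_out :: "nat \<Rightarrow> cmd" where
  "splice_out k =
     unlink k ;;
     fix_loop k"

definition replace :: "nat \<Rightarrow> cmd" where
  "replace k =
     Assign 17 (Fld (Reg 15) (k + 2)) ;; 
     set_child k (Reg 17) (Reg 15) (Reg 16) ;;
     Put (Fld (Reg 15) k) (k + 2) (Reg 16) ;; Put (Fld (Reg 15) (k + 1)) (k + 2) (Reg 16) ;;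
     Put (Reg 16) k (Fld (Reg 15) k) ;; Put (Reg 16) (k + 1) (Fld (Reg 15) (k + 1)) ;;
     Put (Reg 16) (k + 2) (Reg 17) ;; Put (Reg 16) (k + 3) (Fld (Reg 15) (k + 3))"

abbreviation go_left :: "nat \<Rightarrow> cmd" where
  "go_left k \<equiv> Loop (Unequal (Fld (Reg 18) k) (Num 0)) (Assign 18 (Fld (Reg 18) k))"

text \<open>A node with two children is replaced by its successor, which has no left child.\<close>

definition delete :: "nat \<Rightarrow> cmd" where
  "delete k =
     Assign 18 (Reg 15) ;;
     Cond (Equal (Fld (Reg 15) k) (Num 0)) Skip
       (Cond (Equal (Fld (Reg 15) (k + 1)) (Num 0)) Skip
         (Assign 18 (Fld (Reg 15) (k + 1)) ;;
          go_left k)) ;;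
     splice_out k ;;
     Cond (Equal (Reg 18) (Reg 15)) Skip (Assign 16 (Reg 18) ;; replace k)"

abbreviation node_step :: "nat \<Rightarrow> cmd" where
  "node_step k \<equiv>
     Cond (Less (Reg 14) (Reg 11))
       (Assign 11 (Minus (Reg 11) (Plus (Reg 14) (Num 1))) ;; Assign 15 (Fld (Reg 15) (k + 1)))
       (Assign 15 (Fld (Reg 15) k)) ;;
     Assign 14 (Fld (Fld (Reg 15) k) (k + 3))"

definition node_at :: "nat \<Rightarrow> cmd" where
  "node_at k =
     (Assign 15 (Fld (Num 0) k) ;; Assign 14 (Fld (Fld (Reg 15) k) (k + 3))) ;;
     Loop (Unequal (Reg 14) (Reg 11))
       (node_step k)"

abbreviation rank_step :: "nat \<Rightarrow> cmd" where
  "rank_step k \<equiv>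
     Assign 32 (Fld (Reg 30) (k + 2)) ;;
     Cond (Equal (Fld (Reg 32) (k + 1)) (Reg 30))
       (Assign 31 (Plus (Reg 31) (Plus (Fld (Fld (Reg 32) k) (k + 3)) (Num 1)))) Skip ;;
     Assign 30 (Reg 32)"

definition rank :: "nat \<Rightarrow> cmd" where
  "rank k =
     Assign 31 (Plus (Fld (Fld (Reg 30) k) (k + 3)) (Num 1)) ;;
     Loop (Unequal (Fld (Reg 30) (k + 2)) (Num 0))
       (rank_step k)"

context ram
begin

lemma wp_vc_Then:
  assumes "vc c (\<lambda>S g. S = R' \<and> g = h') R h" "wp d l Q R' h'" "cost c + l \<le> n"
  shows "wp (c ;; d) n Q R h"
  by (rule wp_Then[OF wp_mono[OF vc_wp[OF assms(1)] order_refl] assms(3)]) (use assms(2) in simp)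

lemma wp_vc_Loop_step:
  assumes "safeB b R h" "evb b R h" "vc c (\<lambda>R h. wp (Loop b c) l Q R h) R h"
    "costB b + 1 + cost c + l \<le> n"
  shows "wp (Loop b c) n Q R h"
  by (rule wp_Loop_step[OF assms(1,2) vc_wp[OF assms(3)] assms(4)])

lemma cost_rebalance: "cost (rebalance k) \<le> 500"
  by (simp add: rebalance_def rotate_def set_child_def size_exp_def)

lemma linked_Cons:
  "linked k h t ((d, a, s) # c) \<Longrightarrow> if d then hole k h t a s c else hole k h s a t c"
  using linked_left linked_right by (cases d) auto

text \<open>One iteration per frame: at most 500 units for \<open>rebalance\<close>, and the
  remaining 10 cover the guard. After each iteration the rebalanced tree is the subtree in the hole
  of the remaining context.\<close>

lemma wp_fix_loop:
  assumes "k \<le> 6" "linked k h t c" "R 20 = parent c"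
    and "\<And>R' h'. keeps {20..29} R R' \<Longrightarrow> tr k h' (fix_up t c) 0 \<Longrightarrow> h' 0 k = rt (fix_up t c) \<Longrightarrow>
      h' 0 (k + 3) = 0 \<Longrightarrow> frame_of k (set_tree t \<union> nodes c) h h' \<Longrightarrow> Q R' h'"
  shows "wp (fix_loop k) (length c * 510 + 10) Q R h"
  using assms(2-)
proof (induction c arbitrary: t R h)
  case Nil
  have "Q R h"
    by (rule Nil.prems(3)) (use Nil.prems in \<open>simp_all add: linked_def keeps_def frame_refl\<close>)
  then show ?case unfolding fix_loop_def by (intro wp_Loop_end) (use Nil.prems in simp_all)
next
  case (Cons f c)
  obtain d a s where f: "f = (d, a, s)" by (cases f)
  define l r where "l = (if d then t else s)" and "r = (if d then s else t)"
  have H: "hole k h l a r c" using linked_Cons[of k h t d a s c] Cons.prems(1) by (simp add: f l_def r_def)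
  have A: "set_tree (Node l a r) \<union> nodes c = set_tree t \<union> nodes (f # c)" by (auto simp: f l_def r_def)
  have X: "fix_up t (f # c) = fix_up (rebal l a r) c" by (simp add: f l_def r_def)
  have a: "a \<noteq> 0" using fitsD(1)[of "Node l a r" c] H by (auto simp: hole_def)
  have "vc (rebalance k) (\<lambda>R h. wp (fix_loop k) (length c * 510 + 10) Q R h) R h"
  proof (rule vc_rebalance[OF _ assms(1) H])
    show "R 20 = a" using Cons.prems f by simp
    fix R1 h1
    assume 1: "keeps {20..29} R R1" "R1 20 = parent c" "linked k h1 (rebal l a r) c"
      "frame_of k (set_tree (Node l a r) \<union> nodes c) h h1"
    show "wp (fix_loop k) (length c * 510 + 10) Q R1 h1"
    proof (rule Cons.IH[where R = R1, OF 1(3,2)])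
      fix R' h'
      assume 2: "keeps {20..29} R1 R'" "tr k h' (fix_up (rebal l a r) c) 0"
        "h' 0 k = rt (fix_up (rebal l a r) c)" "h' 0 (k + 3) = 0"
        "frame_of k (set_tree (rebal l a r) \<union> nodes c) h1 h'"
      have "inorder (rebal l a r) = inorder (Node l a r)" by simp
      then have "set_tree (rebal l a r) = set_tree (Node l a r)" by (metis set_inorder)
      with 2(5) 1(4) have "frame_of k (set_tree t \<union> nodes (f # c)) h h'"
        unfolding A[symmetric] by (auto intro: frame_trans)
      moreover have "keeps {20..29} R R'" using keeps_trans[OF 1(1) 2(1)] by blast
      ultimately show "Q R' h'" using 2 X Cons.prems(3) by metis
    qed
  qed
  then show ?case
    unfolding fix_loop_def
    by (rule wp_vc_Loop_step[rotated 2]) (use Cons.prems f a cost_rebalance[of k] in simp_all)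
qed

text \<open>The form used after updates: \<open>n\<close> is the size of the focused subtree before
  it gained or lost a node, and \<open>H\<close> bounds the length of the path to the root.\<close>

lemma wp_fix_loop_seq:
  assumes "k \<le> 6" "linked k h t c" "R 20 = parent c" "bal t" "cbal c n" "size t \<le> n + 1" "n \<le> size t + 1"
    "xs = before c @ inorder t @ after c" "length c \<le> H"
    and Q: "\<And>R' h'. keeps {20..29} R R' \<Longrightarrow> seq k h' xs \<Longrightarrow> frame_of k (set xs) h h' \<Longrightarrow> Q R' h'"
  shows "wp (fix_loop k) (H * 510 + 10) Q R h"
proof -
  have F: "fits t c" using assms(2) by (simp add: linked_def)
  have d: "distinct (0 # xs)" using F by (simp add: fits_def inorder_plug assms(8))
  have A: "set_tree t \<union> nodes c = set xs" by (auto simp: nodes_eq assms(8))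
  have "wp (fix_loop k) (length c * 510 + 10) Q R h"
  proof (rule wp_fix_loop[where R = R, OF assms(1-3)])
    fix R' h' assume 1: "keeps {20..29} R R'" "tr k h' (fix_up t c) 0" "h' 0 k = rt (fix_up t c)"
      "h' 0 (k + 3) = 0" "frame_of k (set_tree t \<union> nodes c) h h'"
    have "seq k h' xs" unfolding seq_def
      using 1(2-4) d bal_fix_up[OF assms(4-7)] inorder_fix_up[of t c] assms(8) by blast
    then show "Q R' h'" using Q 1 A by simp
  qed
  then show ?thesis by (rule wp_mono) (use assms(9) in simp_all)
qed

lemma wp_insert_loop:
  assumes "k \<le> 6" "tr k h t (parent c)" "h 0 (k + 3) = 0" "R 13 = rt t" "R 11 = p" "p \<le> size t"
    "R 20 = parent c" "R 12 = dir c" "set_tree t \<subseteq> {..<N}" "size t < N" "0 \<notin> set_tree t"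
    and "\<And>R' c'. keeps {11..20} R R' \<Longrightarrow> plug Leaf c' = plug t c \<Longrightarrow>
      length (before c') = length (before c) + p \<Longrightarrow> R' 20 = parent c' \<Longrightarrow> R' 12 = dir c' \<Longrightarrow> Q R' h"
  shows "wp (Loop (Unequal (Reg 13) (Num 0))
       (insert_step k)) (height t * 50 + 10) Q R h"
    (is "wp (Loop ?b ?c) _ Q R h")
  using assms(2-)
proof (induction t arbitrary: c R p)
  case Leaf
  have "Q R h" by (rule Leaf.prems(11)[of R c]) (use Leaf.prems in \<open>simp_all add: keeps_def\<close>)
  then show ?case by (intro wp_Loop_end) (use Leaf.prems in simp_all)
next
  case (Node l a r)
  have a: "a \<noteq> 0" "a < N" using Node.prems by auto
  have lt: "rt l < N" "size l + size r + 1 < N" using Node.prems N_gt_1 by (auto intro!: rt_less)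
  have h: "h a k = rt l" "h a (k + 1) = rt r" "tr k h l a" "tr k h r a" using Node.prems by auto
  have s: "h (rt l) (k + 3) = size l" using tr_size[OF h(3)] Node.prems by simp
  have "vc ?c (\<lambda>R h. wp (Loop ?b ?c) (max (height l) (height r) * 50 + 10) Q R h) R h"
  \<comment> \<open>A tree has \<open>size + 1\<close> gaps, numbered from 0, and gap
    \<open>size l\<close> lies immediately before \<open>a\<close>. So the descent goes right only
    if \<open>p\<close> is strictly larger.\<close>
  proof (cases "size l < p")
    case True
    let ?R = "R(14 := size l, 20 := a, 11 := p - (size l + 1), 12 := 1, 13 := rt r)"
    have "wp (Loop ?b ?c) (height r * 50 + 10) Q ?R h"
    proof (rule Node.IH(2)[of "(False, a, l) # c"])
      fix R' c'
      assume 1: "keeps {11..20} ?R R'" "plug Leaf c' = plug r ((False, a, l) # c)"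
        "length (before c') = length (before ((False, a, l) # c)) + (p - (size l + 1))"
        "R' 20 = parent c'" "R' 12 = dir c'"
      have "keeps {11..20} R R'" using 1(1) by (auto simp: keeps_def)
      then show "Q R' h" using Node.prems(11)[of R' c'] 1 True by simp
    qed (use h True Node.prems in \<open>simp_all add: dir_def\<close>)
    then have "wp (Loop ?b ?c) (max (height l) (height r) * 50 + 10) Q ?R h" by (rule wp_mono) simp_all
    then show ?thesis using assms(1) Node.prems a lt h s True by simp
  next
    case False
    let ?R = "R(14 := size l, 20 := a, 12 := 0, 13 := rt l)"
    have "wp (Loop ?b ?c) (height l * 50 + 10) Q ?R h"
    proof (rule Node.IH(1)[of "(True, a, r) # c" ?R p])
      fix R' c'
      assume 1: "keeps {11..20} ?R R'" "plug Leaf c' = plug l ((True, a, r) # c)"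
        "length (before c') = length (before ((True, a, r) # c)) + p"
        "R' 20 = parent c'" "R' 12 = dir c'"
      have "keeps {11..20} R R'" using 1(1) by (auto simp: keeps_def)
      then show "Q R' h" using Node.prems(11)[of R' c'] 1 by simp
    qed (use h False Node.prems in \<open>simp_all add: dir_def\<close>)
    then have "wp (Loop ?b ?c) (max (height l) (height r) * 50 + 10) Q ?R h" by (rule wp_mono) simp_all
    then show ?thesis using assms(1) Node.prems a lt h s False by simp
  qed
  then show ?case
    by (rule wp_vc_Loop_step[rotated 2]) (use Node.prems a in simp_all)
qed

lemma wp_insert_at:
  assumes k: "k \<le> 6" and S: "seq k h xs" "set xs \<subseteq> {..<N}" and R: "R 10 = n" "R 11 = p"
    and p: "p \<le> length xs" and n: "n \<notin> set xs" "0 < n" "n < N"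
    and Q: "\<And>R' h'. keeps {11..29} R R' \<Longrightarrow> seq k h' (take p xs @ n # drop p xs) \<Longrightarrow>
      frame_of k (insert n (set xs)) h h' \<Longrightarrow> Q R' h'"
  shows "wp (insert_at k) (hbound (length xs) * 560 + 100) Q R h"
proof -
  obtain t where t: "tr k h t 0" "h 0 k = rt t" "h 0 (k + 3) = 0" "bal t" "inorder t = xs" and d: "distinct (0 # xs)"
    using S(1) unfolding seq_def by blast
  have ft: "fits t []" using d S(2) t(5) by (simp add: fits_def)
  note ftD = fitsD[OF ft]
  have ht: "height t \<le> hbound (length xs)" using height_le_hbound[OF t(4)] t(5) by (metis length_inorder)
  let ?R = "R(20 := 0, 12 := 0, 13 := rt t)"
  let ?Q = "\<lambda>R' h'. h' = h \<and> keeps {11..20} R R' \<and> (\<exists>c. plug Leaf c = t \<and> length (before c) = p \<and>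
    R' 20 = parent c \<and> R' 12 = dir c)"
  have 1: "wp (insert_at k) (20 + ((hbound (length xs) * 50 + 10) + (50 + (hbound (length xs) * 510 + 10)))) Q R h"
    unfolding insert_at_def
  proof (rule wp_vc_Then[where R' = ?R and h' = h and l = "(hbound (length xs) * 50 + 10) + (50 + (hbound (length xs) * 510 + 10))"], goal_cases)
    case 1
    show ?case using k t N_gt_1 by simp
  next
    case 2
    show ?case
    proof (rule wp_Then[OF wp_mono[where Q = ?Q]])
      show "wp (Loop (Unequal (Reg 13) (Num 0))
       (insert_step k)) (height t * 50 + 10) ?Q ?R h"
      proof (rule wp_insert_loop[OF k, where c = "[]" and p = p])
        fix R' c'
        assume 1: "keeps {11..20} ?R R'" "plug Leaf c' = plug t []"
          "length (before c') = length (before []) + p" "R' 20 = parent c'" "R' 12 = dir c'"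
        have "keeps {11..20} R R'" using 1(1) by (auto simp: keeps_def)
        then show "?Q R' h" using 1 by auto
      qed (use k t R p ftD in \<open>auto simp: dir_def\<close>)
      show "height t * 50 + 10 \<le> hbound (length xs) * 50 + 10" using ht by simp
      fix R1 h1
      assume A: "?Q R1 h1"
      then obtain c where c: "plug Leaf c = t" "length (before c) = p" "R1 20 = parent c" "R1 12 = dir c"
        by blast
      have K1: "keeps {11..20} R R1" and h1: "h1 = h" using A by auto
      have n1: "R1 10 = n" using K1 R by (simp add: keeps_def)
      have xs: "xs = before c @ after c" using t(5) c(1) inorder_plug[of Leaf c] by simp
      have fc: "fits Leaf c" using ft c(1) by (simp add: fits_def)
      note fcD = fitsD[OF fc]
      have nc: "n \<notin> nodes c" using n xs by (simp add: nodes_eq)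
      have cx: "cx k h c 0" "cbal c 0"
        using t(1-4) tr_plug[of k h Leaf c] bal_plug[of Leaf c] c(1) by auto
      let ?h1 = "setf h (parent c) (k + dir c) n"
      let ?h2 = "setf (setf (setf (setf ?h1 n k 0) n (k + 1) 0) n (k + 2) (parent c)) n (k + 3) 1"
      have pc: "parent c < N" "parent c \<noteq> n" using fcD nc n N_gt_1 parent_less[of c N] parent_neq[of n c] by auto
      have dir: "dir c = 0 \<or> dir c = 1" by (auto simp: dir_def split: list.split)
      have "\<forall>x\<in>nodes c. same k ?h1 ?h2 x" using nc by (auto simp: same_def setf_apply)
      then have "cx k ?h2 c n"
        using cx_put[OF cx(1) fcD(2), of n] n cx_cong[of c k ?h1 ?h2 n] by (simp add: setf_apply)
      moreover have "fits (Node Leaf n Leaf) c"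
        using d S(2) n by (auto simp: fits_def inorder_plug xs)
      ultimately have L: "linked k ?h2 (Node Leaf n Leaf) c"
        by (simp add: linked_def setf_apply)
      have tk: "take p xs @ n # drop p xs = before c @ inorder (Node Leaf n Leaf) @ after c"
        using c(2) xs by simp
      have "length c \<le> height t" using height_plug[of Leaf c] c(1) by simp
      then have lc: "length c \<le> hbound (length xs)" using ht by simp
      have fr: "frame_of k (insert n (set xs)) h ?h2"
      proof -
        \<comment> \<open>In the empty tree the link is written into record 0, where
          \<open>dir\<close> selects the root link that \<open>frame_of\<close> exempts.\<close>
        have "parent c \<in> set xs \<or> c = []" by (cases c) (auto simp: xs split: if_splits)
        then show ?thesis using dir by (auto simp: frame_of_def setf_apply dir_def)
      qed
      have "wp (fix_loop k) (hbound (length xs) * 510 + 10) Q R1 ?h2"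
      proof (rule wp_fix_loop_seq[where R = R1, OF k L c(3) _ cx(2) _ _ tk lc])
        fix R' h' assume 3: "keeps {20..29} R1 R'" "seq k h' (take p xs @ n # drop p xs)"
          "frame_of k (set (take p xs @ n # drop p xs)) ?h2 h'"
        have st: "set (take p xs @ n # drop p xs) = insert n (set xs)"
          by (metis append_take_drop_id list.simps(15) set_append Un_insert_right)
        have "frame_of k (insert n (set xs)) h h'"
          by (rule frame_trans[OF fr 3(3)[unfolded st] order_refl order_refl])
        moreover have "keeps {11..29} R R'" using keeps_trans[OF K1 3(1)] by simp
        ultimately show "Q R' h'" using Q 3(2) by blast
      qed (simp_all add: near_def)
      then show "wp (attach k ;; fix_loop k) (50 + (hbound (length xs) * 510 + 10)) Q R1 h1"
        unfolding h1
        by (intro wp_vc_Then[where R' = R1 and h' = ?h2])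
          (use k n n1 c pc dir in \<open>auto\<close>)
    qed simp
  qed simp
  show ?thesis by (rule wp_mono[OF 1]) simp_all
qed

text \<open>The only possible child moves up, so the subtree in the hole loses exactly one node and
  the balance can be restored along the path. If there is no child, its parent pointer goes to the
  scratch field of record 0.\<close>

lemma wp_splice_out:
  assumes k: "k \<le> 6" and S: "seq k h xs" "set xs \<subseteq> {..<N}" and R: "R 18 = b"
    and b: "b \<in> set xs" "h b k = 0 \<or> h b (k + 1) = 0"
    and Q: "\<And>R' h'. keeps (insert 17 {20..29}) R R' \<Longrightarrow> seq k h' (remove1 b xs) \<Longrightarrow>
      frame_of k (set xs) h h' \<Longrightarrow> Q R' h'"
  shows "wp (splice_out k) (hbound (length xs) * 510 + 100) Q R h"
proof -
  obtain l r c where xs: "xs = before c @ inorder l @ b # inorder r @ after c"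
    and t: "tr k h (Node l b r) (parent c)" "cx k h c b" "bal (Node l b r)" "cbal c (size (Node l b r))"
      "height (Node l b r) + length c \<le> hbound (length xs)"
    using seq_zipper[OF S(1) b(1)] by metis
  have d: "distinct (0 # xs)" using S(1) by (simp add: seq_def)
  have F: "fits (Node l b r) c" using d S(2) by (simp add: fits_def inorder_plug xs)
  note D = fitsD[OF F]
  define u where "u = (if h b k = 0 then r else l)"
  have z: "rt s = 0 \<Longrightarrow> s = Leaf" if "0 \<notin> set_tree s" for s
    using that by (cases s) auto
  have lr: "l = Leaf \<and> u = r \<or> r = Leaf \<and> u = l"
    using b(2) t(1) z[of l] z[of r] D(1) by (auto simp: u_def)
  then have io: "inorder l @ inorder r = inorder u" and su: "set_tree u \<subseteq> set_tree l \<union> set_tree r" and sz: "size (Node l b r) = size u + 1"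
    and bu: "bal u" and tu: "tr k h u b" and du: "distinct (inorder u)"
    using t(1,3) D(1) by auto
  have nb: "b \<noteq> 0" "b \<notin> nodes c" "b \<notin> set_tree u" "0 \<notin> set_tree u" "set_tree u \<inter> nodes c = {}"
    using D su by auto
  have lt: "b < N" "parent c < N" "rt u < N"
    using D(4) N_gt_1 su by (auto intro!: parent_less rt_less)
  have pb: "parent c \<noteq> b" using nb by (simp add: parent_neq)
  let ?h1 = "relink k h (parent c) b (rt u)"
  let ?h2 = "setf ?h1 (rt u) (k + 2) (parent c)"
  let ?R = "R(17 := rt u, 20 := parent c)"
  have c1: "cx k ?h1 c (rt u)" by (rule cx_relink[OF t(2) nb(1,2) D(2)])
  have ru: "rt u \<notin> nodes c" using rt_cases[of u] nb zero_notin_nodes[OF D(2)] by auto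
  then have "\<forall>x\<in>nodes c. same k ?h1 ?h2 x" by (auto simp: same_def setf_apply)
  then have c2: "cx k ?h2 c (rt u)" using c1 cx_cong[of c k ?h1 ?h2] by (simp add: setf_apply)
  have pu: "parent c \<notin> set_tree u" using parent_cases[of c] nb by auto
  have t2: "tr k ?h2 u (parent c)"
  proof (cases "u = Leaf")
    case False
    then have "rt u \<noteq> parent c" using rt_in[OF False] pu by auto
    then show ?thesis
      by (intro tr_parent[OF tu _ _ _ _ _ du]) (use pu in \<open>auto simp: same_def setf_apply relink_def\<close>)
  qed simp
  have F2: "fits u c" using F io by (auto simp: fits_def inorder_plug simp flip: io)
  have L: "linked k ?h2 u c" using t2 c2 F2 by (simp add: linked_def)
  have rm: "remove1 b xs = before c @ inorder u @ after c"
    using d unfolding xs io[symmetric] by (simp add: remove1_append)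
  have fr: "frame_of k (set xs) h ?h2"
    unfolding frame_of_def
  proof (intro allI)
    fix y f
    have ps: "parent c = 0 \<or> parent c \<in> set xs" and us: "rt u = 0 \<or> rt u \<in> set xs"
      using parent_cases[of c] rt_cases[of u] su by (auto simp: xs nodes_eq)
    have "h 0 k = b" if "parent c = 0" using that t(2) D(2) by (cases c) auto
    then show "y \<in> set xs \<and> k \<le> f \<and> f < k + 4 \<or> y = 0 \<and> (f = k \<or> f = k + 2) \<or> ?h2 y f = h y f"
      using ps us by (auto simp: setf_apply relink_def)
  qed
  have lc: "length c \<le> hbound (length xs)" using t(5) by simp
  have nz: "h b k = 0 \<longleftrightarrow> l = Leaf" using t(1) z[of l] D(1) by auto
  have "wp (splice_out k) (50 + (hbound (length xs) * 510 + 10)) Q R h"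
    unfolding splice_out_def
  proof (rule wp_vc_Then[where R' = ?R and h' = ?h2])
    show "vc (unlink k) (\<lambda>S g. S = ?R \<and> g = ?h2) R h"
    proof (rule vc_Then[where R' = ?R and h' = h], goal_cases)
      case 1
      show ?case using k R lt t(1) by (auto simp: u_def)
    next
      case 2
      show ?case unfolding vc.simps(4)
        by (rule vc_set_child) (use k R lt in simp_all)
    qed
    show "wp (fix_loop k) (hbound (length xs) * 510 + 10) Q ?R ?h2"
    proof (rule wp_fix_loop_seq[where R = ?R, OF k L _ bu t(4) _ _ rm lc])
      fix R' h' assume 3: "keeps {20..29} ?R R'" "seq k h' (remove1 b xs)" "frame_of k (set (remove1 b xs)) ?h2 h'"
      have "frame_of k (set xs) h h'"
        by (rule frame_trans[OF fr 3(3) order_refl]) (rule set_remove1_subset)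
      moreover have "keeps (insert 17 {20..29}) R R'" using 3(1) by (auto simp: keeps_def)
      ultimately show "Q R' h'" using Q 3(2) by blast
    qed (use sz in simp_all)
    show "cost (unlink k) + (hbound (length xs) * 510 + 10)
      \<le> 50 + (hbound (length xs) * 510 + 10)"
      by (simp add: set_child_def)
  qed
  then show ?thesis by (rule wp_mono) simp_all
qed

lemma vc_replace:
  assumes k: "k \<le> 6" and S: "seq k h xs" "set xs \<subseteq> {..<N}" and R: "R 15 = a" "R 16 = b"
    and ab: "a \<in> set xs" "b \<notin> set xs" "0 < b" "b < N"
    and Q: "\<And>R' h'. keeps {17} R R' \<Longrightarrow> seq k h' (map (\<lambda>x. if x = a then b else x) xs) \<Longrightarrow>
      frame_of k (insert b (set xs)) h h' \<Longrightarrow> Q R' h'"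
  shows "vc (replace k) Q R h"
proof -
  obtain l r c where xs: "xs = before c @ inorder l @ a # inorder r @ after c"
    and t: "tr k h (Node l a r) (parent c)" "cx k h c a" "csz k h c (size (Node l a r))" "bal (Node l a r)"
      "cbal c (size (Node l a r))"
    using seq_zipper[OF S(1) ab(1)] by metis
  have d: "distinct (0 # xs)" using S(1) by (simp add: seq_def)
  have F: "fits (Node l a r) c" using d S(2) by (simp add: fits_def inorder_plug xs)
  note D = fitsD[OF F]
  have na: "a \<noteq> 0" "a \<notin> nodes c" "a \<notin> set_tree l" "a \<notin> set_tree r" "distinct (inorder l)" "distinct (inorder r)"
    "set_tree l \<inter> nodes c = {}" "set_tree r \<inter> nodes c = {}" "set_tree l \<inter> set_tree r = {}"
    "0 \<notin> set_tree l" "0 \<notin> set_tree r" "0 \<notin> nodes c"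
    using D zero_notin_nodes by auto
  have nb: "b \<noteq> 0" "b \<notin> nodes c" "b \<notin> set_tree l" "b \<notin> set_tree r" "b \<noteq> a"
    using ab by (auto simp: xs nodes_eq)
  have lt: "a < N" "parent c < N" "rt l < N" "rt r < N"
    using D(4) N_gt_1 by (auto intro!: parent_less rt_less)
  have "parent c \<noteq> a" "parent c \<noteq> b" "rt l \<noteq> a" "rt l \<noteq> b" "rt r \<noteq> a" "rt r \<noteq> b"
    using na nb by (simp_all add: parent_neq rt_neq)
  note ne = this this[symmetric] nb(5) nb(5)[symmetric]
  let ?h1 = "relink k h (parent c) a b"
  let ?h2 = "setf (setf ?h1 (rt l) (k + 2) b) (rt r) (k + 2) b"
  let ?h3 = "setf (setf (setf (setf ?h2 b k (rt l)) b (k + 1) (rt r)) b (k + 2) (parent c)) b (k + 3) (size l + size r + 1)"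
  have c1: "cx k ?h1 c b" by (rule cx_relink[OF t(2) na(1,2) D(2)])
  have rn: "rt l \<notin> nodes c" "rt r \<notin> nodes c"
    using rt_cases[of l] rt_cases[of r] na by auto
  have "same k ?h1 ?h3 x" if "x \<notin> {rt l, rt r, b}" for x using that by (simp add: same_def setf_apply)
  moreover have "x \<notin> {rt l, rt r, b}" if "x \<in> nodes c" for x using that rn nb by auto
  ultimately have "cx k ?h3 c b = cx k ?h1 c b"
    by (intro cx_cong ballI) (auto simp: setf_apply nb)
  then have c3: "cx k ?h3 c b" using c1 by simp
  have pl: "parent c \<notin> set_tree l" "parent c \<notin> set_tree r" using parent_cases[of c] na by auto
  have same3: "same k h ?h3 x" if "x \<notin> {parent c, rt l, rt r, b}" for x
    using that by (simp add: same_def setf_apply relink_def)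
  have rin: "s \<noteq> Leaf \<Longrightarrow> rt s \<in> set_tree s" for s by (rule rt_in)
  have tl: "tr k ?h3 l b"
  proof (cases "l = Leaf")
    case False
    have n: "rt l \<noteq> parent c" "rt l \<noteq> rt r" using rin[OF False] pl na rt_cases[of r] by auto
    show ?thesis
    proof (rule tr_parent)
      show "tr k h l a" using t(1) by simp
      show "\<forall>x\<in>set_tree l - {rt l}. same k h ?h3 x"
      proof (intro ballI same3)
        fix x assume "x \<in> set_tree l - {rt l}"
        then show "x \<notin> {parent c, rt l, rt r, b}" using pl na nb rt_cases[of r] by auto
      qed
    qed (simp_all add: setf_apply relink_def n ne na)
  qed simp
  have tr': "tr k ?h3 r b"
  proof (cases "r = Leaf")
    case False
    have n: "rt r \<noteq> parent c" "rt l \<noteq> rt r" using rin[OF False] pl na rt_cases[of l] by auto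
    show ?thesis
    proof (rule tr_parent)
      show "tr k h r a" using t(1) by simp
      show "\<forall>x\<in>set_tree r - {rt r}. same k h ?h3 x"
      proof (intro ballI same3)
        fix x assume "x \<in> set_tree r - {rt r}"
        then show "x \<notin> {parent c, rt l, rt r, b}" using pl na nb rt_cases[of l] by auto
      qed
    qed (simp_all add: setf_apply relink_def n ne na)
  qed simp
  have T: "tr k ?h3 (Node l b r) (parent c)"
    using tl tr' by (simp add: setf_apply)
  have "csz k ?h3 c (size (Node l a r)) = csz k h c (size (Node l a r))"
    by (intro csz_cong ballI) (use nb in \<open>auto simp: setf_apply relink_def\<close>)
  then have C: "csz k ?h3 c (size (Node l b r))" using t(3) by simp
  let ?xs = "map (\<lambda>x. if x = a then b else x) xs"
  have id: "map (\<lambda>x. if x = a then b else x) ys = ys" if "a \<notin> set ys" for ys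
    using that by (induction ys) auto
  have "a \<notin> set (before c)" "a \<notin> set (after c)" using na by (simp_all add: nodes_eq)
  then have mp: "?xs = before c @ inorder (Node l b r) @ after c"
    using na id by (simp add: xs)
  have "seq k ?h3 ?xs" unfolding mp
  proof (rule seq_plug[OF T _ C])
    show "cx k ?h3 c (rt (Node l b r))" using c3 by simp
    show "bal (Node l b r)" "cbal c (size (Node l b r))" using t by simp_all
    show "proper c" by (rule D)
    show "distinct (0 # inorder (Node l b r))" "set_tree (Node l b r) \<inter> nodes c = {}"
      using na nb D by auto
  qed
  moreover have "frame_of k (insert b (set xs)) h ?h3"
    unfolding frame_of_def
  proof (intro allI)
    fix y f
    have ps: "parent c = 0 \<or> parent c \<in> set xs" and us: "rt l = 0 \<or> rt l \<in> set xs" "rt r = 0 \<or> rt r \<in> set xs"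
      using parent_cases[of c] rt_cases[of l] rt_cases[of r] by (auto simp: xs nodes_eq)
    have h0: "parent c = 0 \<Longrightarrow> h 0 k = a" using t(2) D(2) by (cases c) auto
    consider "y = 0" | "y \<in> insert b (set xs)" | "y \<noteq> 0" "y \<notin> insert b (set xs)" by blast
    then show "y \<in> insert b (set xs) \<and> k \<le> f \<and> f < k + 4 \<or> y = 0 \<and> (f = k \<or> f = k + 2) \<or> ?h3 y f = h y f"
    proof cases
      case 1
      then have "?h3 y f = h y f" if "f \<notin> {k, k + 2}" using that h0 nb(1) by (auto simp: setf_apply relink_def)
      with 1 show ?thesis by auto
    next
      case 2
      have "?h3 y f = h y f" if "f \<notin> {k, k + 1, k + 2, k + 3}"
        using that by (simp add: setf_apply relink_def)
      moreover have "f \<notin> {k, k + 1, k + 2, k + 3}" if "\<not> (k \<le> f \<and> f < k + 4)" using that by auto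
      ultimately show ?thesis using 2 by blast
    next
      case 3
      then have "y \<notin> {parent c, rt l, rt r, b}" using ps us by auto
      then show ?thesis by (simp add: setf_apply relink_def)
    qed
  qed
  moreover have "keeps {17} R (R(17 := parent c))" by (simp add: keeps_def)
  ultimately have q: "Q (R(17 := parent c)) ?h3" using Q by blast
  have h: "h a k = rt l" "h a (k + 1) = rt r" "h a (k + 2) = parent c" "h a (k + 3) = size l + size r + 1"
    using t(1) by simp_all
  have h1: "?h1 a f = h a f" for f using ne by (simp add: relink_def setf_apply)
  show ?thesis
    unfolding replace_def
  proof (rule vc_Then[where R' = "R(17 := parent c)" and h' = h], goal_cases)
    case 1
    show ?case using k lt by (simp add: R h[simplified])
  next
    case 2
    show ?case
    proof (rule vc_Then[where R' = "R(17 := parent c)" and h' = ?h1], goal_cases)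
      case 1
      show ?case by (rule vc_set_child) (use k lt R in simp_all)
    next
      case 2
      show ?case using k lt ab q by (simp add: R h1 h[simplified] setf_apply ne)
    qed
  qed
qed

lemma wp_leftmost:
  assumes "k \<le> 6" "tr k h t q" "t \<noteq> Leaf" "R 18 = rt t" "set_tree t \<subseteq> {..<N}" "0 \<notin> set_tree t"
    and "h (hd (inorder t)) k = 0 \<Longrightarrow> Q (R(18 := hd (inorder t))) h"
  shows "wp (go_left k) (height t * 20 + 10) Q R h"
    (is "wp (Loop ?b ?c) _ _ _ _")
  using assms(2-)
proof (induction t arbitrary: q R)
  case (Node l a r)
  show ?case
  proof (cases "l = Leaf")
    case True
    have "R(18 := a) = R" using Node.prems by (simp add: fun_upd_idem)
    then have "Q R h" using Node.prems(6) Node.prems(1) True by simp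
    then show ?thesis by (intro wp_Loop_end) (use Node.prems assms(1) True in simp_all)
  next
    case False
    have "0 \<notin> set_tree l" using Node.prems by simp
    then have "rt l \<noteq> 0" using rt_in[OF False] by metis
    moreover have "wp (Loop ?b ?c) (height l * 20 + 10) Q (R(18 := rt l)) h"
    proof (rule Node.IH(1)[of a])
      assume "h (hd (inorder l)) k = 0"
      moreover have e: "hd (inorder (Node l a r)) = hd (inorder l)" using False by (simp add: hd_append)
      ultimately show "Q (R(18 := rt l, 18 := hd (inorder l))) h"
        using Node.prems(6) unfolding e fun_upd_upd by blast
    qed (use Node.prems False in simp_all)
    then have V: "vc ?c (\<lambda>R h. wp (Loop ?b ?c) (height l * 20 + 10) Q R h) R h"
      using Node.prems assms(1) by simp
    ultimately show ?thesis
      by (intro wp_vc_Loop_step[OF _ _ V]) (use Node.prems assms(1) in simp_all)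
  qed
qed simp

text \<open>Because \<open>b\<close> directly follows \<open>a\<close>, removing \<open>b\<close>
  and then renaming \<open>a\<close> to \<open>b\<close> leaves \<open>b\<close> where it stands
  after the removal of \<open>a\<close>.\<close>

lemma replace_removed:
  assumes "distinct (ys @ a # b # zs)"
  shows "map (\<lambda>x. if x = a then b else x) (remove1 b (ys @ a # b # zs)) = remove1 a (ys @ a # b # zs)"
proof -
  have "map (\<lambda>x. if x = a then b else x) vs = vs" if "a \<notin> set vs" for vs
    using that by (induction vs) auto
  then show ?thesis using assms by (simp add: remove1_append)
qed

lemma wp_delete:
  assumes k: "k \<le> 6" and S: "seq k h xs" "set xs \<subseteq> {..<N}" and R: "R 15 = a" and a: "a \<in> set xs"
    and Q: "\<And>R' h'. keeps {16..29} R R' \<Longrightarrow> seq k h' (remove1 a xs) \<Longrightarrow>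
      frame_of k (set xs) h h' \<Longrightarrow> Q R' h'"
  shows "wp (delete k) (hbound (length xs) * 530 + 300) Q R h"
proof -
  obtain l r c where xs: "xs = before c @ inorder l @ a # inorder r @ after c"
    and t: "tr k h (Node l a r) (parent c)" "cx k h c a"
      "height (Node l a r) + length c \<le> hbound (length xs)"
    using seq_zipper[OF S(1) a] by metis
  have d: "distinct (0 # xs)" using S(1) by (simp add: seq_def)
  have F: "fits (Node l a r) c" using d S(2) by (simp add: fits_def inorder_plug xs)
  note D = fitsD[OF F]
  have lt: "a < N" "rt r < N" using D(4) N_gt_1 by (auto intro!: rt_less)
  have hr: "height r \<le> hbound (length xs)" using t(3) by simp
  let ?H = "hbound (length xs)"
  \<comment> \<open>The node to splice out is either \<open>a\<close> itself, lacking a child, or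
    the direct successor of \<open>a\<close>, lacking a left child.\<close>
  define P where "P b h1 \<longleftrightarrow> h1 = h \<and> (b = a \<and> (h a k = 0 \<or> h a (k + 1) = 0) \<or>
    h b k = 0 \<and> (\<exists>ys zs. xs = ys @ a # b # zs))" for b h1
  let ?end = "splice_out k ;; Cond (Equal (Reg 18) (Reg 15)) Skip (Assign 16 (Reg 18) ;; replace k)"
  have E: "wp ?end (?H * 510 + 200) Q R1 h1" if K: "keeps {18} R R1" and P: "P (R1 18) h1" for R1 h1
  proof -
    define b where "b = R1 18"
    have h1: "h1 = h" and b: "b = a \<and> (h a k = 0 \<or> h a (k + 1) = 0) \<or> h b k = 0 \<and> (\<exists>ys zs. xs = ys @ a # b # zs)"
      using P by (auto simp: P_def b_def)
    then have bx: "b \<in> set xs" "h b k = 0 \<or> h b (k + 1) = 0" using a by auto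
    have "wp (splice_out k) (?H * 510 + 100)
       (\<lambda>R' h'. wp (Cond (Equal (Reg 18) (Reg 15)) Skip (Assign 16 (Reg 18) ;; replace k)) 100 Q R' h') R1 h"
    proof (rule wp_splice_out[where R = R1, OF k S _ bx])
      show "R1 18 = b" by (simp add: b_def)
      fix R2 h2 assume 2: "keeps (insert 17 {20..29}) R1 R2" "seq k h2 (remove1 b xs)" "frame_of k (set xs) h h2"
      have r2: "R2 18 = b" "R2 15 = a" using 2(1) K R by (auto simp: keeps_def b_def)
      have KK: "keeps {16..29} R R2" using 2(1) K by (auto simp: keeps_def)
      have "vc (Cond (Equal (Reg 18) (Reg 15)) Skip (Assign 16 (Reg 18) ;; replace k)) Q R2 h2"
      proof (rule vc_CondI)
        assume "evb (Equal (Reg 18) (Reg 15)) R2 h2"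
        then show "vc Skip Q R2 h2" using Q KK 2 r2 by simp
      next
        assume "\<not> evb (Equal (Reg 18) (Reg 15)) R2 h2"
        then have ne: "b \<noteq> a" using r2 by simp
        then obtain ys zs where yz: "xs = ys @ a # b # zs" using b by auto
        have "vc (replace k) Q (R2(16 := b)) h2"
        proof (rule vc_replace[where R = "R2(16 := b)" and a = a and b = b, OF k 2(2)])
          show "set (remove1 b xs) \<subseteq> {..<N}" using S(2) set_remove1_subset by fast
          show "a \<in> set (remove1 b xs)" using a ne by simp
          show "b \<notin> set (remove1 b xs)" using d by simp
          show "0 < b" "b < N" using bx d S(2) by (auto intro: gr0I)
          fix R3 h3 assume 3: "keeps {17} (R2(16 := b)) R3"
            "seq k h3 (map (\<lambda>x. if x = a then b else x) (remove1 b xs))"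
            "frame_of k (insert b (set (remove1 b xs))) h2 h3"
          have "seq k h3 (remove1 a xs)" using 3(2) replace_removed[of ys a b zs] d yz by simp
          moreover have "keeps {16..29} R R3" using 3(1) KK by (auto simp: keeps_def)
          moreover have "insert b (set (remove1 b xs)) \<subseteq> set xs" using bx d by auto
          then have "frame_of k (set xs) h h3" using frame_trans[OF 2(3) 3(3) order_refl] by blast
          ultimately show "Q R3 h3" using Q by blast
        qed (use r2 ne in simp_all)
        then show "vc (Assign 16 (Reg 18) ;; replace k) Q R2 h2" using r2 by simp
      qed simp
      then show "wp (Cond (Equal (Reg 18) (Reg 15)) Skip (Assign 16 (Reg 18) ;; replace k)) 100 Q R2 h2"
        by (rule vc_wp') (simp add: replace_def set_child_def)
    qed
    then show ?thesis unfolding h1 by (rule wp_Then) simp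
  qed
  have C: "wp (Cond (Equal (Fld (Reg 15) k) (Num 0)) Skip
       (Cond (Equal (Fld (Reg 15) (k + 1)) (Num 0)) Skip
         (Assign 18 (Fld (Reg 15) (k + 1)) ;;
          go_left k)))
      (?H * 20 + 60) (\<lambda>R h. wp ?end (?H * 510 + 200) Q R h) (R(18 := a)) h"
  proof (rule wp_Cond[where k = "?H * 20 + 45"])
    assume "evb (Equal (Fld (Reg 15) k) (Num 0)) (R(18 := a)) h"
    then have "wp ?end (?H * 510 + 200) Q (R(18 := a)) h"
      using R by (intro E) (simp_all add: keeps_def P_def)
    then show "wp Skip (?H * 20 + 45) (\<lambda>R h. wp ?end (?H * 510 + 200) Q R h) (R(18 := a)) h"
      by (intro vc_wp') simp_all
  next
    assume n1: "\<not> evb (Equal (Fld (Reg 15) k) (Num 0)) (R(18 := a)) h"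
    show "wp (Cond (Equal (Fld (Reg 15) (k + 1)) (Num 0)) Skip
         (Assign 18 (Fld (Reg 15) (k + 1)) ;;
          go_left k))
        (?H * 20 + 45) (\<lambda>R h. wp ?end (?H * 510 + 200) Q R h) (R(18 := a)) h"
    proof (rule wp_Cond[where k = "?H * 20 + 30"])
      assume "evb (Equal (Fld (Reg 15) (k + 1)) (Num 0)) (R(18 := a)) h"
      then have "wp ?end (?H * 510 + 200) Q (R(18 := a)) h"
        using R by (intro E) (simp_all add: keeps_def P_def)
      then show "wp Skip (?H * 20 + 30) (\<lambda>R h. wp ?end (?H * 510 + 200) Q R h) (R(18 := a)) h"
        by (intro vc_wp') simp_all
    next
      assume "\<not> evb (Equal (Fld (Reg 15) (k + 1)) (Num 0)) (R(18 := a)) h"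
      then have r: "r \<noteq> Leaf" using t(1) R by auto
      let ?b = "hd (inorder r)"
      have "wp (go_left k) (height r * 20 + 10)
          (\<lambda>R h. wp ?end (?H * 510 + 200) Q R h) (R(18 := rt r)) h"
      proof (rule wp_leftmost[OF k _ r, where q = a])
        assume "h ?b k = 0"
        moreover have "xs = (before c @ inorder l) @ a # ?b # (tl (inorder r) @ after c)"
          using r xs by (cases "inorder r") (auto simp: eq_Nil_inorder)
        ultimately have "P ?b h" unfolding P_def by blast
        then have "wp ?end (?H * 510 + 200) Q (R(18 := ?b)) h"
          by (intro E) (simp_all add: keeps_def)
        then show "wp ?end (?H * 510 + 200) Q (R(18 := rt r, 18 := ?b)) h" by simp
      qed (use t(1) D in auto)
      then have W: "wp (go_left k) (?H * 20 + 10)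
          (\<lambda>R h. wp ?end (?H * 510 + 200) Q R h) (R(18 := rt r)) h"
        by (rule wp_mono) (use hr in simp_all)
      show "wp (Assign 18 (Fld (Reg 15) (k + 1)) ;;
          go_left k) (?H * 20 + 30)
          (\<lambda>R h. wp ?end (?H * 510 + 200) Q R h) (R(18 := a)) h"
        by (rule wp_vc_Then[OF _ W]) (use k R lt t(1) in simp_all)
    qed (use k R lt in simp_all)
  qed (use k R lt in simp_all)
  show ?thesis
    unfolding delete_def
    by (rule wp_vc_Then[OF _ wp_Then[OF C order_refl]]) (use R in simp_all)
qed

lemma wp_node_at:
  assumes k: "k \<le> 6" and S: "seq k h xs" "set xs \<subseteq> {..<N}" and R: "R 11 = p" and p: "p < length xs"
    and Q: "\<And>R'. keeps {11, 14, 15} R R' \<Longrightarrow> R' 15 = xs ! p \<Longrightarrow> Q R' h"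
  shows "wp (node_at k) (hbound (length xs) * 60 + 60) Q R h"
proof -
  let ?b = "Unequal (Reg 14) (Reg 11)"
  let ?c = "node_step k"
  obtain t where t: "tr k h t 0" "h 0 k = rt t" "h 0 (k + 3) = 0" "bal t" "inorder t = xs" and d: "distinct (0 # xs)"
    using S(1) unfolding seq_def by blast
  have ht: "height t \<le> hbound (length xs)" using height_le_hbound[OF t(4)] t(5) by (metis length_inorder)
  have "fits t []" using d S(2) t(5) by (simp add: fits_def)
  note tD = fitsD[OF this]
  \<comment> \<open>Register 14 holds the size of the left subtree of the current node, which is the
    index of that node within its own subtree; the loop stops when it equals the index that is
    sought there.\<close>
  have L: "wp (Loop ?b ?c) (height s * 60 + 10) Q R1 h"
    if "tr k h s q" "q' < size s" "set_tree s \<subseteq> {..<N}" "size s < N" "R1 15 = rt s" "R1 14 = size (left s)"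
      "R1 11 = q'" "keeps {11, 14, 15} R R1" "inorder s ! q' = xs ! p" for s q q' R1
    using that
  proof (induction s arbitrary: q q' R1)
    case (Node l a r)
    have h: "h a k = rt l" "h a (k + 1) = rt r" "tr k h l a" "tr k h r a" using Node.prems by auto
    consider "q' = size l" | "q' < size l" | "size l < q'" by linarith
    then show ?case
    proof cases
      case 1
      then have "Q R1 h" using Q Node.prems by (simp add: nth_append)
      then show ?thesis by (intro wp_Loop_end) (use Node.prems 1 in simp_all)
    next
      case 2
      then obtain l1 b l2 where l: "l = Node l1 b l2" by (cases l) auto
      have hb: "h b k = rt l1" "tr k h l1 b" using h(3) l by auto
      have s: "h (rt l1) (k + 3) = size l1" using tr_size[OF hb(2) t(3)] .
      have lt: "rt l1 < N" using Node.prems(3) N_gt_1 unfolding l by (auto intro!: rt_less)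
      have "wp (Loop ?b ?c) (height l * 60 + 10) Q (R1(15 := b, 14 := size l1)) h"
      proof (rule Node.IH(1)[OF h(3), of q'])
        show "inorder l ! q' = xs ! p" using Node.prems(9) 2 by (simp add: nth_append)
      qed (use Node.prems l 2 in \<open>auto simp: keeps_def\<close>)
      then have "vc ?c (\<lambda>R h. wp (Loop ?b ?c) (height l * 60 + 10) Q R h) R1 h"
        using Node.prems k 2 h s lt hb l by simp
      then show ?thesis
        by (rule wp_vc_Loop_step[rotated 2]) (use Node.prems 2 in simp_all)
    next
      case 3
      then obtain r1 b r2 where r: "r = Node r1 b r2" using Node.prems by (cases r) auto
      have hb: "h b k = rt r1" "tr k h r1 b" using h(4) r by auto
      have s: "h (rt r1) (k + 3) = size r1" using tr_size[OF hb(2) t(3)] .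
      have lt: "rt r1 < N" using Node.prems(3) N_gt_1 unfolding r by (auto intro!: rt_less)
      have "wp (Loop ?b ?c) (height r * 60 + 10) Q (R1(11 := q' - (size l + 1), 15 := b, 14 := size r1)) h"
      proof (rule Node.IH(2)[OF h(4), of "q' - (size l + 1)"])
        show "inorder r ! (q' - (size l + 1)) = xs ! p" using Node.prems(9) 3 by (simp add: nth_append)
      qed (use Node.prems r 3 in \<open>auto simp: keeps_def\<close>)
      then have "vc ?c (\<lambda>R h. wp (Loop ?b ?c) (height r * 60 + 10) Q R h) R1 h"
        using Node.prems k 3 h s lt hb r by (simp add: fun_upd_twist)
      then show ?thesis
        by (rule wp_vc_Loop_step[rotated 2]) (use Node.prems 3 in simp_all)
    qed
  qed simp
  have nl: "t \<noteq> Leaf" using p t(5) by auto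
  then obtain l a r where tt: "t = Node l a r" by (cases t) auto
  have h: "h a k = rt l" "tr k h l a" using t(1) tt by auto
  have s: "h (rt l) (k + 3) = size l" using tr_size[OF h(2) t(3)] .
  have lt: "rt l < N" "a < N" using tD(4) N_gt_1 unfolding tt by (auto intro!: rt_less)
  have "p < size t" using p t(5) by auto
  then have W: "wp (Loop ?b ?c) (height t * 60 + 10) Q (R(15 := rt t, 14 := size (left t))) h"
    by (intro L[OF t(1), of p]) (use t(5) tD R in \<open>auto simp: keeps_def\<close>)
  have "wp (node_at k) (50 + (height t * 60 + 10)) Q R h"
    unfolding node_at_def
    by (rule wp_vc_Then[OF _ W]) (use k t tt h s lt N_gt_1 in simp_all)
  then show ?thesis by (rule wp_mono) (use ht in simp_all)
qed

lemma wp_rank: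
  assumes k: "k \<le> 6" and S: "seq k h xs" "set xs \<subseteq> {..<N}" and R: "R 30 = a" and a: "a \<in> set xs"
    and Q: "\<And>R'. keeps {30, 31, 32} R R' \<Longrightarrow> R' 31 = length (takeWhile (\<lambda>x. x \<noteq> a) xs) + 1 \<Longrightarrow> Q R' h"
  shows "wp (rank k) (hbound (length xs) * 70 + 60) Q R h"
proof -
  let ?b = "Unequal (Fld (Reg 30) (k + 2)) (Num 0)"
  let ?c = "rank_step k"
  obtain l r c where xs: "xs = before c @ inorder l @ a # inorder r @ after c"
    and t: "tr k h (Node l a r) (parent c)" "cx k h c a"
      "height (Node l a r) + length c \<le> hbound (length xs)"
    using seq_zipper[OF S(1) a] by metis
  have d: "distinct (0 # xs)" using S(1) by (simp add: seq_def)
  have F: "fits (Node l a r) c" using d S(2) by (simp add: fits_def inorder_plug xs)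
  note D = fitsD[OF F]
  have z: "h 0 (k + 3) = 0" using cx_zero_size[OF t(2)] .
  have "length xs = card (set xs)" using d by (simp add: distinct_card)
  also have "\<dots> \<le> card {..<N}" using S(2) by (intro card_mono) auto
  finally have len: "length xs \<le> N" by simp
  \<comment> \<open>Each iteration consumes one frame of \<open>e\<close>. The invariant is that
    register 31 plus the number of nodes still contributed by \<open>e\<close> is the final
    rank.\<close>
  have L: "wp (Loop ?b ?c) (length e * 70 + 20) Q R1 h"
    if "cx k h e y" "h y (k + 2) = parent e" "y \<notin> nodes e" "y \<noteq> 0" "proper e" "nodes e \<subseteq> {..<N}" "y < N"
      "R1 30 = y" "R1 31 + length (before e) \<le> N" "keeps {30, 31, 32} R R1"
      "R1 31 + length (before e) = length (takeWhile (\<lambda>x. x \<noteq> a) xs) + 1" for e y R1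
    using that
  proof (induction e arbitrary: y R1)
    case Nil
    have "Q R1 h" using Q Nil.prems by simp
    then show ?case by (intro wp_Loop_end) (use k Nil.prems in simp_all)
  next
    case (Cons f e)
    obtain g b s where f: "f = (g, b, s)" by (cases f)
    have b: "b \<noteq> 0" "b < N" "rt s < N" using Cons.prems N_gt_1 f by (auto intro!: rt_less)
    have hb: "h b k = (if g then y else rt s)" "h b (k + 1) = (if g then rt s else y)" "h b (k + 2) = parent e"
      "tr k h s b" "cx k h e b" "h y (k + 2) = b" using Cons.prems f by auto
    have s: "h (rt s) (k + 3) = size s" using tr_size[OF hb(4) z] .
    \<comment> \<open>Since the sibling has a different root, comparing the right link with the
      current node detects reliably on which side the climb came up.\<close>
    have ry: "rt s \<noteq> y" using Cons.prems f by (intro rt_neq) auto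
    let ?R = "R1(32 := b, 31 := R1 31 + (if g then 0 else size s + 1), 30 := b)"
    have W: "wp (Loop ?b ?c) (length e * 70 + 20) Q ?R h"
      by (rule Cons.IH[OF hb(5,3)]) (use Cons.prems f b in \<open>auto simp: keeps_def\<close>)
    have "vc ?c (\<lambda>R h. wp (Loop ?b ?c) (length e * 70 + 20) Q R h) R1 h"
    proof (cases g)
      case True
      then have "?R = R1(32 := b, 30 := b)" by (auto simp: fun_eq_iff)
      then show ?thesis using W k True b hb[simplified] s ry Cons.prems(7,8) by simp
    next
      case False
      moreover have "R1 31 + (size s + 1) < 16 * N" using Cons.prems f False by simp
      ultimately show ?thesis using W k b hb[simplified] s ry Cons.prems(7,8) by simp
    qed
    then show ?case
      by (rule wp_vc_Loop_step[rotated 2]) (use k Cons.prems f b hb in simp_all)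
  qed
  have h: "h a k = rt l" "h a (k + 2) = parent c" "tr k h l a" using t(1) by auto
  have s: "h (rt l) (k + 3) = size l" using tr_size[OF h(3) z] .
  have lt: "a < N" "rt l < N" using D(4) N_gt_1 by (auto intro!: rt_less)
  have "a \<notin> set (before c @ inorder l)" using d xs by auto
  then have tw: "takeWhile (\<lambda>x. x \<noteq> a) xs = before c @ inorder l"
    unfolding xs by (subst append_assoc[symmetric], subst takeWhile_append2) auto
  have W: "wp (Loop ?b ?c) (length c * 70 + 20) Q (R(31 := size l + 1)) h"
    by (rule L[OF t(2) h(2)]) (use D lt R len xs tw in \<open>auto simp: keeps_def\<close>)
  have "wp (rank k) (40 + (length c * 70 + 20)) Q R h"
    unfolding rank_def
    by (rule wp_vc_Then[OF _ W]) (use k R h s lt D(5) in simp_all)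
  then show ?thesis by (rule wp_mono) (use t(3) in simp_all)
qed

end

section \<open>Searching\<close>

definition rk :: "nat list \<Rightarrow> nat \<Rightarrow> nat" where
  "rk gs a = (if a \<in> set gs then length (takeWhile (\<lambda>x. x \<noteq> a) gs) + 1 else 0)"

lemma rk_Nil [simp]: "rk [] x = 0"
  by (simp add: rk_def)

lemma rk_Cons: "rk (a # gs) x = (if x = a then 1 else if x \<in> set gs then rk gs x + 1 else 0)"
  by (auto simp: rk_def)

lemma rk_append: "rk (gs @ hs) x = (if x \<in> set gs then rk gs x else if x \<in> set hs then length gs + rk hs x else 0)"
  by (induction gs) (auto simp: rk_Cons rk_def)

lemma rk_le: "rk gs x \<le> length gs"
  by (induction gs) (auto simp: rk_Cons)

lemma rk_pos: "x \<in> set gs \<longleftrightarrow> 0 < rk gs x"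
  by (simp add: rk_def)

lemma nth_rk: "x \<in> set gs \<Longrightarrow> gs ! (rk gs x - 1) = x"
  by (induction gs) (auto simp: rk_Cons rk_pos nth_Cons')

lemma rk_nth: "distinct gs \<Longrightarrow> i < length gs \<Longrightarrow> rk gs (gs ! i) = i + 1"
  by (induction gs arbitrary: i) (auto simp: rk_Cons nth_Cons' less_Suc_eq_0_disj)

lemma rk_map: "inj_on f (insert x (set gs)) \<Longrightarrow> rk (map f gs) (f x) = rk gs x"
  by (induction gs) (auto simp: rk_Cons inj_on_def)

definition kle :: "heap \<Rightarrow> nat list \<Rightarrow> nat \<Rightarrow> nat \<Rightarrow> nat \<Rightarrow> bool" where
  "kle h gs v t a \<longleftrightarrow> h a 8 < v \<or> h a 8 = v \<and> rk gs a \<le> t"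

definition klt :: "heap \<Rightarrow> nat list \<Rightarrow> nat \<Rightarrow> nat \<Rightarrow> bool" where
  "klt h gs a b \<longleftrightarrow> h a 8 < h b 8 \<or> h a 8 = h b 8 \<and> rk gs a < rk gs b"

text \<open>
  The tree in the fields 0 to 3 holds the log \<open>gs\<close>; the one in the fields 4 to 7 holds all records
  \<open>ds\<close>, ordered by vertex and then by position in the log. The records outside of \<open>gs\<close> hold the
  initial values and count as position 0. The fields 8 and 9 hold the vertex and the spin value.
\<close>

definition store :: "heap \<Rightarrow> nat list \<Rightarrow> nat list \<Rightarrow> bool" where
  "store h gs ds \<longleftrightarrow> seq 0 h gs \<and> seq 4 h ds \<and> set gs \<subseteq> set ds \<and>
     (\<forall>a\<in>set ds - set gs. \<forall>f<4. h a f = 0) \<and> sorted_wrt (klt h gs) ds"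

text \<open>Counts the nodes satisfying \<open>E\<close> on the search path that goes right at
  \<open>P\<close>. With \<open>E\<close> for the nodes of the sought vertex, these are the
  comparisons that may need a position.\<close>

fun eqs :: "(nat \<Rightarrow> bool) \<Rightarrow> (nat \<Rightarrow> bool) \<Rightarrow> nat tree \<Rightarrow> nat" where
  "eqs P E Leaf = 0"
| "eqs P E (Node l a r) = (if E a then 1 else 0) + eqs P E (if P a then r else l)"

lemma eqs_height: "eqs P E t \<le> height t"
  by (induction t) auto

text \<open>Until a node of \<open>v\<close> is met, the path goes left at no charge. At the first
  one, the whole left subtree belongs to \<open>v\<close>; together with that node it has at most
  \<open>F\<close> nodes, so by balance the entire remaining subtree has at most
  \<open>4 * F\<close> nodes and its height bounds the rest.\<close>

lemma eqs_above:
  fixes v :: nat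
  assumes "bal t" "sorted (map g (inorder t))" "\<forall>a\<in>set_tree t. v \<le> g a" "\<forall>a. v < g a \<longrightarrow> \<not> P a"
    "length (filter (\<lambda>a. g a = v) (inorder t)) \<le> F"
  shows "eqs P (\<lambda>a. g a = v) t \<le> hbound (4 * F)"
  using assms
proof (induction t)
  case (Node l a r)
  show ?case
  proof (cases "g a = v")
    case True
    have "\<forall>x\<in>set_tree l. g x = v"
      using Node.prems(2,3) True by (force simp: sorted_append)
    then have "filter (\<lambda>a. g a = v) (inorder l) = inorder l" by simp
    then have "size1 l \<le> F" using Node.prems(5) True by (simp add: size1_size)
    moreover have "size1 r \<le> 3 * size1 l" using Node.prems(1) by (simp add: near_def)
    ultimately have "size (Node l a r) \<le> 4 * F" by (simp add: size1_size)
    then have "height (Node l a r) \<le> hbound (4 * F)"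
      using height_le_hbound[OF Node.prems(1)] hbound_mono le_trans by blast
    then show ?thesis using eqs_height le_trans by blast
  next
    case False
    then have "v < g a" using Node.prems(3) by force
    then have "\<not> P a" using Node.prems(4) by blast
    moreover have "eqs P (\<lambda>a. g a = v) l \<le> hbound (4 * F)"
      using Node.prems by (intro Node.IH(1)) (auto simp: sorted_append split: if_splits)
    ultimately show ?thesis using False by simp
  qed
qed simp

lemma eqs_below:
  fixes v :: nat
  assumes "bal t" "sorted (map g (inorder t))" "\<forall>a\<in>set_tree t. g a \<le> v" "\<forall>a. g a < v \<longrightarrow> P a"
    "length (filter (\<lambda>a. g a = v) (inorder t)) \<le> F"
  shows "eqs P (\<lambda>a. g a = v) t \<le> hbound (4 * F)"
  using assms
proof (induction t)
  case (Node l a r)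
  show ?case
  proof (cases "g a = v")
    case True
    have "\<forall>x\<in>set_tree r. g x = v"
      using Node.prems(2,3) True by (force simp: sorted_append)
    then have "filter (\<lambda>a. g a = v) (inorder r) = inorder r" by simp
    then have "size1 r \<le> F" using Node.prems(5) True by (simp add: size1_size)
    moreover have "size1 l \<le> 3 * size1 r" using Node.prems(1) by (simp add: near_def)
    ultimately have "size (Node l a r) \<le> 4 * F" by (simp add: size1_size)
    then have "height (Node l a r) \<le> hbound (4 * F)"
      using height_le_hbound[OF Node.prems(1)] hbound_mono le_trans by blast
    then show ?thesis using eqs_height le_trans by blast
  next
    case False
    then have "g a < v" using Node.prems(3) by force
    then have "P a" using Node.prems(4) by blast
    moreover have "eqs P (\<lambda>a. g a = v) r \<le> hbound (4 * F)"
      using Node.prems by (intro Node.IH(2)) (auto simp: sorted_append split: if_splits)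
    ultimately show ?thesis using False by simp
  qed
qed simp

text \<open>
  The nodes with vertex \<open>v\<close> are contiguous. Once a search path has met one of them, on each side it
  can meet a further one only if that has a subtree, of comparable weight, all of whose nodes belong
  to \<open>v\<close>; so the number of rank computations is logarithmic in the number of nodes with vertex \<open>v\<close>.
\<close>

lemma eqs_bound:
  fixes v :: nat
  assumes "bal t" "sorted (map g (inorder t))" "\<forall>a. g a < v \<longrightarrow> P a" "\<forall>a. v < g a \<longrightarrow> \<not> P a"
    "length (filter (\<lambda>a. g a = v) (inorder t)) \<le> F"
  shows "eqs P (\<lambda>a. g a = v) t \<le> 1 + hbound (4 * F)"
  using assms
proof (induction t)
  case (Node l a r)
  have s: "bal l" "bal r" "sorted (map g (inorder l))" "sorted (map g (inorder r))"
    "length (filter (\<lambda>a. g a = v) (inorder l)) \<le> F" "length (filter (\<lambda>a. g a = v) (inorder r)) \<le> F"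
    "\<forall>x\<in>set_tree l. g x \<le> g a" "\<forall>x\<in>set_tree r. g a \<le> g x"
    using Node.prems by (auto simp: sorted_append split: if_splits)
  consider "g a = v" | "g a < v" | "v < g a" using less_linear by blast
  then show ?case
  proof cases
    case 1
    then show ?thesis
      using eqs_below[of l g v P F] eqs_above[of r g v P F] s Node.prems(3,4) by simp
  next
    case 2
    then show ?thesis using Node.IH(2) s Node.prems(3,4) by simp
  next
    case 3
    then show ?thesis using Node.IH(1) s Node.prems(3,4) by simp
  qed
qed simp

text \<open>
  The pair \<open>(v, t)\<close> is passed in the registers 33 and 34. The results are the last record up to
  \<open>(v, t)\<close> in register 36, the first record after it (or 0) in register 37, and the number of records
  up to \<open>(v, t)\<close> in register 38.
\<close>

definition decide :: cmd where
  "decide =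
     Cond (Less (Fld (Reg 35) 8) (Reg 33)) (Assign 39 (Num 1))
       (Cond (Equal (Fld (Reg 35) 8) (Reg 33))
          (Cond (Equal (Fld (Reg 35) 3) (Num 0)) (Assign 39 (Num 1))
             (Assign 30 (Reg 35) ;; rank 0 ;;
              Cond (Less (Reg 34) (Reg 31)) (Assign 39 (Num 0)) (Assign 39 (Num 1))))
          (Assign 39 (Num 0)))"

abbreviation descend :: cmd where
  "descend \<equiv>
     Cond (Equal (Reg 39) (Num 1))
       (Assign 36 (Reg 35) ;; Assign 38 (Plus (Reg 38) (Plus (Fld (Fld (Reg 35) 4) 7) (Num 1))) ;;
        Assign 35 (Fld (Reg 35) 5))
       (Assign 37 (Reg 35) ;; Assign 35 (Fld (Reg 35) 4))"

definition search :: cmd where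
  "search =
     (Assign 35 (Fld (Num 0) 4) ;; Assign 36 (Num 0) ;; Assign 37 (Num 0) ;; Assign 38 (Num 0)) ;;
     Loop (Unequal (Reg 35) (Num 0))
       (decide ;; descend)"

text \<open>The product bounds the expensive comparisons, of which there are logarithmically many in
  the block size \<open>T + 1\<close>; the term in \<open>hbound n\<close> pays for the cheap work
  on each level of the other tree.\<close>

definition search_cost :: "nat \<Rightarrow> nat \<Rightarrow> nat" where
  "search_cost T n = (1 + hbound (4 * (T + 1))) * (hbound T * 70 + 120) + hbound n * 100 + 60"

lemma size_pos: "seq k h xs \<Longrightarrow> a \<in> set xs \<Longrightarrow> 0 < h a (k + 3)"
  by (erule seq_zipper[where a = a]) auto

lemma sorted_wrt_sorted: "sorted_wrt (klt h gs) ds \<Longrightarrow> sorted (map (\<lambda>a. h a 8) ds)"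
  unfolding sorted_map by (erule sorted_wrt_mono_rel[rotated]) (auto simp: klt_def)

lemma sorted_wrt_unrelated:
  "sorted_wrt r xs \<Longrightarrow> (\<And>a b. a \<in> set xs \<Longrightarrow> b \<in> set xs \<Longrightarrow> \<not> r a b) \<Longrightarrow> length xs \<le> 1"
  by (cases xs rule: remdups_adj.cases) auto

text \<open>Records outside of \<open>gs\<close> all have rank 0, so two of them with the same
  vertex would be unrelated by the strict order \<open>klt\<close>. Hence at most one is added to
  the log entries.\<close>

lemma same_vertex_count:
  assumes "sorted_wrt (klt h gs) ds" "distinct gs" "distinct ds"
  shows "length (filter (\<lambda>a. h a 8 = v) ds) \<le> length gs + 1"
proof -
  let ?xs = "filter (\<lambda>a. h a 8 = v) ds"
  have "length (filter (\<lambda>a. a \<in> set gs) ?xs) = card (set (filter (\<lambda>a. a \<in> set gs) ?xs))"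
    using assms(3) by (intro distinct_card[symmetric] distinct_filter)
  also have "\<dots> \<le> card (set gs)" by (intro card_mono) auto
  also have "\<dots> = length gs" using assms(2) by (rule distinct_card)
  finally have 1: "length (filter (\<lambda>a. a \<in> set gs) ?xs) \<le> length gs" .
  have 2: "length (filter (\<lambda>a. a \<notin> set gs) ?xs) \<le> 1"
  proof (rule sorted_wrt_unrelated)
    show "sorted_wrt (klt h gs) (filter (\<lambda>a. a \<notin> set gs) ?xs)"
      using assms(1) by (intro sorted_wrt_filter)
  qed (auto simp: klt_def rk_pos)
  show ?thesis using 1 2 sum_length_filter_compl[of "\<lambda>a. a \<in> set gs" ?xs] by linarith
qed

lemma kle_mono: "klt h gs a b \<Longrightarrow> kle h gs v t b \<Longrightarrow> kle h gs v t a"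
  by (auto simp: klt_def kle_def)

context ram
begin

text \<open>A zero size field of the log tree reveals that a record carries an initial value, so its
  position 0 is known without a climb. Only log entries of the vertex \<open>v\<close> itself pay
  for a rank.\<close>

lemma wp_decide:
  assumes S: "seq 0 h gs" "set gs \<subseteq> {..<N}" and R: "R 35 = a" "R 33 = v" "R 34 = t"
    and a: "a < N" "a \<notin> set gs \<Longrightarrow> h a 3 = 0"
    and Q: "\<And>R'. keeps {30, 31, 32, 39} R R' \<Longrightarrow> R' 39 = (if kle h gs v t a then 1 else 0) \<Longrightarrow> Q R' h"
  shows "wp decide ((if h a 8 = v then hbound (length gs) * 70 + 120 else 0) + 30) Q R h"
  unfolding decide_def
proof (rule wp_Cond[where k = "(if h a 8 = v then hbound (length gs) * 70 + 120 else 0) + 15"])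
  assume "evb (Less (Fld (Reg 35) 8) (Reg 33)) R h"
  then have "h a 8 < v" using R by simp
  then have "Q (R(39 := 1)) h" by (intro Q) (auto simp: keeps_def kle_def)
  then show "wp (Assign 39 (Num 1)) ((if h a 8 = v then hbound (length gs) * 70 + 120 else 0) + 15) Q R h"
    by (intro vc_wp') simp_all
next
  assume "\<not> evb (Less (Fld (Reg 35) 8) (Reg 33)) R h"
  then have n1: "\<not> h a 8 < v" using R by simp
  show "wp (Cond (Equal (Fld (Reg 35) 8) (Reg 33))
          (Cond (Equal (Fld (Reg 35) 3) (Num 0)) (Assign 39 (Num 1))
             (Assign 30 (Reg 35) ;; rank 0 ;;
              Cond (Less (Reg 34) (Reg 31)) (Assign 39 (Num 0)) (Assign 39 (Num 1))))
          (Assign 39 (Num 0))) ((if h a 8 = v then hbound (length gs) * 70 + 120 else 0) + 15) Q R h"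
  proof (rule wp_Cond[where k = "(if h a 8 = v then hbound (length gs) * 70 + 120 else 0) + 5"])
    assume "\<not> evb (Equal (Fld (Reg 35) 8) (Reg 33)) R h"
    then have "h a 8 > v" using R n1 by simp
    then have "Q (R(39 := 0)) h" by (intro Q) (auto simp: keeps_def kle_def)
    then show "wp (Assign 39 (Num 0)) ((if h a 8 = v then hbound (length gs) * 70 + 120 else 0) + 5) Q R h"
      by (intro vc_wp') simp_all
  next
    assume "evb (Equal (Fld (Reg 35) 8) (Reg 33)) R h"
    then have e: "h a 8 = v" using R by simp
    show "wp (Cond (Equal (Fld (Reg 35) 3) (Num 0)) (Assign 39 (Num 1))
             (Assign 30 (Reg 35) ;; rank 0 ;;
              Cond (Less (Reg 34) (Reg 31)) (Assign 39 (Num 0)) (Assign 39 (Num 1))))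
       ((if h a 8 = v then hbound (length gs) * 70 + 120 else 0) + 5) Q R h"
    proof (rule wp_Cond[where k = "hbound (length gs) * 70 + 100"])
      assume "evb (Equal (Fld (Reg 35) 3) (Num 0)) R h"
      then have "h a 3 = 0" using R by simp
      then have "a \<notin> set gs" using size_pos[OF S(1), of a] by auto
      then have "Q (R(39 := 1)) h" using e by (intro Q) (auto simp: keeps_def kle_def rk_def)
      then show "wp (Assign 39 (Num 1)) (hbound (length gs) * 70 + 100) Q R h"
        by (intro vc_wp') simp_all
    next
      assume "\<not> evb (Equal (Fld (Reg 35) 3) (Num 0)) R h"
      then have ag: "a \<in> set gs" using R a(2) by auto
      let ?P = "\<lambda>R h. wp (Cond (Less (Reg 34) (Reg 31)) (Assign 39 (Num 0)) (Assign 39 (Num 1))) 10 Q R h"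
      have W: "wp (rank 0) (hbound (length gs) * 70 + 60) ?P (R(30 := a)) h"
      proof (rule wp_rank[where R = "R(30 := a)" and a = a, OF _ S _ ag])
        fix R'
        assume 1: "keeps {30, 31, 32} (R(30 := a)) R'" "R' 31 = length (takeWhile (\<lambda>x. x \<noteq> a) gs) + 1"
        have r: "R' 31 = rk gs a" "R' 34 = t" using 1 ag R by (simp_all add: rk_def keeps_def)
        have "Q (R'(39 := if kle h gs v t a then 1 else 0)) h"
          using 1(1) by (intro Q) (auto simp: keeps_def)
        then have "vc (Cond (Less (Reg 34) (Reg 31)) (Assign 39 (Num 0)) (Assign 39 (Num 1))) Q R' h"
          using r e by (auto simp: kle_def not_less split: if_splits)
        then show "?P R' h" by (rule vc_wp') simp
      qed simp_all
      show "wp (Assign 30 (Reg 35) ;; rank 0 ;;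
            Cond (Less (Reg 34) (Reg 31)) (Assign 39 (Num 0)) (Assign 39 (Num 1)))
          (hbound (length gs) * 70 + 100) Q R h"
        by (rule wp_vc_Then[OF _ wp_Then[OF W order_refl]]) (use R in simp_all)
    qed (use R a e in simp_all)
  qed (use R a in simp_all)
qed (use R a in simp_all)

text \<open>The best candidates found higher up, in registers 36 and 37, enter as defaults of
  \<open>last\<close> and \<open>hd\<close>; this makes the claim inductive for subtrees. Whole
  sides are skipped because \<open>kle\<close> is downward closed along \<open>klt\<close>.\<close>

lemma wp_search_loop:
  assumes S: "store h gs ds" "set ds \<subseteq> {..<N}"
    and "tr 4 h s q" "set_tree s \<subseteq> set ds" "size s < N" "0 \<notin> set_tree s" "sorted_wrt (klt h gs) (inorder s)"
    and "R 35 = rt s" "R 33 = v" "R 34 = t" "R 38 + size s < 2 * N"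
    and "\<And>R'. keeps {30, 31, 32, 35, 36, 37, 38, 39} R R' \<Longrightarrow>
      R' 36 = last (R 36 # filter (kle h gs v t) (inorder s)) \<Longrightarrow>
      R' 37 = hd (filter (\<lambda>a. \<not> kle h gs v t a) (inorder s) @ [R 37]) \<Longrightarrow>
      R' 38 = R 38 + length (filter (kle h gs v t) (inorder s)) \<Longrightarrow> Q R' h"
  shows "wp (Loop (Unequal (Reg 35) (Num 0))
       (decide ;; descend))
     (eqs (kle h gs v t) (\<lambda>a. h a 8 = v) s * (hbound (length gs) * 70 + 120) + height s * 100 + 10) Q R h"
    (is "wp (Loop ?b (decide ;; ?c)) (?T s) Q R h")
  using assms(3-)
proof (induction s arbitrary: q R)
  case Leaf
  have "Q R h" by (rule Leaf.prems) (use Leaf.prems in \<open>simp_all add: keeps_def\<close>)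
  then show ?case by (intro wp_Loop_end) (use Leaf.prems in simp_all)
next
  case (Node l a r)
  let ?P = "kle h gs v t"
  have z: "h 0 7 = 0" using S(1) by (auto simp: store_def seq_def)
  have h: "h a 4 = rt l" "h a 5 = rt r" "tr 4 h l a" "tr 4 h r a" using Node.prems by auto
  have s: "h (rt l) 7 = size l" using tr_size[OF h(3)] z by simp
  have a: "a \<noteq> 0" "a < N" "a \<in> set ds" using Node.prems S(2) by auto
  have lt: "rt l < N" using Node.prems S(2) N_gt_1 by (auto intro!: rt_less)
  have G: "seq 0 h gs" "set gs \<subseteq> {..<N}" "a \<notin> set gs \<Longrightarrow> h a 3 = 0" using S a by (auto simp: store_def)
  have ml: "\<forall>x\<in>set_tree l. klt h gs x a" "\<forall>x\<in>set_tree r. klt h gs a x"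
    using Node.prems(5) by (auto simp: sorted_wrt_append)
  let ?E = "(if h a 8 = v then hbound (length gs) * 70 + 120 else 0)"
  let ?n = "if ?P a then r else l"
  have W: "wp decide (?E + 30) (\<lambda>R h. wp ?c 40 (\<lambda>R h. wp (Loop ?b (decide ;; ?c)) (?T ?n) Q R h) R h) R h"
  proof (rule wp_decide[where R = R, OF G(1,2) _ Node.prems(7,8) a(2) G(3)])
    fix R1 assume 1: "keeps {30, 31, 32, 39} R R1" "R1 39 = (if ?P a then 1 else 0)"
    have r1: "R1 35 = a" "R1 33 = v" "R1 34 = t" "R1 38 = R 38" "R1 36 = R 36" "R1 37 = R 37"
      using 1(1) Node.prems by (simp_all add: keeps_def)
    show "wp ?c 40 (\<lambda>R h. wp (Loop ?b (decide ;; ?c)) (?T ?n) Q R h) R1 h"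
    proof (cases "?P a")
      case True
      have fl: "\<forall>x\<in>set_tree l. ?P x" using ml(1) kle_mono True by blast
      then have fl: "filter ?P (inorder l) = inorder l" "filter (\<lambda>a. \<not> ?P a) (inorder l) = []" by simp_all
      let ?R = "R1(36 := a, 38 := R 38 + (size l + 1), 35 := rt r)"
      have W: "wp (Loop ?b (decide ;; ?c)) (?T r) Q ?R h"
      proof (rule Node.IH(2)[OF h(4)])
        fix R' assume 2: "keeps {30, 31, 32, 35, 36, 37, 38, 39} ?R R'"
          "R' 36 = last (?R 36 # filter ?P (inorder r))"
          "R' 37 = hd (filter (\<lambda>a. \<not> ?P a) (inorder r) @ [?R 37])"
          "R' 38 = ?R 38 + length (filter ?P (inorder r))"
        have "keeps {30, 31, 32, 35, 36, 37, 38, 39} R R'" using 1(1) 2(1) by (auto simp: keeps_def)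
        then show "Q R' h" using Node.prems(10)[of R'] 2(2-) r1 fl True by simp
      qed (use Node.prems r1 in \<open>auto simp: sorted_wrt_append\<close>)
      have "vc ?c (\<lambda>R h. wp (Loop ?b (decide ;; ?c)) (?T r) Q R h) R1 h"
        using W 1(2) True r1 a lt h s Node.prems(9) by simp
      then show ?thesis using True by (intro vc_wp') simp_all
    next
      case False
      have "\<forall>x\<in>set_tree r. \<not> ?P x" using ml(2) kle_mono False by blast
      then have fl: "filter ?P (inorder r) = []" "filter (\<lambda>a. \<not> ?P a) (inorder r) = inorder r" by simp_all
      let ?R = "R1(37 := a, 35 := rt l)"
      have W: "wp (Loop ?b (decide ;; ?c)) (?T l) Q ?R h"
      proof (rule Node.IH(1)[OF h(3)])
        fix R' assume 2: "keeps {30, 31, 32, 35, 36, 37, 38, 39} ?R R'"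
          "R' 36 = last (?R 36 # filter ?P (inorder l))"
          "R' 37 = hd (filter (\<lambda>a. \<not> ?P a) (inorder l) @ [?R 37])"
          "R' 38 = ?R 38 + length (filter ?P (inorder l))"
        have "keeps {30, 31, 32, 35, 36, 37, 38, 39} R R'" using 1(1) 2(1) by (auto simp: keeps_def)
        then show "Q R' h" using Node.prems(10)[of R'] 2(2-) r1 fl False by (simp add: hd_append)
      qed (use Node.prems r1 in \<open>auto simp: sorted_wrt_append\<close>)
      have "vc ?c (\<lambda>R h. wp (Loop ?b (decide ;; ?c)) (?T l) Q R h) R1 h"
        using W 1(2) False r1 a lt h s Node.prems(9) by simp
      then show ?thesis using False by (intro vc_wp') simp_all
    qed
  qed (use Node.prems in simp_all)
  show ?case
  proof (rule wp_Loop_step[OF _ _ wp_Then[OF W order_refl]])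
    have "height ?n \<le> max (height l) (height r)" by simp
    then show "costB ?b + 1 + (?E + 30 + 40) + ?T ?n \<le> ?T (Node l a r)"
      by (cases "h a 8 = v"; cases "?P a") (simp_all add: algebra_simps)
  qed (use Node.prems a in simp_all)
qed

lemma wp_search:
  assumes S: "store h gs ds" "set ds \<subseteq> {..<N}" and R: "R 33 = v" "R 34 = t"
    and Q: "\<And>R'. keeps {30, 31, 32, 35, 36, 37, 38, 39} R R' \<Longrightarrow>
      R' 36 = last (0 # filter (kle h gs v t) ds) \<Longrightarrow>
      R' 37 = hd (filter (\<lambda>a. \<not> kle h gs v t a) ds @ [0]) \<Longrightarrow>
      R' 38 = length (filter (kle h gs v t) ds) \<Longrightarrow> Q R' h"
  shows "wp search (search_cost (length gs) (length ds)) Q R h"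
proof -
  obtain s where s: "tr 4 h s 0" "h 0 4 = rt s" "h 0 7 = 0" "bal s" "inorder s = ds" and d: "distinct (0 # ds)"
    using S(1) unfolding store_def seq_def by auto
  have "fits s []" using d S(2) s(5) by (simp add: fits_def)
  note D = fitsD[OF this]
  have srt: "sorted_wrt (klt h gs) ds" and dg: "distinct gs" using S(1) by (auto simp: store_def seq_def)
  have hs: "height s \<le> hbound (length ds)" using height_le_hbound[OF s(4)] s(5) by (metis length_inorder)
  have "eqs (kle h gs v t) (\<lambda>a. h a 8 = v) s \<le> 1 + hbound (4 * (length gs + 1))"
  proof (rule eqs_bound[OF s(4)])
    show "sorted (map (\<lambda>a. h a 8) (inorder s))" using sorted_wrt_sorted[OF srt] s(5) by simp
    show "length (filter (\<lambda>a. h a 8 = v) (inorder s)) \<le> length gs + 1"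
      using same_vertex_count[OF srt dg] d s(5) by simp
  qed (auto simp: kle_def)
  then have e: "eqs (kle h gs v t) (\<lambda>a. h a 8 = v) s * (hbound (length gs) * 70 + 120)
    \<le> (1 + hbound (4 * (length gs + 1))) * (hbound (length gs) * 70 + 120)"
    by (rule mult_le_mono1)
  let ?R = "R(35 := rt s, 36 := 0, 37 := 0, 38 := 0)"
  have W: "wp (Loop (Unequal (Reg 35) (Num 0))
       (decide ;; descend))
     (eqs (kle h gs v t) (\<lambda>a. h a 8 = v) s * (hbound (length gs) * 70 + 120) + height s * 100 + 10) Q ?R h"
  proof (rule wp_search_loop[OF S s(1)])
    fix R' assume 1: "keeps {30, 31, 32, 35, 36, 37, 38, 39} ?R R'"
      "R' 36 = last (?R 36 # filter (kle h gs v t) (inorder s))"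
      "R' 37 = hd (filter (\<lambda>a. \<not> kle h gs v t a) (inorder s) @ [?R 37])"
      "R' 38 = ?R 38 + length (filter (kle h gs v t) (inorder s))"
    have "keeps {30, 31, 32, 35, 36, 37, 38, 39} R R'" using 1(1) by (auto simp: keeps_def)
    then show "Q R' h" using Q 1(2-) s(5) by simp
  qed (use s srt R D in auto)
  have "wp search (50 + (eqs (kle h gs v t) (\<lambda>a. h a 8 = v) s * (hbound (length gs) * 70 + 120) + height s * 100 + 10)) Q R h"
    unfolding search_def
    by (rule wp_vc_Then[OF _ W]) (use s N_gt_1 in simp_all)
  then show ?thesis
    by (rule wp_mono) (use e hs in \<open>simp_all add: search_cost_def\<close>)
qed

end

section \<open>Representation of instances\<close>

definition repr :: "instance_data \<Rightarrow> heap \<Rightarrow> nat list \<Rightarrow> nat list \<Rightarrow> bool" where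
  "repr s h gs ds \<longleftrightarrow> store h gs ds \<and> map (\<lambda>a. (h a 8, h a 9)) gs = entries s \<and>
     (\<lambda>a. h a 8) ` (set ds - set gs) = verts s \<and> (\<forall>a\<in>set ds - set gs. h a 9 = init s (h a 8))"

definition records :: "instance_data \<Rightarrow> nat" where
  "records s = len s + card (verts s)"

text \<open>Field 8 of record 0 holds the number of the first free record.\<close>

definition layout :: "instance_data \<Rightarrow> heap \<Rightarrow> nat list \<Rightarrow> nat list \<Rightarrow> bool" where
  "layout s h gs ds \<longleftrightarrow> repr s h gs ds \<and> set ds = {1..records s} \<and> h 0 8 = records s + 1 \<and>
     (\<forall>f\<in>{1, 2, 5, 6, 9}. h 0 f = 0)"

definition invar :: "instance_data \<Rightarrow> heap \<Rightarrow> bool" where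
  "invar s h \<longleftrightarrow> (\<exists>gs ds. layout s h gs ds)"

lemma reprD:
  assumes "repr s h gs ds"
  shows "store h gs ds" "entries s = map (\<lambda>a. (h a 8, h a 9)) gs"
    "verts s = (\<lambda>a. h a 8) ` (set ds - set gs)" "\<forall>a\<in>set ds - set gs. h a 9 = init s (h a 8)"
  using assms by (simp_all add: repr_def)

lemma length_log: "repr s h gs ds \<Longrightarrow> length gs = len s"
  by (simp add: len_def reprD(2))

lemma storeD:
  assumes "store h gs ds"
  shows "distinct gs" "distinct ds" "0 \<notin> set ds" "seq 0 h gs" "seq 4 h ds" "set gs \<subseteq> set ds" "sorted_wrt (klt h gs) ds"
  using assms by (auto simp: store_def seq_def)

text \<open>Two records of one vertex outside of the log both have rank 0, so neither could precede
  the other in \<open>ds\<close>.\<close>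

lemma headers_inj:
  assumes "store h gs ds"
  shows "inj_on (\<lambda>a. h a 8) (set ds - set gs)"
proof (rule inj_onI)
  fix x y assume xy: "x \<in> set ds - set gs" "y \<in> set ds - set gs" "h x 8 = h y 8"
  then have "rk gs x = 0" "rk gs y = 0" by (auto simp: rk_def)
  then have n: "\<not> klt h gs x y" "\<not> klt h gs y x" using xy by (auto simp: klt_def)
  obtain i j where ij: "i < length ds" "j < length ds" "x = ds ! i" "y = ds ! j"
    using xy by (metis DiffD1 in_set_conv_nth)
  then show "x = y" using n storeD(7)[OF assms] by (metis linorder_neqE_nat sorted_wrt_nth_less)
qed

lemma length_records:
  assumes "repr s h gs ds"
  shows "length ds = records s"
proof -
  have S: "store h gs ds" using assms by (simp add: repr_def)
  have "card (verts s) = card (set ds - set gs)"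
    unfolding reprD(3)[OF assms] by (rule card_image[OF headers_inj[OF S]])
  also have "\<dots> = length ds - length gs"
    using storeD[OF S] by (simp add: card_Diff_subset distinct_card)
  finally show ?thesis
    using length_log[OF assms] card_mono[of "set ds" "set gs"] storeD[OF S]
    by (simp add: records_def distinct_card)
qed

lemma log_vertex:
  assumes "repr s h gs ds" "valid s" "a \<in> set ds"
  shows "h a 8 \<in> verts s" "h a 9 \<in> spins s"
proof -
  have "h a 8 \<in> verts s \<and> h a 9 \<in> spins s"
  proof (cases "a \<in> set gs")
    case True
    then have "(h a 8, h a 9) \<in> set (entries s)" unfolding reprD(2)[OF assms(1)] by auto
    then show ?thesis using assms(2) by (auto simp: valid_def)
  next
    case False
    then have "h a 8 \<in> verts s" "h a 9 = init s (h a 8)" using assms by (auto simp: repr_def)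
    then show ?thesis using assms(2) by (auto simp: valid_def)
  qed
  then show "h a 8 \<in> verts s" "h a 9 \<in> spins s" by auto
qed

lemma log_nth:
  assumes "repr s h gs ds" "i \<in> {1..len s}"
  shows "gs ! (i - 1) \<in> set gs" "rk gs (gs ! (i - 1)) = i" "vtx s i = h (gs ! (i - 1)) 8" "spin s i = h (gs ! (i - 1)) 9"
proof -
  have l: "i - 1 < length gs" using assms length_log[OF assms(1)] by auto
  have "distinct gs" using assms(1) storeD by (auto simp: repr_def)
  then show "gs ! (i - 1) \<in> set gs" "rk gs (gs ! (i - 1)) = i" using l assms(2) by (auto simp: rk_nth)
  have "entries s ! (i - 1) = (h (gs ! (i - 1)) 8, h (gs ! (i - 1)) 9)"
    unfolding reprD(2)[OF assms(1)] using l by simp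
  then show "vtx s i = h (gs ! (i - 1)) 8" "spin s i = h (gs ! (i - 1)) 9" by (simp_all add: vtx_def spin_def)
qed

lemma log_rk:
  assumes "repr s h gs ds" "a \<in> set gs"
  shows "rk gs a \<in> {1..len s}" "vtx s (rk gs a) = h a 8" "spin s (rk gs a) = h a 9"
proof -
  show r: "rk gs a \<in> {1..len s}"
    using assms rk_pos[of a gs] rk_le[of gs a] length_log[OF assms(1)] by auto
  show "vtx s (rk gs a) = h a 8" "spin s (rk gs a) = h a 9"
    using log_nth(3,4)[OF assms(1) r] nth_rk[OF assms(2)] by simp_all
qed

lemma sorted_wrt_last:
  "sorted_wrt r xs \<Longrightarrow> x \<in> set xs \<Longrightarrow> x = last xs \<or> r x (last xs)"
  by (induction xs) auto

lemma sorted_wrt_hd: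
  "sorted_wrt r xs \<Longrightarrow> x \<in> set xs \<Longrightarrow> x = hd xs \<or> r (hd xs) x"
  by (cases xs) auto

text \<open>The record with the initial value of \<open>v\<close> always qualifies, having rank 0.
  So the last qualifying record cannot belong to a smaller vertex.\<close>

lemma search_last:
  assumes "repr s h gs ds" "v \<in> verts s" "b = last (0 # filter (kle h gs v t) ds)"
  shows "b \<in> set ds" "h b 8 = v" "rk gs b \<le> t" "\<forall>x\<in>set ds. h x 8 = v \<and> rk gs x \<le> t \<longrightarrow> rk gs x \<le> rk gs b"
proof -
  let ?xs = "filter (kle h gs v t) ds"
  have S: "sorted_wrt (klt h gs) ?xs"
    using assms(1) storeD(7) by (auto simp: repr_def sorted_wrt_filter)
  obtain a where a: "a \<in> set ds - set gs" "h a 8 = v"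
    using assms(2) unfolding reprD(3)[OF assms(1)] by blast
  then have ax: "a \<in> set ?xs" by (simp add: kle_def rk_def)
  then have ne: "?xs \<noteq> []" by (metis empty_iff list.set(1))
  then have b1: "b = last ?xs" using assms(3) by simp
  have "b \<in> set ?xs" unfolding b1 by (rule last_in_set[OF ne])
  note b = b1 this
  have m: "x = b \<or> klt h gs x b" if "x \<in> set ?xs" for x
    using sorted_wrt_last[OF S that] b(1) by simp
  show 1: "b \<in> set ds" "h b 8 = v" "rk gs b \<le> t"
    using b(2) m[OF ax] a(2) by (auto simp: kle_def klt_def)
  show "\<forall>x\<in>set ds. h x 8 = v \<and> rk gs x \<le> t \<longrightarrow> rk gs x \<le> rk gs b"
  proof (intro ballI impI)
    fix x assume "x \<in> set ds" "h x 8 = v \<and> rk gs x \<le> t"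
    then show "rk gs x \<le> rk gs b" using m[of x] 1 by (auto simp: kle_def klt_def)
  qed
qed

text \<open>The first record beyond \<open>(v, t)\<close> may belong to a larger vertex or be
  missing; if \<open>v\<close> has a later entry at all, it is the next one. Hence the test of its
  vertex in \<open>answer_successor\<close>.\<close>

lemma search_first:
  assumes "repr s h gs ds" "c = hd (filter (\<lambda>a. \<not> kle h gs v t a) ds @ [0])"
  shows "c = 0 \<or> c \<in> set ds \<and> (h c 8 = v \<longrightarrow> t < rk gs c)"
    "x \<in> set ds \<Longrightarrow> h x 8 = v \<Longrightarrow> t < rk gs x \<Longrightarrow> c \<in> set ds \<and> h c 8 = v \<and> rk gs c \<le> rk gs x"
proof -
  let ?xs = "filter (\<lambda>a. \<not> kle h gs v t a) ds"
  have S: "sorted_wrt (klt h gs) ?xs"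
    using assms(1) storeD(7) by (auto simp: repr_def sorted_wrt_filter)
  have c: "c = (if ?xs = [] then 0 else hd ?xs)" using assms(2) by (auto simp: hd_append)
  have i: "?xs \<noteq> [] \<Longrightarrow> c \<in> set ?xs" using hd_in_set[of ?xs] c by simp
  then show "c = 0 \<or> c \<in> set ds \<and> (h c 8 = v \<longrightarrow> t < rk gs c)"
    using c by (cases "?xs = []") (auto simp: kle_def)
  assume x: "x \<in> set ds" "h x 8 = v" "t < rk gs x"
  then have xx: "x \<in> set ?xs" by (auto simp: kle_def)
  then have ne: "?xs \<noteq> []" by (metis empty_iff list.set(1))
  have "x = c \<or> klt h gs c x" using sorted_wrt_hd[OF S xx] c ne by simp
  then show "c \<in> set ds \<and> h c 8 = v \<and> rk gs c \<le> rk gs x"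
    using i[OF ne] x by (auto simp: kle_def klt_def)
qed

lemma state_at_search:
  assumes "repr s h gs ds" "v \<in> verts s" "t \<le> len s" "b = last (0 # filter (kle h gs v t) ds)"
  shows "state_at s t v = h b 9"
proof -
  note b = search_last[OF assms(1,2,4)]
  have gd: "set gs \<subseteq> set ds" using assms(1) by (simp add: repr_def store_def)
  have up: "i \<le> rk gs b" if "i \<in> {1..t}" "vtx s i = v" for i
    using log_nth[OF assms(1), of i] that assms(3) b(4) gd by auto
  show ?thesis
  proof (cases "b \<in> set gs")
    case True
    note r = log_rk[OF assms(1) True]
    have "Max {i \<in> {1..t}. vtx s i = v} = rk gs b"
      using up r b(2,3) by (intro Max_eqI) auto
    moreover have "\<exists>i\<in>{1..t}. vtx s i = v" using r b(2,3) by auto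
    ultimately show ?thesis using r by (simp add: state_at_def)
  next
    case False
    then have "rk gs b = 0" by (simp add: rk_def)
    then have "\<not> (\<exists>i\<in>{1..t}. vtx s i = v)" using up by force
    moreover have "h b 9 = init s v" using assms(1) b(1,2) False by (auto simp: repr_def)
    ultimately show ?thesis unfolding state_at_def by simp
  qed
qed

lemma successor_search:
  assumes "repr s h gs ds" "c = hd (filter (\<lambda>a. \<not> kle h gs v t a) ds @ [0])"
  shows "(case successor s t v of None \<Rightarrow> 0 | Some i \<Rightarrow> i) = (if c \<noteq> 0 \<and> h c 8 = v then rk gs c else 0)"
proof -
  note c = search_first[OF assms]
  have "store h gs ds" using assms(1) by (simp add: repr_def)
  note gd = storeD(6,3)[OF this]
  show ?thesis
  proof (cases "c \<noteq> 0 \<and> h c 8 = v")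
    case True
    then have t: "t < rk gs c" using c(1) by auto
    then have "c \<in> set gs" by (auto simp: rk_pos)
    note r = log_rk[OF assms(1) this]
    have "Min {i \<in> {t<..len s}. vtx s i = v} = rk gs c"
    proof (intro Min_eqI)
      fix i assume "i \<in> {i \<in> {t<..len s}. vtx s i = v}"
      then show "rk gs c \<le> i" using log_nth[OF assms(1), of i] c(2)[of "gs ! (i - 1)"] gd by auto
    qed (use r t True in auto)
    moreover have "\<exists>i\<in>{t<..len s}. vtx s i = v" using r t True by auto
    ultimately show ?thesis using True by (simp add: successor_def)
  next
    case False
    have "\<not> (\<exists>i\<in>{t<..len s}. vtx s i = v)"
    proof
      assume "\<exists>i\<in>{t<..len s}. vtx s i = v"
      then obtain i where "i \<in> {t<..len s}" "vtx s i = v" by blast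
      then show False using log_nth[OF assms(1), of i] c(2)[of "gs ! (i - 1)"] gd False by auto
    qed
    then show ?thesis using False unfolding successor_def by auto
  qed
qed

section \<open>The effect of the operations on the representation\<close>

lemma partition_sorted:
  assumes "sorted_wrt r xs" "\<And>x y. r x y \<Longrightarrow> P y \<Longrightarrow> P x"
  shows "xs = filter P xs @ filter (\<lambda>x. \<not> P x) xs"
  using assms(1)
proof (induction xs)
  case (Cons a xs)
  show ?case
  proof (cases "P a")
    case False
    then have "\<forall>x\<in>set xs. \<not> P x" using Cons.prems assms(2) by auto
    then show ?thesis using False by simp
  qed (use Cons in simp)
qed simp

text \<open>Two relations are needed because an insertion into the log changes the ranks, and with
  them the order \<open>klt\<close>. The set \<open>P\<close> is a prefix of the list, so its
  cardinality, which the search delivers, is the right index.\<close>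

lemma sorted_wrt_insert_at:
  assumes "sorted_wrt r xs" "\<And>x y. r x y \<Longrightarrow> P y \<Longrightarrow> P x" "k = length (filter P xs)"
    and "\<And>x y. x \<in> set xs \<Longrightarrow> y \<in> set xs \<Longrightarrow> r x y \<Longrightarrow> r' x y"
    and "\<And>x. x \<in> set xs \<Longrightarrow> P x \<Longrightarrow> r' x e" "\<And>x. x \<in> set xs \<Longrightarrow> \<not> P x \<Longrightarrow> r' e x"
  shows "sorted_wrt r' (take k xs @ e # drop k xs)"
proof -
  have p: "xs = filter P xs @ filter (\<lambda>x. \<not> P x) xs" using partition_sorted[OF assms(1,2)] .
  have tk: "take k xs = filter P xs" "drop k xs = filter (\<lambda>x. \<not> P x) xs"
    using p assms(3) by (metis append_eq_conv_conj)+
  have "sorted_wrt r' xs" using assms(1,4) by (rule sorted_wrt_mono_rel[rotated]) auto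
  then have "sorted_wrt r' (take k xs @ drop k xs)" by simp
  then show ?thesis unfolding sorted_wrt_append using assms(5,6) tk by auto
qed

lemma set_insert_at: "set (take k xs @ e # drop k xs) = insert e (set xs)"
  by (metis append_take_drop_id list.simps(15) set_append Un_insert_right)

text \<open>Ranks from \<open>t\<close> on grow by one and smaller ones stay, which is strictly
  monotone. So the old records keep their relative order in \<open>ds\<close> without any change to
  what is stored about positions.\<close>

lemma repr_insert:
  assumes rep: "repr s h gs ds" and adm: "t \<in> {1..len s + 1}" "v \<in> verts s" and e: "e \<notin> set ds"
    and h': "\<And>y f. y \<in> set ds \<Longrightarrow> f \<in> {8, 9} \<Longrightarrow> h' y f = h y f" "h' e 8 = v" "h' e 9 = c"
      "\<And>y f. y \<in> set ds - set gs \<Longrightarrow> f < 4 \<Longrightarrow> h' y f = h y f"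
    and k: "k = length (filter (kle h gs v (t - 1)) ds)"
    and gs': "gs' = take (t - 1) gs @ e # drop (t - 1) gs" and ds': "ds' = take k ds @ e # drop k ds"
    and s': "seq 0 h' gs'" "seq 4 h' ds'"
  shows "repr (perform (Insert t v c) s) h' gs' ds'"
proof -
  have S: "store h gs ds" using rep by (simp add: repr_def)
  note sD = storeD[OF S]
  have set': "set gs' = insert e (set gs)" "set ds' = insert e (set ds)"
    unfolding gs' ds' by (rule set_insert_at)+
  have eg: "e \<notin> set gs" using e sD by auto
  have hdr: "set ds' - set gs' = set ds - set gs" using e unfolding set' by auto
  have len: "t - 1 \<le> length gs" using adm length_log[OF rep] by auto
  let ?A = "take (t - 1) gs" and ?B = "drop (t - 1) gs"
  have lA: "length ?A = t - 1" using len by simp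
  have g: "gs = ?A @ ?B" by simp
  have dAB: "set ?A \<inter> set ?B = {}" using sD(1) g by (metis distinct_append)
  have rke: "rk gs' e = t"
    using eg lA adm unfolding gs' by (auto simp: rk_append rk_Cons dest: in_set_takeD)
  have rk': "rk gs' x = (if rk gs x < t then rk gs x else rk gs x + 1)" if "x \<noteq> e" for x
  proof -
    have *: "rk gs x = (if x \<in> set ?A then rk ?A x else if x \<in> set ?B then t - 1 + rk ?B x else 0)"
      by (subst g, subst rk_append) (simp only: lA)
    have **: "rk gs' x = (if x \<in> set ?A then rk ?A x else if x \<in> set ?B then t - 1 + (rk ?B x + 1) else 0)"
      unfolding gs' using that len by (simp add: rk_append rk_Cons min_absorb2)
    have q: "rk ?A x < t" using rk_le[of ?A x] adm(1) unfolding lA by auto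
    have "1 \<le> t" "x \<in> set ?B \<Longrightarrow> 0 < rk ?B x" using adm(1) rk_pos by auto
    then show ?thesis
      unfolding * ** using q by (cases "x \<in> set ?A"; cases "x \<in> set ?B") simp_all
  qed
  have xe: "x \<noteq> e" if "x \<in> set ds" for x using that e by auto
  have "sorted_wrt (klt h' gs') ds'"
    unfolding ds'
  proof (rule sorted_wrt_insert_at[OF sD(7) _ k])
    show "klt h gs x y \<Longrightarrow> kle h gs v (t - 1) y \<Longrightarrow> kle h gs v (t - 1) x" for x y by (rule kle_mono)
    show "klt h' gs' x y" if "x \<in> set ds" "y \<in> set ds" "klt h gs x y" for x y
      using that(3) by (auto simp: klt_def h'(1) that(1,2) rk'[OF xe])
    show "klt h' gs' x e" if "x \<in> set ds" "kle h gs v (t - 1) x" for x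
      using that(2) adm(1) by (auto simp: klt_def kle_def h'(1,2) that(1) rk'[OF xe] rke)
    show "klt h' gs' e x" if "x \<in> set ds" "\<not> kle h gs v (t - 1) x" for x
      using that(2) adm(1) by (auto simp: klt_def kle_def h'(1,2) that(1) rk'[OF xe] rke)
  qed
  moreover have "\<forall>a\<in>set ds' - set gs'. \<forall>f<4. h' a f = 0"
    using S h'(4) unfolding hdr store_def by auto
  ultimately have "store h' gs' ds'"
    using s' sD(6) set' unfolding store_def by auto
  moreover have "map (\<lambda>a. (h' a 8, h' a 9)) gs' = entries (perform (Insert t v c) s)"
  proof -
    have "map (\<lambda>a. (h' a 8, h' a 9)) gs = entries s"
      unfolding reprD(2)[OF rep] using h'(1) sD(6) by (intro map_cong) auto
    then show ?thesis unfolding gs' using h'(2,3) by (auto simp flip: take_map drop_map)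
  qed
  moreover have "(\<lambda>a. h' a 8) ` (set ds' - set gs') = verts s" "\<forall>a\<in>set ds' - set gs'. h' a 9 = init s (h' a 8)"
    using rep h'(1) unfolding hdr repr_def by force+
  ultimately show ?thesis unfolding repr_def by simp
qed

lemma repr_add_vertex:
  assumes rep: "repr s h gs ds" and val: "valid s" and v: "v \<notin> verts s" and e: "e \<notin> set ds"
    and h': "\<And>y f. y \<in> set ds \<Longrightarrow> f \<in> {8, 9} \<Longrightarrow> h' y f = h y f" "h' e 8 = v" "h' e 9 = c"
      "\<And>y f. y \<in> set ds - set gs \<Longrightarrow> f < 4 \<Longrightarrow> h' y f = h y f" "\<And>f. f < 4 \<Longrightarrow> h' e f = 0"
    and k: "k = length (filter (kle h gs v 0) ds)" and ds': "ds' = take k ds @ e # drop k ds"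
    and s': "seq 0 h' gs" "seq 4 h' ds'"
  shows "repr (perform (AddVertex v c) s) h' gs ds'"
proof -
  have S: "store h gs ds" using rep by (simp add: repr_def)
  note sD = storeD[OF S]
  have set': "set ds' = insert e (set ds)" unfolding ds' by (rule set_insert_at)
  have eg: "e \<notin> set gs" using e sD by auto
  have hdr: "set ds' - set gs = insert e (set ds - set gs)" using eg unfolding set' by auto
  have nv: "h x 8 \<noteq> v" if "x \<in> set ds" for x using log_vertex[OF rep val that] v by auto
  have "sorted_wrt (klt h' gs) ds'"
    unfolding ds'
  proof (rule sorted_wrt_insert_at[OF sD(7) _ k])
    show "klt h gs x y \<Longrightarrow> kle h gs v 0 y \<Longrightarrow> kle h gs v 0 x" for x y by (rule kle_mono)
    show "klt h' gs x y" if "x \<in> set ds" "y \<in> set ds" "klt h gs x y" for x y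
      using that h'(1) by (auto simp: klt_def)
    show "klt h' gs x e" if "x \<in> set ds" "kle h gs v 0 x" for x
      using that h'(1,2) nv by (auto simp: klt_def kle_def)
    show "klt h' gs e x" if "x \<in> set ds" "\<not> kle h gs v 0 x" for x
      using that h'(1,2) nv by (auto simp: klt_def kle_def)
  qed
  moreover have "\<forall>a\<in>set ds' - set gs. \<forall>f<4. h' a f = 0"
    using S h'(4,5) unfolding hdr store_def by auto
  ultimately have "store h' gs ds'"
    using s' sD(6) set' unfolding store_def by auto
  moreover have "map (\<lambda>a. (h' a 8, h' a 9)) gs = entries s"
    unfolding reprD(2)[OF rep] using h'(1) sD(6) by (intro map_cong) auto
  moreover have "(\<lambda>a. h' a 8) ` (set ds' - set gs) = insert v (verts s)"
    using rep h'(1,2) unfolding hdr repr_def by force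
  moreover have "\<forall>a\<in>set ds' - set gs. h' a 9 = ((init s)(v := c)) (h' a 8)"
    using rep h'(1,2,3) nv unfolding hdr repr_def by auto
  ultimately show ?thesis unfolding repr_def by simp
qed

lemma repr_update:
  assumes rep: "repr s h gs ds" and t: "t \<in> {1..len s}"
  shows "repr (perform (Update t c) s) (setf h (gs ! (t - 1)) 9 c) gs ds"
proof -
  let ?a = "gs ! (t - 1)" and ?h = "setf h (gs ! (t - 1)) 9 c"
  have S: "store h gs ds" using rep by (simp add: repr_def)
  note sD = storeD[OF S]
  have ag: "?a \<in> set gs" using log_nth(1)[OF rep t] .
  have l: "t - 1 < length gs" using t length_log[OF rep] by auto
  have sq: "seq 0 ?h gs" "seq 4 ?h ds"
    using sD(4,5) by (auto intro!: seq_cong[of _ h] simp: same_def setf_apply)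
  have kl: "klt ?h gs = klt h gs" by (simp add: klt_def setf_apply fun_eq_iff)
  have "store ?h gs ds"
    using S sq ag unfolding store_def kl by (auto simp: setf_apply)
  moreover have "map (\<lambda>x. (?h x 8, ?h x 9)) gs = (entries s)[t - 1 := (vtx s t, c)]"
  proof (rule nth_equalityI)
    have e: "entries s = map (\<lambda>a. (h a 8, h a 9)) gs" using rep by (simp add: repr_def)
    show "length (map (\<lambda>x. (?h x 8, ?h x 9)) gs) = length ((entries s)[t - 1 := (vtx s t, c)])"
      by (simp add: e)
    fix i assume i: "i < length (map (\<lambda>x. (?h x 8, ?h x 9)) gs)"
    then have "gs ! i = ?a \<longleftrightarrow> i = t - 1" using sD(1) l by (simp add: nth_eq_iff_index_eq)
    then show "map (\<lambda>x. (?h x 8, ?h x 9)) gs ! i = (entries s)[t - 1 := (vtx s t, c)] ! i"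
      using i log_nth(3)[OF rep t] by (auto simp: e setf_apply nth_list_update)
  qed
  moreover have "(\<lambda>a. ?h a 8) ` (set ds - set gs) = verts s" "\<forall>a\<in>set ds - set gs. ?h a 9 = init s (?h a 8)"
    using rep ag by (auto simp: repr_def setf_apply)
  ultimately show ?thesis by (simp add: repr_def)
qed

lemma repr_remove:
  assumes rep: "repr s h gs ds" and t: "t \<in> {1..len s}" and a: "a = gs ! (t - 1)"
    and h': "\<And>y f. f \<in> {8, 9} \<Longrightarrow> h' y f = h y f"
      "\<And>y f. y \<in> set ds - set gs \<Longrightarrow> f < 4 \<Longrightarrow> h' y f = h y f"
    and s': "seq 0 h' (remove1 a gs)" "seq 4 h' (remove1 a ds)"
  shows "repr (perform (Remove t) s) h' (remove1 a gs) (remove1 a ds)"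
proof -
  have S: "store h gs ds" using rep by (simp add: repr_def)
  note sD = storeD[OF S]
  have ag: "a \<in> set gs" "rk gs a = t" using log_nth[OF rep t] a by auto
  have l: "t - 1 < length gs" using t length_log[OF rep] by auto
  let ?A = "take (t - 1) gs" and ?B = "drop t gs"
  have g: "gs = ?A @ a # ?B" using id_take_nth_drop[OF l] t a by simp
  have d: "distinct (?A @ a # ?B)" using sD(1) g by simp
  have r: "remove1 a gs = ?A @ ?B" using d by (subst g) (simp add: remove1_append)
  have rr: "remove1 a (?A @ a # ?B) = ?A @ ?B" using d by (simp add: remove1_append)
  have lA: "length ?A = t - 1" using l by simp
  have rk': "rk (remove1 a gs) x = (if rk gs x < t then rk gs x else rk gs x - 1)" if "x \<noteq> a" for x
  proof -
    have *: "rk gs x = (if x \<in> set ?A then rk ?A x else if x \<in> set ?B then t - 1 + (rk ?B x + 1) else 0)"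
      by (subst g, subst rk_append, subst rk_Cons) (use that lA in auto)
    have **: "rk (remove1 a gs) x = (if x \<in> set ?A then rk ?A x else if x \<in> set ?B then t - 1 + rk ?B x else 0)"
      unfolding r by (simp only: rk_append lA)
    have q: "rk ?A x < t" using rk_le[of ?A x] t unfolding lA by auto
    have "1 \<le> t" "x \<in> set ?B \<Longrightarrow> 0 < rk ?B x" using t rk_pos by auto
    then show ?thesis
      unfolding * ** using q by (cases "x \<in> set ?A"; cases "x \<in> set ?B") simp_all
  qed
  \<comment> \<open>The shift of the ranks would identify \<open>t - 1\<close> with
    \<open>t\<close>; it is strictly monotone on the remaining records because none of them has rank
    \<open>t\<close>.\<close>
  have ne: "rk gs x \<noteq> t" if "x \<noteq> a" "x \<in> set ds" for x
    using that ag nth_rk[of x gs] nth_rk[OF ag(1)] t by (cases "x \<in> set gs") (auto simp: rk_def)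
  have hdr: "set (remove1 a ds) - set (remove1 a gs) = set ds - set gs"
    using sD(1,2) ag by auto
  have "sorted_wrt (klt h gs) (remove1 a ds)"
    using sD(2,7) by (simp add: distinct_remove1_removeAll sorted_wrt_filter removeAll_filter_not_eq)
  then have "sorted_wrt (klt h' (remove1 a gs)) (remove1 a ds)"
  proof (rule sorted_wrt_mono_rel[rotated])
    fix x y assume "x \<in> set (remove1 a ds)" "y \<in> set (remove1 a ds)" "klt h gs x y"
    then show "klt h' (remove1 a gs) x y"
    proof -
      have xy: "x \<noteq> a" "y \<noteq> a" "x \<in> set ds" "y \<in> set ds"
        using \<open>x \<in> _\<close> \<open>y \<in> _\<close> sD(2) by auto
      have "rk gs x \<noteq> t" "rk gs y \<noteq> t" using ne xy by auto
      with \<open>klt h gs x y\<close> show ?thesis by (auto simp: klt_def h'(1) rk'[OF xy(1)] rk'[OF xy(2)])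
    qed
  qed
  moreover have "\<forall>x\<in>set (remove1 a ds) - set (remove1 a gs). \<forall>f<4. h' x f = 0"
    using S h'(2) unfolding hdr store_def by auto
  moreover have "set (remove1 a gs) \<subseteq> set (remove1 a ds)" using sD by auto
  ultimately have "store h' (remove1 a gs) (remove1 a ds)"
    using s' unfolding store_def by auto
  moreover have "map (\<lambda>a. (h' a 8, h' a 9)) (remove1 a gs) = take (t - 1) (entries s) @ drop t (entries s)"
    using rep h'(1) unfolding r repr_def by (auto simp flip: take_map drop_map)
  moreover have "(\<lambda>a. h' a 8) ` (set (remove1 a ds) - set (remove1 a gs)) = verts s"
    "\<forall>x\<in>set (remove1 a ds) - set (remove1 a gs). h' x 9 = init s (h' x 8)"
    using rep h'(1) unfolding hdr repr_def by force+
  ultimately show ?thesis unfolding repr_def by simp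
qed

lemma repr_remove_vertex:
  assumes rep: "repr s h gs ds" and a: "a \<in> set ds - set gs" "h a 8 = v"
    and h': "\<And>y f. f < 4 \<or> f \<in> {8, 9} \<Longrightarrow> h' y f = h y f"
    and s': "seq 0 h' gs" "seq 4 h' (remove1 a ds)"
  shows "repr (perform (RemoveVertex v) s) h' gs (remove1 a ds)"
proof -
  have S: "store h gs ds" using rep by (simp add: repr_def)
  note sD = storeD[OF S]
  have hdr: "set (remove1 a ds) - set gs = set ds - set gs - {a}" using sD(2) by auto
  have nv: "h x 8 \<noteq> v" if "x \<in> set ds - set gs - {a}" for x
    using headers_inj[OF S] that a unfolding inj_on_def by blast
  have "sorted_wrt (klt h gs) (remove1 a ds)"
    using sD(2,7) by (simp add: distinct_remove1_removeAll sorted_wrt_filter removeAll_filter_not_eq)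
  then have "sorted_wrt (klt h' gs) (remove1 a ds)"
    by (rule sorted_wrt_mono_rel[rotated]) (simp add: klt_def h')
  moreover have "\<forall>x\<in>set (remove1 a ds) - set gs. \<forall>f<4. h' x f = 0"
    using S h' unfolding hdr store_def by auto
  moreover have "set gs \<subseteq> set (remove1 a ds)" using sD a by auto
  ultimately have "store h' gs (remove1 a ds)"
    using s' unfolding store_def by auto
  moreover have "map (\<lambda>a. (h' a 8, h' a 9)) gs = entries s" using rep h' by (simp add: repr_def)
  moreover have "(\<lambda>a. h' a 8) ` (set (remove1 a ds) - set gs) = verts s - {v}"
    using rep h' a nv unfolding hdr repr_def by auto
  moreover have "\<forall>x\<in>set (remove1 a ds) - set gs. h' x 9 = ((init s)(v := undefined)) (h' x 8)"
    using rep h' nv unfolding hdr repr_def by auto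
  ultimately show ?thesis unfolding repr_def by simp
qed

text \<open>Record numbers are mere names: ranks and the order depend only on the two lists and on
  the stored vertices. This justifies the compaction after a deletion.\<close>

lemma repr_rename:
  assumes rep: "repr s h gs ds" and f: "inj_on f (set ds)"
    and h': "\<And>y i. y \<in> set ds \<Longrightarrow> i \<in> {8, 9} \<Longrightarrow> h' (f y) i = h y i"
      "\<And>y i. y \<in> set ds - set gs \<Longrightarrow> i < 4 \<Longrightarrow> h' (f y) i = 0"
    and s': "seq 0 h' (map f gs)" "seq 4 h' (map f ds)"
  shows "repr s h' (map f gs) (map f ds)"
proof -
  have S: "store h gs ds" using rep by (simp add: repr_def)
  note sD = storeD[OF S]
  have hdr: "set (map f ds) - set (map f gs) = f ` (set ds - set gs)"
    using inj_on_image_set_diff[OF f, of "set ds" "set gs"] sD(6) by auto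
  have rk': "rk (map f gs) (f x) = rk gs x" if "x \<in> set ds" for x
    using that sD(6) by (intro rk_map inj_on_subset[OF f]) auto
  have "sorted_wrt (\<lambda>x y. klt h' (map f gs) (f x) (f y)) ds"
    using sD(7) by (rule sorted_wrt_mono_rel[rotated]) (auto simp: klt_def h' rk')
  then have "sorted_wrt (klt h' (map f gs)) (map f ds)" by (simp add: sorted_wrt_map)
  then have "store h' (map f gs) (map f ds)"
    using s' sD(6) h'(2) unfolding store_def hdr by auto
  moreover have "map (\<lambda>a. (h' a 8, h' a 9)) (map f gs) = entries s"
    unfolding reprD(2)[OF rep] using h'(1) sD(6) by auto
  moreover have "(\<lambda>a. h' a 8) ` (set (map f ds) - set (map f gs)) = verts s"
    using rep h'(1) unfolding hdr repr_def image_image by force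
  moreover have "\<forall>a\<in>set (map f ds) - set (map f gs). h' a 9 = init s (h' a 8)"
    using rep h'(1) unfolding hdr repr_def by auto
  ultimately show ?thesis unfolding repr_def by simp
qed

section \<open>The operations\<close>

lemma frame_field: "frame_of k A h h' \<Longrightarrow> f < k \<or> k + 4 \<le> f \<Longrightarrow> h' y f = h y f"
  unfolding frame_of_def by (elim allE[of _ y] allE[of _ f]) auto

lemma frame_node: "frame_of k A h h' \<Longrightarrow> y \<notin> A \<Longrightarrow> y \<noteq> 0 \<Longrightarrow> h' y f = h y f"
  unfolding frame_of_def by blast

lemma frame_zero: "frame_of k A h h' \<Longrightarrow> 0 \<notin> A \<Longrightarrow> f \<noteq> k \<Longrightarrow> f \<noteq> k + 2 \<Longrightarrow> h' 0 f = h 0 f"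
  unfolding frame_of_def by blast

lemma seq_frame:
  assumes "seq j h xs" "frame_of k A h h'" "j + 4 \<le> k \<or> k + 4 \<le> j"
  shows "seq j h' xs"
  by (rule seq_cong[OF assms(1)]) (use assms(3) in \<open>auto simp: same_def frame_field[OF assms(2)]\<close>)

lemma seq_setf:
  assumes "seq k h xs" "f < k \<or> k + 4 \<le> f \<or> a \<notin> set xs \<and> (a \<noteq> 0 \<or> f = k + 1 \<or> f = k + 2)"
  shows "seq k (setf h a f x) xs"
proof -
  have "0 \<notin> set xs" using assms(1) by (simp add: seq_def)
  then show ?thesis
    using assms(2) by (intro seq_cong[OF assms(1)]) (auto simp: same_def setf_apply)
qed

lemma repr_cong:
  assumes rep: "repr s h gs ds" and h': "\<And>a f. a \<in> set ds \<Longrightarrow> f < 10 \<Longrightarrow> h' a f = h a f"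
    "\<And>f. f \<in> {0, 3, 4, 7} \<Longrightarrow> h' 0 f = h 0 f"
  shows "repr s h' gs ds"
proof -
  note sD = storeD[OF reprD(1)[OF rep]]
  have g: "a \<in> set gs \<Longrightarrow> f < 10 \<Longrightarrow> h' a f = h a f" for a f using h'(1) sD(6) by auto
  have "seq 0 h' gs" by (rule seq_cong[OF sD(4)]) (simp_all add: same_def g h'(2))
  moreover have "seq 4 h' ds" by (rule seq_cong[OF sD(5)]) (simp_all add: same_def h')
  moreover have "sorted_wrt (klt h' gs) ds"
    using sD(7) by (rule sorted_wrt_mono_rel[rotated]) (simp add: klt_def h'(1))
  ultimately have "store h' gs ds"
    using reprD(1)[OF rep] h'(1) unfolding store_def by auto
  moreover have "map (\<lambda>a. (h' a 8, h' a 9)) gs = entries s"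
    unfolding reprD(2)[OF rep] using g by (intro map_cong) auto
  moreover have "(\<lambda>a. h' a 8) ` (set ds - set gs) = verts s"
    unfolding reprD(3)[OF rep] using h'(1) by (intro image_cong) auto
  moreover have "\<forall>a\<in>set ds - set gs. h' a 9 = init s (h' a 8)" using reprD(4)[OF rep] h'(1) by auto
  ultimately show ?thesis by (simp add: repr_def)
qed

lemma invI:
  assumes "repr s h gs ds" "set ds = {1..records s}" "h' 0 8 = records s + 1" "\<forall>f\<in>{1, 2, 5, 6, 9}. h' 0 f = 0"
    "\<And>a f. a \<in> set ds \<Longrightarrow> h' a f = h a f" "\<And>f. f \<in> {0, 3, 4, 7} \<Longrightarrow> h' 0 f = h 0 f"
  shows "invar s h'"
  unfolding invar_def layout_def using repr_cong[OF assms(1,5,6)] assms(2-4) by blast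

text \<open>Resets the scratch parent fields of record 0 as \<open>layout\<close> demands, so that
  every stored word is again bounded in terms of the current instance.\<close>

definition clean :: cmd where
  "clean = Put (Num 0) 2 (Num 0) ;; Put (Num 0) 6 (Num 0)"

definition allocate :: "nat \<Rightarrow> nat \<Rightarrow> cmd" where
  "allocate v c =
     Assign 10 (Fld (Num 0) 8) ;; Put (Num 0) 8 (Plus (Reg 10) (Num 1)) ;;
     Put (Reg 10) 8 (Reg v) ;; Put (Reg 10) 9 (Reg c)"

abbreviation move_record :: cmd where
  "move_record \<equiv>
     Put (Reg 40) 8 (Fld (Reg 41) 8) ;; Put (Reg 40) 9 (Fld (Reg 41) 9) ;;
     Assign 15 (Reg 41) ;; Assign 16 (Reg 40)"

abbreviation relocate :: cmd where
  "relocate \<equiv>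
     Cond (Equal (Fld (Reg 41) 3) (Num 0))
       (Put (Reg 40) 0 (Num 0) ;; Put (Reg 40) 1 (Num 0) ;; Put (Reg 40) 2 (Num 0) ;; Put (Reg 40) 3 (Num 0))
       (replace 0)"

text \<open>The last record moves into the place of the record in register 15, which is in no tree.\<close>

definition free_record :: cmd where
  "free_record =
     (Assign 40 (Reg 15) ;; Assign 41 (Minus (Fld (Num 0) 8) (Num 1))) ;;
     Cond (Equal (Reg 40) (Reg 41)) Skip
       (move_record ;; replace 4 ;; relocate) ;;
     Put (Num 0) 8 (Reg 41) ;; clean"

abbreviation answer_successor :: cmd where
  "answer_successor \<equiv>
     Cond (Equal (Reg 37) (Num 0)) (Assign 0 (Num 0))
       (Cond (Equal (Fld (Reg 37) 8) (Reg 33))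
          (Assign 30 (Reg 37) ;; rank 0 ;; Assign 0 (Reg 31))
          (Assign 0 (Num 0)))"

fun program :: "opkind \<Rightarrow> cmd" where
  "program INSERT =
     (Assign 34 (Minus (Reg 0) (Num 1)) ;; Assign 33 (Reg 1)) ;; search ;;
     (allocate 1 2 ;; Assign 11 (Minus (Reg 0) (Num 1))) ;; insert_at 0 ;;
     Assign 11 (Reg 38) ;; insert_at 4 ;; clean"
| "program REMOVE =
     Assign 11 (Minus (Reg 0) (Num 1)) ;; node_at 0 ;; delete 0 ;; delete 4 ;; free_record"
| "program UPDATE =
     Assign 11 (Minus (Reg 0) (Num 1)) ;; node_at 0 ;; Put (Reg 15) 9 (Reg 1)"
| "program EVAL =
     (Assign 34 (Reg 0) ;; Assign 33 (Reg 1)) ;; search ;; Assign 0 (Fld (Reg 36) 9)"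
| "program SUCCESSOR =
     (Assign 34 (Reg 0) ;; Assign 33 (Reg 1)) ;; search ;;
     answer_successor"
| "program ADD_VERTEX =
     (Assign 34 (Num 0) ;; Assign 33 (Reg 0)) ;; search ;;
     (allocate 0 1 ;; Put (Reg 10) 0 (Num 0) ;; Put (Reg 10) 1 (Num 0) ;; Put (Reg 10) 2 (Num 0) ;;
      Put (Reg 10) 3 (Num 0) ;; Assign 11 (Reg 38)) ;;
     insert_at 4 ;; clean"
| "program REMOVE_VERTEX =
     (Assign 34 (Num 0) ;; Assign 33 (Reg 0)) ;; search ;; Assign 15 (Reg 36) ;; delete 4 ;; free_record"

definition op_cost :: "nat \<Rightarrow> nat \<Rightarrow> nat" where
  "op_cost T n = search_cost T n + hbound n * 2000 + 2000"

context ram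
begin

lemma layoutD:
  assumes "layout s h gs ds" "records s + 2 \<le> N"
  shows "repr s h gs ds" "store h gs ds" "set ds = {1..records s}" "set ds \<subseteq> {..<N}" "set gs \<subseteq> {..<N}"
    "length ds = records s" "length gs = len s" "h 0 8 = records s + 1" "\<forall>f\<in>{1, 2, 5, 6, 9}. h 0 f = 0"
    "hbound (length gs) \<le> hbound (records s)" "set gs \<subseteq> set ds" "0 \<notin> set ds" "seq 0 h gs" "seq 4 h ds"
    "distinct ds"
proof -
  show r: "repr s h gs ds" and d: "set ds = {1..records s}"
    and "h 0 8 = records s + 1" "\<forall>f\<in>{1, 2, 5, 6, 9}. h 0 f = 0"
    using assms(1) by (simp_all add: layout_def)
  show S: "store h gs ds" using r by (rule reprD)
  show N: "set ds \<subseteq> {..<N}" using d assms(2) by auto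
  show "length ds = records s" using r by (rule length_records)
  show l: "length gs = len s" using r by (rule length_log)
  show "hbound (length gs) \<le> hbound (records s)" unfolding l by (simp add: hbound_mono records_def)
  show "set gs \<subseteq> set ds" "0 \<notin> set ds" "seq 0 h gs" "seq 4 h ds" "distinct ds" using S by (rule storeD)+
  then show "set gs \<subseteq> {..<N}" using N by blast
qed

lemma wp_eval:
  assumes I: "invar s h" and N: "records s + 2 \<le> N" and R: "R 0 = t" "R 1 = v"
    and adm: "t \<le> len s" "v \<in> verts s"
  shows "wp (program EVAL) (op_cost (len s) (records s)) (\<lambda>R' h'. h' = h \<and> R' 0 = state_at s t v) R h"
proof -
  obtain gs ds where L: "layout s h gs ds" using I by (auto simp: invar_def)
  note G = layoutD[OF L N]
  have W: "wp search (search_cost (length gs) (length ds))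
      (\<lambda>R h'. wp (Assign 0 (Fld (Reg 36) 9)) 20 (\<lambda>R' h'. h' = h \<and> R' 0 = state_at s t v) R h')
      (R(34 := t, 33 := v)) h"
  proof (rule wp_search[OF G(2,4)])
    fix R' :: "nat \<Rightarrow> nat" assume b: "R' 36 = last (0 # filter (kle h gs v t) ds)"
    have "R' 36 \<in> set ds" using search_last(1)[OF G(1) adm(2) b] .
    then have "R' 36 < N" using G(4) by auto
    then show "wp (Assign 0 (Fld (Reg 36) 9)) 20 (\<lambda>R' h'. h' = h \<and> R' 0 = state_at s t v) R' h"
      using state_at_search[OF G(1) adm(2,1) b] by (intro vc_wp') simp_all
  qed simp_all
  have "wp (program EVAL) (20 + (search_cost (length gs) (length ds) + 20))
      (\<lambda>R' h'. h' = h \<and> R' 0 = state_at s t v) R h"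
    unfolding program.simps
    by (rule wp_vc_Then[OF _ wp_Then[OF W order_refl]]) (use R in simp_all)
  then show ?thesis by (rule wp_mono) (simp_all add: op_cost_def G)
qed

lemma wp_successor:
  assumes I: "invar s h" and N: "records s + 2 \<le> N" and R: "R 0 = t" "R 1 = v"
  shows "wp (program SUCCESSOR) (op_cost (len s) (records s))
    (\<lambda>R' h'. h' = h \<and> R' 0 = (case successor s t v of None \<Rightarrow> 0 | Some i \<Rightarrow> i)) R h"
    (is "wp _ _ ?Q R h")
proof -
  obtain gs ds where L: "layout s h gs ds" using I by (auto simp: invar_def)
  note G = layoutD[OF L N]
  note sD = storeD[OF G(2)]
  
  have W: "wp search (search_cost (length gs) (length ds)) (\<lambda>R h'. wp answer_successor (hbound (length gs) * 70 + 100) ?Q R h')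
      (R(34 := t, 33 := v)) h"
  proof (rule wp_search[OF G(2,4)])
    fix R' assume K: "keeps {30, 31, 32, 35, 36, 37, 38, 39} (R(34 := t, 33 := v)) R'"
      and c: "R' 37 = hd (filter (\<lambda>a. \<not> kle h gs v t a) ds @ [0])"
    let ?c = "R' 37"
    have r33: "R' 33 = v" using K by (simp add: keeps_def)
    have A: "(case successor s t v of None \<Rightarrow> 0 | Some i \<Rightarrow> i) = (if ?c \<noteq> 0 \<and> h ?c 8 = v then rk gs ?c else 0)"
      by (rule successor_search[OF G(1) c])
    note f = search_first(1)[OF G(1) c]
    have lt: "?c < N" using f G(4) N_gt_1 by auto
    show "wp answer_successor (hbound (length gs) * 70 + 100) ?Q R' h"
    proof (rule wp_Cond[where k = "hbound (length gs) * 70 + 90"])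
      assume "evb (Equal (Reg 37) (Num 0)) R' h"
      then show "wp (Assign 0 (Num 0)) (hbound (length gs) * 70 + 90) ?Q R' h"
        using A by (intro vc_wp') simp_all
    next
      assume "\<not> evb (Equal (Reg 37) (Num 0)) R' h"
      then have nz: "?c \<noteq> 0" by simp
      show "wp (Cond (Equal (Fld (Reg 37) 8) (Reg 33))
          (Assign 30 (Reg 37) ;; rank 0 ;; Assign 0 (Reg 31)) (Assign 0 (Num 0)))
          (hbound (length gs) * 70 + 90) ?Q R' h"
      proof (rule wp_Cond[where k = "hbound (length gs) * 70 + 80"])
        assume "\<not> evb (Equal (Fld (Reg 37) 8) (Reg 33)) R' h"
        then show "wp (Assign 0 (Num 0)) (hbound (length gs) * 70 + 80) ?Q R' h"
          using A r33 by (intro vc_wp') simp_all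
      next
        assume "evb (Equal (Fld (Reg 37) 8) (Reg 33)) R' h"
        then have e: "h ?c 8 = v" using r33 by simp
        then have cg: "?c \<in> set gs" using f nz rk_pos[of ?c gs] by auto
        have W: "wp (rank 0) (hbound (length gs) * 70 + 60) (\<lambda>R h. wp (Assign 0 (Reg 31)) 5 ?Q R h) (R'(30 := ?c)) h"
        proof (rule wp_rank[OF _ sD(4) G(5) _ cg])
          fix R'' :: "nat \<Rightarrow> nat" assume "R'' 31 = length (takeWhile (\<lambda>x. x \<noteq> ?c) gs) + 1"
          then have "R'' 31 = rk gs ?c" using cg by (simp add: rk_def)
          then show "wp (Assign 0 (Reg 31)) 5 ?Q R'' h" using A nz e by (intro vc_wp') simp_all
        qed simp_all
        show "wp (Assign 30 (Reg 37) ;; rank 0 ;; Assign 0 (Reg 31)) (hbound (length gs) * 70 + 80) ?Q R' h"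
          by (rule wp_vc_Then[OF _ wp_Then[OF W order_refl]]) simp_all
      qed (use lt in simp_all)
    qed simp_all
  qed simp_all
  have "wp (program SUCCESSOR) (20 + (search_cost (length gs) (length ds) + (hbound (length gs) * 70 + 100))) ?Q R h"
    unfolding program.simps
    by (rule wp_vc_Then[OF _ wp_Then[OF W order_refl]]) (use R in simp_all)
  then show ?thesis by (rule wp_mono) (use G(10) in \<open>simp_all add: op_cost_def G(6,7)\<close>)
qed

lemma wp_update:
  assumes I: "invar s h" and N: "records s + 2 \<le> N" and R: "R 0 = t" "R 1 = c"
    and t: "t \<in> {1..len s}"
  shows "wp (program UPDATE) (op_cost (len s) (records s)) (\<lambda>R' h'. invar (perform (Update t c) s) h') R h"
    (is "wp _ _ ?Q R h")
proof -
  obtain gs ds where L: "layout s h gs ds" using I by (auto simp: invar_def)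
  note G = layoutD[OF L N]
  let ?a = "gs ! (t - 1)"
  have a: "?a \<in> set gs" using log_nth(1)[OF G(1) t] .
  then have "?a \<in> set ds" "?a < N" using G(5,11) by auto
  then have a0: "?a \<noteq> 0" "?a < N" using G(12) by metis+
  have l: "t - 1 < length gs" using t G(7) by auto
  have W: "wp (node_at 0) (hbound (length gs) * 60 + 60) (\<lambda>R h. wp (Put (Reg 15) 9 (Reg 1)) 10 ?Q R h) (R(11 := t - 1)) h"
  proof (rule wp_node_at[OF _ G(13,5) _ l])
    fix R' assume "keeps {11, 14, 15} (R(11 := t - 1)) R'" and r: "R' 15 = ?a"
    then have "R' 1 = c" using R by (simp add: keeps_def)
    have "records (perform (Update t c) s) = records s" by (simp add: records_def len_def)
    then have "invar (perform (Update t c) s) (setf h ?a 9 c)"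
      using G a0 by (intro invI[OF repr_update[OF G(1) t]]) (auto simp: setf_apply)
    then show "wp (Put (Reg 15) 9 (Reg 1)) 10 ?Q R' h"
      using r a0 \<open>R' 1 = c\<close> by (intro vc_wp') simp_all
  qed simp_all
  have tN: "t < 16 * N" using t N by (simp add: records_def)
  have "wp (program UPDATE) (20 + (hbound (length gs) * 60 + 60 + 10)) ?Q R h"
    unfolding program.simps
    by (rule wp_vc_Then[OF _ wp_Then[OF W order_refl]]) (use R t tN in simp_all)
  then show ?thesis by (rule wp_mono) (use G(10) in \<open>simp_all add: op_cost_def\<close>)
qed

lemma wp_insert:
  assumes I: "invar s h" and N: "records s + 2 \<le> N" and R: "R 0 = t" "R 1 = v" "R 2 = c"
    and adm: "t \<in> {1..len s + 1}" "v \<in> verts s"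
  shows "wp (program INSERT) (op_cost (len s) (records s)) (\<lambda>R' h'. invar (perform (Insert t v c) s) h') R h"
    (is "wp _ _ ?Q R h")
proof -
  obtain gs ds where L: "layout s h gs ds" using I by (auto simp: invar_def)
  note G = layoutD[OF L N]
  let ?n = "records s" and ?s = "perform (Insert t v c) s"
  let ?e = "?n + 1"
  \<comment> \<open>The new entry has to follow all records of \<open>v\<close> with positions below
    \<open>t\<close>, hence \<open>t - 1\<close>. The count is taken before either tree changes and
    is the index of the new record in \<open>ds\<close>.\<close>
  let ?k = "length (filter (kle h gs v (t - 1)) ds)"
  let ?gs = "take (t - 1) gs @ ?e # drop (t - 1) gs" and ?ds = "take ?k ds @ ?e # drop ?k ds"
  have e: "?e \<notin> set ds" "?e \<notin> set gs" "?e < N" "?e \<noteq> 0" using G(3,11) N by auto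
  have tN: "t < 16 * N" "1 \<le> t" using adm N by (simp_all add: records_def)
  let ?h1 = "setf (setf (setf h 0 8 (?n + 2)) ?e 8 v) ?e 9 c"
  have q1: "seq 0 ?h1 gs" "seq 4 ?h1 ds" using G(13,14) by (auto intro!: seq_setf)
  have rs: "records ?s = ?n + 1" using adm by (auto simp: records_def len_def)
  have sg: "set ?gs = insert ?e (set gs)" "set ?ds = insert ?e (set ds)" by (rule set_insert_at)+
  let ?C1 = "hbound ?n * 560 + 100" and ?C0 = "hbound (length gs) * 560 + 100"
  have fin: "wp clean 20 ?Q R3 h3"
    if 2: "seq 0 h2 ?gs" "frame_of 0 (insert ?e (set gs)) ?h1 h2" and 3: "seq 4 h3 ?ds"
      "frame_of 4 (insert ?e (set ds)) h2 h3" for h2 h3 R3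
  proof -
    have q: "seq 0 h3 ?gs" using seq_frame[OF 2(1) 3(2)] by simp
    have same: "h3 y f = ?h1 y f" if "f \<in> {8, 9}" for y f
      using that frame_field[OF 3(2), of f y] frame_field[OF 2(2), of f y] by auto
    have same0: "h3 y f = ?h1 y f" if "y \<in> set ds - set gs" "f < 4" for y f
      using that frame_field[OF 3(2), of f y] frame_node[OF 2(2), of y f] G(12) e by auto
    have rep: "repr ?s h3 ?gs ?ds"
    proof (rule repr_insert[OF G(1) adm e(1) _ _ _ _ refl refl refl q 3(1)])
      show "h3 y f = h y f" if "y \<in> set ds" "f \<in> {8, 9}" for y f
        using same[OF that(2)] that e G(12) by (auto simp: setf_apply)
      show "h3 y f = h y f" if "y \<in> set ds - set gs" "f < 4" for y f
        using same0[OF that] that e G(12) by (auto simp: setf_apply)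
    qed (simp_all add: same setf_apply)
    have z: "h3 0 f = ?h1 0 f" if "f \<notin> {0, 2, 4, 6}" for f
      using that frame_zero[OF 3(2), of f] frame_zero[OF 2(2), of f] G(11,12) by auto
    have "invar ?s (setf (setf h3 0 2 0) 0 6 0)"
    proof (rule invI[OF rep])
      show "set ?ds = {1..records ?s}" unfolding sg rs G(3) by auto
      show "setf (setf h3 0 2 0) 0 6 0 0 8 = records ?s + 1" unfolding rs using z[of 8] by (simp add: setf_apply)
      show "\<forall>f\<in>{1, 2, 5, 6, 9}. setf (setf h3 0 2 0) 0 6 0 0 f = 0"
        using z[of 1] z[of 5] z[of 9] G(9) by (simp add: setf_apply)
    qed (use G(12) in \<open>auto simp: setf_apply dest: in_set_takeD in_set_dropD\<close>)
    then show ?thesis using N_gt_1 by (intro vc_wp') (simp_all add: clean_def)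
  qed
  have W4: "wp (insert_at 4 ;; clean) (?C1 + 20) ?Q R2 h2"
    if r: "R2 10 = ?e" "R2 11 = ?k" and 2: "seq 0 h2 ?gs" "frame_of 0 (insert ?e (set gs)) ?h1 h2" for R2 h2
  proof -
    have q: "seq 4 h2 ds" using seq_frame[OF q1(2) 2(2)] by simp
    have "wp (insert_at 4) (hbound (length ds) * 560 + 100) (\<lambda>R h. wp clean 20 ?Q R h) R2 h2"
      by (rule wp_insert_at[where R = R2, OF _ q G(4) r _ e(1) _ e(3)]) (use fin[OF 2] in simp_all)
    then show ?thesis unfolding G(6) by (rule wp_Then) simp
  qed
  let ?R0 = "R(34 := t - 1, 33 := v)"
  have W1: "wp search (search_cost (length gs) (length ds))
      (\<lambda>R h. wp ((allocate 1 2 ;; Assign 11 (Minus (Reg 0) (Num 1))) ;; insert_at 0 ;;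
        Assign 11 (Reg 38) ;; insert_at 4 ;; clean) (60 + (?C0 + (10 + (?C1 + 20)))) ?Q R h) ?R0 h"
  proof (rule wp_search[OF G(2,4)])
    fix R1 assume K: "keeps {30, 31, 32, 35, 36, 37, 38, 39} ?R0 R1" and k: "R1 38 = ?k"
    have r: "R1 0 = t" "R1 1 = v" "R1 2 = c" using K R by (simp_all add: keeps_def)
    let ?R1 = "R1(10 := ?e, 11 := t - 1)"
    have W: "wp (insert_at 0) ?C0 (\<lambda>R h. wp (Assign 11 (Reg 38) ;; insert_at 4 ;; clean) (10 + (?C1 + 20)) ?Q R h) ?R1 ?h1"
    proof (rule wp_insert_at[where R = ?R1 and n = ?e and p = "t - 1", OF _ q1(1) G(5)])
      fix R2 h2 assume 2: "keeps {11..29} ?R1 R2" "seq 0 h2 ?gs" "frame_of 0 (insert ?e (set gs)) ?h1 h2"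
      have r2: "R2 10 = ?e" "R2 38 = ?k"
        using k 2(1) by (simp_all add: keeps_def)
      have W: "wp (insert_at 4 ;; clean) (?C1 + 20) ?Q (R2(11 := ?k)) h2"
        by (rule W4[OF _ _ 2(2,3)]) (simp_all add: r2)
      show "wp (Assign 11 (Reg 38) ;; insert_at 4 ;; clean) (10 + (?C1 + 20)) ?Q R2 h2"
        by (rule wp_vc_Then[OF _ W]) (simp_all add: r2)
    qed (use G(7) adm e in auto)
    show "wp ((allocate 1 2 ;; Assign 11 (Minus (Reg 0) (Num 1))) ;; insert_at 0 ;;
        Assign 11 (Reg 38) ;; insert_at 4 ;; clean) (60 + (?C0 + (10 + (?C1 + 20)))) ?Q R1 h"
      by (rule wp_vc_Then[OF _ wp_Then[OF W order_refl]])
        (use r tN e G(8) N_gt_1 in \<open>simp_all add: allocate_def\<close>)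
  qed simp_all
  have "wp (program INSERT) (20 + (search_cost (length gs) (length ds) + (60 + (?C0 + (10 + (?C1 + 20)))))) ?Q R h"
    unfolding program.simps
    by (rule wp_vc_Then[OF _ wp_Then[OF W1 order_refl]]) (use R tN in simp_all)
  then show ?thesis by (rule wp_mono) (use G(10) in \<open>simp_all add: op_cost_def G(6,7)\<close>)
qed

lemma wp_add_vertex:
  assumes I: "invar s h" and N: "records s + 2 \<le> N" and R: "R 0 = v" "R 1 = c"
    and val: "valid s" and v: "v \<notin> verts s"
  shows "wp (program ADD_VERTEX) (op_cost (len s) (records s)) (\<lambda>R' h'. invar (perform (AddVertex v c) s) h') R h"
    (is "wp _ _ ?Q R h")
proof -
  obtain gs ds where L: "layout s h gs ds" using I by (auto simp: invar_def)
  note G = layoutD[OF L N]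
  let ?n = "records s" and ?s = "perform (AddVertex v c) s"
  let ?e = "?n + 1"
  let ?k = "length (filter (kle h gs v 0) ds)"
  let ?ds = "take ?k ds @ ?e # drop ?k ds"
  have e: "?e \<notin> set ds" "?e \<notin> set gs" "?e < N" "?e \<noteq> 0" using G(3,11) N by auto
  let ?h0 = "setf (setf (setf h 0 8 (?n + 2)) ?e 8 v) ?e 9 c"
  let ?h1 = "setf (setf (setf (setf ?h0 ?e 0 0) ?e 1 0) ?e 2 0) ?e 3 0"
  have q1: "seq 0 ?h1 gs" "seq 4 ?h1 ds" using G(13,14) e by (auto intro!: seq_setf)
  have "finite (verts s)" using val by (simp add: valid_def)
  then have rs: "records ?s = ?n + 1" using v by (simp add: records_def len_def)
  have sg: "set ?ds = insert ?e (set ds)" by (rule set_insert_at)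
  let ?C1 = "hbound (length ds) * 560 + 100"
  have fin: "wp clean 20 ?Q R3 h3"
    if 3: "seq 4 h3 ?ds" "frame_of 4 (insert ?e (set ds)) ?h1 h3" for h3 R3
  proof -
    have q: "seq 0 h3 gs" using seq_frame[OF q1(1) 3(2)] by simp
    have same: "h3 y f = ?h1 y f" if "f < 4 \<or> f \<in> {8, 9}" for y f
      using that frame_field[OF 3(2), of f y] by auto
    have rep: "repr ?s h3 gs ?ds"
    proof (rule repr_add_vertex[OF G(1) val v e(1) _ _ _ _ _ refl refl q 3(1)])
      show "h3 y f = h y f" if "y \<in> set ds" "f \<in> {8, 9}" for y f
        using same[of f y] that e G(12) by (auto simp: setf_apply)
      show "h3 y f = h y f" if "y \<in> set ds - set gs" "f < 4" for y f
        using same[of f y] that e G(12) by (auto simp: setf_apply)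
      show "h3 ?e f = 0" if "f < 4" for f
        using same[of f ?e] that by (auto simp: setf_apply less_Suc_eq numeral_eq_Suc)
    qed (simp_all add: same setf_apply)
    have z: "h3 0 f = ?h1 0 f" if "f \<notin> {4, 6}" for f
      using that frame_zero[OF 3(2), of f] G(12) by auto
    have "invar ?s (setf (setf h3 0 2 0) 0 6 0)"
    proof (rule invI[OF rep])
      show "set ?ds = {1..records ?s}" unfolding sg rs G(3) by auto
      show "setf (setf h3 0 2 0) 0 6 0 0 8 = records ?s + 1" unfolding rs using z[of 8] by (simp add: setf_apply)
      show "\<forall>f\<in>{1, 2, 5, 6, 9}. setf (setf h3 0 2 0) 0 6 0 0 f = 0"
        using z[of 1] z[of 5] z[of 9] G(9) by (simp add: setf_apply)
    qed (use G(12) in \<open>auto simp: setf_apply dest: in_set_takeD in_set_dropD\<close>)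
    then show ?thesis using N_gt_1 by (intro vc_wp') (simp_all add: clean_def)
  qed
  let ?R0 = "R(34 := 0, 33 := v)"
  let ?A = "allocate 0 1 ;; Put (Reg 10) 0 (Num 0) ;; Put (Reg 10) 1 (Num 0) ;; Put (Reg 10) 2 (Num 0) ;;
      Put (Reg 10) 3 (Num 0) ;; Assign 11 (Reg 38)"
  have W1: "wp search (search_cost (length gs) (length ds))
      (\<lambda>R h. wp (?A ;; insert_at 4 ;; clean) (100 + (?C1 + 20)) ?Q R h) ?R0 h"
  proof (rule wp_search[OF G(2,4)])
    fix R1 assume K: "keeps {30, 31, 32, 35, 36, 37, 38, 39} ?R0 R1" and k: "R1 38 = ?k"
    have r: "R1 0 = v" "R1 1 = c" using K R by (simp_all add: keeps_def)
    let ?R1 = "R1(10 := ?e, 11 := ?k)"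
    have W: "wp (insert_at 4) ?C1 (\<lambda>R h. wp clean 20 ?Q R h) ?R1 ?h1"
      by (rule wp_insert_at[where R = ?R1 and n = ?e and p = ?k, OF _ q1(2) G(4) _ _ _ e(1) _ e(3)])
        (use fin in simp_all)
    show "wp (?A ;; insert_at 4 ;; clean) (100 + (?C1 + 20)) ?Q R1 h"
      by (rule wp_vc_Then[OF _ wp_Then[OF W order_refl]])
        (use r e G(8) N_gt_1 k in \<open>simp_all add: allocate_def setf_apply\<close>)
  qed simp_all
  have "wp (program ADD_VERTEX) (20 + (search_cost (length gs) (length ds) + (100 + (?C1 + 20)))) ?Q R h"
    unfolding program.simps
    by (rule wp_vc_Then[OF _ wp_Then[OF W1 order_refl]]) (use R in simp_all)
  then show ?thesis by (rule wp_mono) (simp_all add: op_cost_def G(6,7))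
qed

text \<open>The instance is already represented; only the numbering has a gap at \<open>a\<close>.
  The last record is always in the tree of all records, but in the log tree only if it is a log
  entry. Otherwise zeros must be written to fields 0 to 3 of \<open>a\<close>, which may still hold
  links of a deleted log entry.\<close>

lemma vc_free_record:
  assumes rep: "repr s h gs ds" and ds: "set ds = {1..records s + 1} - {a}" and a: "a \<in> {1..records s + 1}"
    and N: "records s + 3 \<le> N" and R: "R 15 = a" and h: "h 0 8 = records s + 2" "\<forall>f\<in>{1, 5, 9}. h 0 f = 0"
  shows "vc free_record (\<lambda>R' h'. invar s h') R h"
proof -
  let ?n = "records s" and ?b = "records s + 1" and ?R = "R(40 := a, 41 := records s + 1)"
  have an: "a < N" "a \<noteq> 0" "?b < N" using a N by auto
  note S = reprD(1)[OF rep]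
  note sD = storeD[OF S]
  have dN: "set ds \<subseteq> {..<N}" unfolding ds using N by auto
  have fin: "vc (Put (Num 0) 8 (Reg 41) ;; clean) (\<lambda>R' h'. invar s h') R3 h3"
    if 3: "repr s h3 gs' ds'" "set ds' = {1..?n}" "\<forall>f\<in>{1, 5, 9}. h3 0 f = 0" "R3 41 = ?b" for R3 h3 gs' ds'
  proof -
    have "invar s (setf (setf (setf h3 0 8 ?b) 0 2 0) 0 6 0)"
    proof (rule invI[OF 3(1,2)])
      show "\<forall>f\<in>{1, 2, 5, 6, 9}. setf (setf (setf h3 0 8 ?b) 0 2 0) 0 6 0 0 f = 0"
        using 3(3) by (simp add: setf_apply)
      show "setf (setf (setf h3 0 8 ?b) 0 2 0) 0 6 0 a f = h3 a f" if "a \<in> set ds'" for a f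
        using that unfolding 3(2) by (simp add: setf_apply)
    qed (auto simp: setf_apply)
    then show ?thesis using 3(4) N by (simp add: clean_def)
  qed
  have main: "vc (Cond (Equal (Reg 40) (Reg 41)) Skip
       (move_record ;; replace 4 ;; relocate))
     (\<lambda>R h. vc (Put (Num 0) 8 (Reg 41) ;; clean) (\<lambda>R' h'. invar s h') R h) ?R h"
  proof (rule vc_CondI)
    assume "evb (Equal (Reg 40) (Reg 41)) ?R h"
    then have "a = ?b" by simp
    then have "set ds = {1..?n}" unfolding ds by auto
    then show "vc Skip (\<lambda>R h. vc (Put (Num 0) 8 (Reg 41) ;; clean) (\<lambda>R' h'. invar s h') R h) ?R h"
      using fin[OF rep _ h(2), of ?R] by simp
  next
    assume "\<not> evb (Equal (Reg 40) (Reg 41)) ?R h"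
    then have ne: "a \<noteq> ?b" by simp
    then have bd: "?b \<in> set ds" unfolding ds by simp
    have ad: "a \<notin> set ds" unfolding ds by simp
    with sD(6) have "a \<notin> set gs" by blast
    note ad = ad this
    let ?f = "\<lambda>x. if x = ?b then a else x"
    have inj: "inj_on ?f (set ds)" using ad by (auto simp: inj_on_def)
    have sd': "set (map ?f ds) = {1..?n}"
    proof -
      have "set (map ?f ds) = insert a (set ds - {?b})" using bd by auto
      also have "\<dots> = {1..?n}" unfolding ds using a ne by auto
      finally show ?thesis .
    qed
    let ?h1 = "setf (setf h a 8 (h ?b 8)) a 9 (h ?b 9)"
    let ?R1 = "?R(15 := ?b, 16 := a)"
    have q1: "seq 0 ?h1 gs" "seq 4 ?h1 ds" using sD(4,5) by (auto intro!: seq_setf)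
    have n8: "?h1 (?f y) i = h y i" if "y \<in> set ds" "i \<in> {8, 9}" for y i
      using that ad by (auto simp: setf_apply)
    
    let ?P = "\<lambda>R h. vc (Put (Num 0) 8 (Reg 41) ;; clean) (\<lambda>R' h'. invar s h') R h"
    have V: "vc (replace 4) (\<lambda>R h. vc relocate ?P R h) ?R1 ?h1"
    proof (rule vc_replace[where R = ?R1 and a = ?b and b = a, OF _ q1(2) dN _ _ bd ad(1)])
      fix R2 h2 assume 2: "keeps {17} ?R1 R2" "seq 4 h2 (map ?f ds)" "frame_of 4 (insert a (set ds)) ?h1 h2"
      have r2: "R2 40 = a" "R2 41 = ?b" "R2 15 = ?b" "R2 16 = a" using 2(1) by (simp_all add: keeps_def)
      have f2: "h2 y f = ?h1 y f" if "f < 4 \<or> f \<in> {8, 9}" for y f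
        using that frame_field[OF 2(3), of f y] by auto
      have z2: "h2 0 f = h 0 f" if "f \<in> {1, 5, 9}" for f
        using that frame_zero[OF 2(3), of f] an sD(3) by (auto simp: setf_apply)
      have q2: "seq 0 h2 gs" using seq_frame[OF q1(1) 2(3)] by simp
      have h0: "h y i = 0" if "y \<in> set ds - set gs" "i < 4" for y i using S that by (auto simp: store_def)
      show "vc relocate ?P R2 h2"
      proof (rule vc_CondI)
        assume "evb (Equal (Fld (Reg 41) 3) (Num 0)) R2 h2"
        then have "h ?b 3 = 0" using r2 f2[of 3 ?b] ne by (simp add: setf_apply)
        then have bg: "?b \<notin> set gs" using size_pos[OF sD(4), of ?b] by auto
        then have mg: "map ?f gs = gs" by (intro map_idI) auto
        let ?h3 = "setf (setf (setf (setf h2 a 0 0) a 1 0) a 2 0) a 3 0"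
        have "repr s ?h3 (map ?f gs) (map ?f ds)"
        proof (rule repr_rename[OF rep inj])
          show "?h3 (?f y) i = h y i" if "y \<in> set ds" "i \<in> {8, 9}" for y i
            using n8[OF that] f2[of i "?f y"] that(2) by (auto simp: setf_apply)
          show "?h3 (?f y) i = 0" if y: "y \<in> set ds - set gs" "i < 4" for y i
          proof (cases "y = ?b")
            case True
            then show ?thesis using y(2) by (auto simp: setf_apply less_Suc_eq numeral_eq_Suc)
          next
            case False
            moreover have "y \<noteq> a" using y(1) ad by auto
            ultimately show ?thesis using f2[of i y] h0[OF y] y(2) by (simp add: setf_apply)
          qed
          show "seq 0 ?h3 (map ?f gs)" unfolding mg using q2 ad an by (intro seq_setf) auto
          show "seq 4 ?h3 (map ?f ds)" using 2(2) by (intro seq_setf) auto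
        qed
        then have "?P R2 ?h3"
          by (rule fin[OF _ sd']) (use z2 h(2) an r2 in \<open>auto simp: setf_apply\<close>)
        then show "vc (Put (Reg 40) 0 (Num 0) ;; Put (Reg 40) 1 (Num 0) ;; Put (Reg 40) 2 (Num 0) ;;
            Put (Reg 40) 3 (Num 0)) ?P R2 h2"
          using r2 an by simp
      next
        assume "\<not> evb (Equal (Fld (Reg 41) 3) (Num 0)) R2 h2"
        then have "h ?b 3 \<noteq> 0" using r2 f2[of 3 ?b] ne by (simp add: setf_apply)
        then have bg: "?b \<in> set gs" using h0[of ?b 3] bd by auto
        show "vc (replace 0) ?P R2 h2"
        proof (rule vc_replace[where R = R2 and a = ?b and b = a, OF _ q2 _ _ _ bg ad(2)])
          fix R3 h3 assume 3: "keeps {17} R2 R3" "seq 0 h3 (map ?f gs)" "frame_of 0 (insert a (set gs)) h2 h3"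
          have f3: "h3 y f = h2 y f" if "4 \<le> f" for y f
            using that frame_field[OF 3(3), of f y] by auto
          have "repr s h3 (map ?f gs) (map ?f ds)"
          proof (rule repr_rename[OF rep inj])
            show "h3 (?f y) i = h y i" if "y \<in> set ds" "i \<in> {8, 9}" for y i
              using n8[OF that] f2[of i "?f y"] f3[of i "?f y"] that(2) by auto
            show "h3 (?f y) i = 0" if y: "y \<in> set ds - set gs" "i < 4" for y i
            proof -
              have "y \<noteq> ?b" "y \<noteq> a" "y \<noteq> 0" using y(1) bg ad(1) sD(3) by (metis DiffD1 DiffD2)+
              then show ?thesis
                using frame_node[OF 3(3), of y i] f2[of i y] h0[OF y] y by (simp add: setf_apply)
            qed
            show "seq 4 h3 (map ?f ds)" using seq_frame[OF 2(2) 3(3)] by simp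
          qed (rule 3(2))
          then show "?P R3 h3"
          proof (rule fin[OF _ sd'])
            have "0 \<notin> insert a (set gs)" using an(2) sD(3,6) by (metis insertE subsetD)
            then show "\<forall>f\<in>{1, 5, 9}. h3 0 f = 0"
              using z2 h(2) frame_zero[OF 3(3)] by simp
            show "R3 41 = ?b" using 3(1) r2 by (simp add: keeps_def)
          qed
        qed (use r2 dN sD(6) an in auto)
      qed (use r2 an in simp_all)
    qed (use an in simp_all)
    show "vc (move_record ;; replace 4 ;; relocate) ?P ?R h"
      by (rule vc_Then[where R' = ?R1 and h' = ?h1, OF _ vc.simps(4)[THEN iffD2, OF V]])
        (use an ne in \<open>simp add: setf_apply\<close>)
  qed simp
  show ?thesis
    unfolding free_record_def
    by (rule vc_Then[where R' = ?R and h' = h, OF _ vc.simps(4)[THEN iffD2, OF main]]) (use R h N in simp_all)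
qed

lemma cost_free_record: "cost free_record \<le> 300"
  by (simp add: free_record_def replace_def set_child_def clean_def)

lemma wp_remove:
  assumes I: "invar s h" and N: "records s + 2 \<le> N" and R: "R 0 = t" and t: "t \<in> {1..len s}"
  shows "wp (program REMOVE) (op_cost (len s) (records s)) (\<lambda>R' h'. invar (perform (Remove t) s) h') R h"
    (is "wp _ _ ?Q R h")
proof -
  obtain gs ds where L: "layout s h gs ds" using I by (auto simp: invar_def)
  note G = layoutD[OF L N]
  let ?n = "records s" and ?s = "perform (Remove t) s" and ?a = "gs ! (t - 1)"
  have rs: "records ?s + 1 = ?n" using t by (auto simp: records_def len_def)
  have a: "?a \<in> set gs" "?a \<in> set ds" using log_nth(1)[OF G(1) t] G(11) by auto
  have l: "t - 1 < length gs" using t G(7) by auto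
  let ?C0 = "hbound (length gs) * 530 + 300" and ?C4 = "hbound (length ds) * 530 + 300"
  have W1: "wp (node_at 0) (hbound (length gs) * 60 + 60)
      (\<lambda>R h. wp (delete 0 ;; delete 4 ;; free_record) (?C0 + (?C4 + 300)) ?Q R h) (R(11 := t - 1)) h"
  proof (rule wp_node_at[OF _ G(13,5) _ l])
    fix R1 :: "nat \<Rightarrow> nat" assume r1: "R1 15 = ?a"
    have "wp (delete 0) ?C0 (\<lambda>R h. wp (delete 4 ;; free_record) (?C4 + 300) ?Q R h) R1 h"
    proof (rule wp_delete[where R = R1, OF _ G(13,5) r1 a(1)])
      fix R2 h2 assume 2: "keeps {16..29} R1 R2" "seq 0 h2 (remove1 ?a gs)" "frame_of 0 (set gs) h h2"
      have r2: "R2 15 = ?a" using 2(1) r1 by (simp add: keeps_def)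
      have q2: "seq 4 h2 ds" using seq_frame[OF G(14) 2(3)] by simp
      have "wp (delete 4) ?C4 (\<lambda>R h. wp free_record 300 ?Q R h) R2 h2"
      proof (rule wp_delete[where R = R2, OF _ q2 G(4) r2 a(2)])
        fix R3 h3 assume 3: "keeps {16..29} R2 R3" "seq 4 h3 (remove1 ?a ds)" "frame_of 4 (set ds) h2 h3"
        have r3: "R3 15 = ?a" using 3(1) r2 by (simp add: keeps_def)
        have q3: "seq 0 h3 (remove1 ?a gs)" using seq_frame[OF 2(2) 3(3)] by simp
        have z: "h3 0 f = h 0 f" if "f \<notin> {0, 2, 4, 6}" for f
          using that frame_zero[OF 3(3), of f] frame_zero[OF 2(3), of f] G(11,12) by auto
        have "vc free_record ?Q R3 h3"
        proof (rule vc_free_record[where a = ?a])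
          show "repr ?s h3 (remove1 ?a gs) (remove1 ?a ds)"
          proof (rule repr_remove[OF G(1) t refl _ _ q3 3(2)])
            show "h3 y f = h y f" if "f \<in> {8, 9}" for y f
              using that frame_field[OF 3(3), of f y] frame_field[OF 2(3), of f y] by auto
            show "h3 y f = h y f" if "y \<in> set ds - set gs" "f < 4" for y f
              using that frame_field[OF 3(3), of f y] frame_node[OF 2(3), of y f] G(12) by auto
          qed
          show "set (remove1 ?a ds) = {1..records ?s + 1} - {?a}" unfolding rs using G(3,15) by simp
          show "?a \<in> {1..records ?s + 1}" unfolding rs using a G(3) by simp
          show "records ?s + 3 \<le> N" using rs N by linarith
          have "h3 0 8 = ?n + 1" using z[of 8] G(8) by simp
          then show "h3 0 8 = records ?s + 2" using rs by linarith
          show "\<forall>f\<in>{1, 5, 9}. h3 0 f = 0" using z G(9) by simp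
        qed (rule r3)
        then show "wp free_record 300 ?Q R3 h3" by (rule vc_wp') (rule cost_free_record)
      qed simp
      then show "wp (delete 4 ;; free_record) (?C4 + 300) ?Q R2 h2" by (rule wp_Then) simp
    qed simp
    then show "wp (delete 0 ;; delete 4 ;; free_record) (?C0 + (?C4 + 300)) ?Q R1 h" by (rule wp_Then) simp
  qed simp_all
  have tN: "t < 16 * N" using t N by (simp add: records_def)
  have "wp (program REMOVE) (20 + (hbound (length gs) * 60 + 60 + (?C0 + (?C4 + 300)))) ?Q R h"
    unfolding program.simps
    by (rule wp_vc_Then[OF _ wp_Then[OF W1 order_refl]]) (use R t tN in simp_all)
  then show ?thesis by (rule wp_mono) (use G(10) in \<open>simp_all add: op_cost_def G(6,7)\<close>)
qed

lemma wp_remove_vertex: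
  assumes I: "invar s h" and N: "records s + 2 \<le> N" and R: "R 0 = v"
    and val: "valid s" and v: "v \<in> verts s" "v \<notin> fst ` set (entries s)"
  shows "wp (program REMOVE_VERTEX) (op_cost (len s) (records s)) (\<lambda>R' h'. invar (perform (RemoveVertex v) s) h') R h"
    (is "wp _ _ ?Q R h")
proof -
  obtain gs ds where L: "layout s h gs ds" using I by (auto simp: invar_def)
  note G = layoutD[OF L N]
  let ?n = "records s" and ?s = "perform (RemoveVertex v) s"
  have "finite (verts s)" using val by (simp add: valid_def)
  then have rs: "records ?s + 1 = ?n" using v(1) card_Suc_Diff1[of "verts s" v] by (simp add: records_def len_def)
  let ?C4 = "hbound (length ds) * 530 + 300"
  let ?R0 = "R(34 := 0, 33 := v)"
  have W1: "wp search (search_cost (length gs) (length ds))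
      (\<lambda>R h. wp (Assign 15 (Reg 36) ;; delete 4 ;; free_record) (10 + (?C4 + 300)) ?Q R h) ?R0 h"
  proof (rule wp_search[OF G(2,4)])
    fix R1 :: "nat \<Rightarrow> nat" assume b: "R1 36 = last (0 # filter (kle h gs v 0) ds)"
    let ?a = "R1 36"
    note sl = search_last(1-3)[OF G(1) v(1) b]
    \<comment> \<open>A record of \<open>v\<close> with rank at most 0 is not in the log, so the
      search for \<open>(v, 0)\<close> finds the record with the initial value.\<close>
    have a: "?a \<in> set ds - set gs" "h ?a 8 = v" using sl rk_pos[of ?a gs] by auto
    let ?R1 = "R1(15 := ?a)"
    have W: "wp (delete 4) ?C4 (\<lambda>R h. wp free_record 300 ?Q R h) ?R1 h"
    proof (rule wp_delete[where R = ?R1 and a = ?a, OF _ G(14,4)])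
      fix R3 h3 assume 3: "keeps {16..29} ?R1 R3" "seq 4 h3 (remove1 ?a ds)" "frame_of 4 (set ds) h h3"
      have r3: "R3 15 = ?a" using 3(1) by (simp add: keeps_def)
      have q3: "seq 0 h3 gs" using seq_frame[OF G(13) 3(3)] by simp
      have z: "h3 0 f = h 0 f" if "f \<notin> {4, 6}" for f
        using that frame_zero[OF 3(3), of f] G(12) by auto
      have "vc free_record ?Q R3 h3"
      proof (rule vc_free_record[where a = ?a])
        show "repr ?s h3 gs (remove1 ?a ds)"
        proof (rule repr_remove_vertex[OF G(1) a _ q3 3(2)])
          show "h3 y f = h y f" if "f < 4 \<or> f \<in> {8, 9}" for y f
            using that frame_field[OF 3(3), of f y] by auto
        qed
        show "set (remove1 ?a ds) = {1..records ?s + 1} - {?a}" unfolding rs using G(3,15) by simp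
        show "?a \<in> {1..records ?s + 1}" unfolding rs using a G(3) by simp
        show "records ?s + 3 \<le> N" using rs N by linarith
        have "h3 0 8 = ?n + 1" using z[of 8] G(8) by simp
        then show "h3 0 8 = records ?s + 2" using rs by linarith
        show "\<forall>f\<in>{1, 5, 9}. h3 0 f = 0" using z G(9) by simp
      qed (rule r3)
      then show "wp free_record 300 ?Q R3 h3" by (rule vc_wp') (rule cost_free_record)
    qed (use a in simp_all)
    show "wp (Assign 15 (Reg 36) ;; delete 4 ;; free_record) (10 + (?C4 + 300)) ?Q R1 h"
      by (rule wp_vc_Then[OF _ wp_Then[OF W order_refl]]) simp_all
  qed simp_all
  have "wp (program REMOVE_VERTEX) (20 + (search_cost (length gs) (length ds) + (10 + (?C4 + 300)))) ?Q R h"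
    unfolding program.simps
    by (rule wp_vc_Then[OF _ wp_Then[OF W1 order_refl]]) (use R in simp_all)
  then show ?thesis by (rule wp_mono) (simp_all add: op_cost_def G(6,7))
qed

lemma wp_program:
  assumes "invar s h" "records s + 2 \<le> N" "valid s" "admissible s p"
  shows "wp (program (kind p)) (op_cost (len s) (records s))
    (\<lambda>R' h'. invar (perform p s) h' \<and> (\<forall>y. answer p s = Some y \<longrightarrow> R' 0 = y)) (input_regs p) h"
proof (cases p)
  case (Insert t v c)
  show ?thesis
    unfolding Insert kind.simps by (rule wp_mono[OF wp_insert[OF assms(1,2)] order_refl])
      (use assms(4) in \<open>simp_all add: Insert input_regs_def\<close>)
next
  case (Remove t)
  show ?thesis
    unfolding Remove kind.simps by (rule wp_mono[OF wp_remove[OF assms(1,2)] order_refl])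
      (use assms(4) in \<open>simp_all add: Remove input_regs_def\<close>)
next
  case (Update t c)
  show ?thesis
    unfolding Update kind.simps by (rule wp_mono[OF wp_update[OF assms(1,2)] order_refl])
      (use assms(4) in \<open>simp_all add: Update input_regs_def\<close>)
next
  case (Eval t v)
  show ?thesis
    unfolding Eval kind.simps by (rule wp_mono[OF wp_eval[OF assms(1,2)] order_refl])
      (use assms(1,4) in \<open>simp_all add: Eval input_regs_def\<close>)
next
  case (Successor t v)
  show ?thesis
    unfolding Successor kind.simps by (rule wp_mono[OF wp_successor[OF assms(1,2)] order_refl])
      (use assms(1,4) in \<open>simp_all add: Successor input_regs_def\<close>)
next
  case (AddVertex v c)
  show ?thesis
    unfolding AddVertex kind.simps by (rule wp_mono[OF wp_add_vertex[OF assms(1,2) _ _ assms(3)] order_refl])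
      (use assms(4) in \<open>simp_all add: AddVertex input_regs_def\<close>)
next
  case (RemoveVertex v)
  show ?thesis
    unfolding RemoveVertex kind.simps by (rule wp_mono[OF wp_remove_vertex[OF assms(1,2) _ assms(3)] order_refl])
      (use assms(4) in \<open>simp_all add: RemoveVertex input_regs_def\<close>)
qed

end

section \<open>The stored words and their size\<close>

definition represents :: "instance_data \<Rightarrow> nat list \<Rightarrow> bool" where
  "represents s ws \<longleftrightarrow> (\<exists>h. invar s h \<and> ws = map (flat h) [0..<10 * (records s + 1)])"

text \<open>Needed because the memory outside of the stored words is arbitrary: the heap met by an
  operation agrees with the representing one only on the records in use.\<close>

lemma invar_cong:
  assumes "invar s h" "\<And>a f. a \<le> records s \<Longrightarrow> f < 10 \<Longrightarrow> h' a f = h a f"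
  shows "invar s h'"
proof -
  from assms(1) obtain gs ds where r: "repr s h gs ds" and d: "set ds = {1..records s}"
    and z: "h 0 8 = records s + 1" "\<forall>f\<in>{1, 2, 5, 6, 9}. h 0 f = 0"
    unfolding invar_def layout_def by blast
  show ?thesis
  proof (rule invI[OF repr_cong[OF r] d])
    show "h' a f = h a f" if "a \<in> set ds" "f < 10" for a f
      using that assms(2) unfolding d by simp
    show "h' 0 f = h 0 f" if "f \<in> {0, 3, 4, 7}" for f using that assms(2) by auto
    show "h' 0 8 = records s + 1" "\<forall>f\<in>{1, 2, 5, 6, 9}. h' 0 f = 0" using z assms(2) by auto
  qed simp_all
qed

lemma seq_field_bounds:
  assumes "seq k h xs" "set xs \<subseteq> {1..n}" "f \<in> {k, k + 1, k + 2, k + 3}"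
  shows "a \<in> set xs \<Longrightarrow> h a f \<le> n" "h 0 k \<le> n"
proof -
  obtain t where t: "h 0 k = rt t" "inorder t = xs" using assms(1) by (auto simp: seq_def)
  have b: "rt u \<le> n" if "set_tree u \<subseteq> {1..n}" for u using rt_cases[of u] that by auto
  show "h 0 k \<le> n" unfolding t(1) using b[of t] assms(2) t(2) set_inorder[of t] by simp
  assume "a \<in> set xs"
  then obtain l r c where z: "xs = before c @ inorder l @ a # inorder r @ after c" "tr k h (Node l a r) (parent c)"
    using seq_zipper[OF assms(1)] by metis
  have "set_tree l \<subseteq> {1..n}" "set_tree r \<subseteq> {1..n}" "nodes c \<subseteq> {1..n}"
    using assms(2) by (auto simp: z(1) nodes_eq)
  then have "rt l \<le> n" "rt r \<le> n" "parent c \<le> n" using b parent_cases[of c] by auto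
  moreover have "length xs \<le> n"
    using assms(1,2) card_mono[of "{1..n}" "set xs"] by (simp add: seq_def distinct_card)
  then have "size l + size r + 1 \<le> n" unfolding z(1) by simp
  ultimately show "h a f \<le> n" using z(2) assms(3) by auto
qed

text \<open>The bound must refer to the current instance, since a word length sufficient for it may
  be too small for an earlier one. This is why \<open>layout\<close> also prescribes the idle fields
  of record 0. The extra 1 is the number of the first free record.\<close>

lemma invar_word_bound:
  assumes I: "invar s h" and val: "valid s" and a: "a \<le> records s" and f: "f < 10"
  shows "h a f \<le> records s + 1 \<or> h a f \<in> verts s \<union> spins s"
proof -
  from I obtain gs ds where r: "repr s h gs ds" and d: "set ds = {1..records s}"
    and z: "h 0 8 = records s + 1" "\<forall>f\<in>{1, 2, 5, 6, 9}. h 0 f = 0"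
    unfolding invar_def layout_def by blast
  note S = reprD(1)[OF r]
  note sD = storeD[OF S]
  have gs: "set gs \<subseteq> {1..records s}" and ds: "set ds \<subseteq> {1..records s}" using sD(6) d by simp_all
  have s0: "h 0 3 = 0" "h 0 7 = 0" using sD(4,5) by (auto simp: seq_def)
  have fs: "f \<in> {0, 1, 2, 3} \<or> f \<in> {4, 5, 6, 7} \<or> f = 8 \<or> f = 9" using f by auto
  show ?thesis
  proof (cases "a = 0")
    case True
    have "h 0 0 \<le> records s" "h 0 4 \<le> records s"
      using seq_field_bounds(2)[OF sD(4) gs, of 0] seq_field_bounds(2)[OF sD(5) ds, of 4] by auto
    then show ?thesis using z s0 fs True by auto
  next
    case False
    then have ad: "a \<in> set ds" unfolding d using a by simp
    note lv = log_vertex[OF r val ad]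
    consider "f < 4" "a \<in> set gs" | "f < 4" "a \<notin> set gs" | "f \<in> {4, 5, 6, 7}" | "f = 8 \<or> f = 9" using fs by fastforce
    then show ?thesis
    proof cases
      case 1
      then have "h a f \<le> records s"
        by (intro seq_field_bounds(1)[OF sD(4) gs]) auto
      then show ?thesis by simp
    next
      case 2
      then have "h a f = 0" using S ad by (auto simp: store_def)
      then show ?thesis by simp
    next
      case 3
      then have "h a f \<le> records s"
        by (intro seq_field_bounds(1)[OF sD(5) ds _ ad]) auto
      then show ?thesis by simp
    qed (use lv in auto)
  qed
qed

section \<open>Word length and running time\<close>

lemma lg_ge_1: "1 \<le> lg n"
  unfolding lg_def by (subst le_log_iff) auto

lemma log_records: "log 2 (real (records s + 4)) \<le> lg (len s) + lg (card (verts s))"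
proof -
  let ?T = "real (len s)" and ?V = "real (card (verts s))"
  have "real (records s + 4) \<le> (?T + 2) * (?V + 2)"
    by (simp add: records_def algebra_simps)
  moreover have "0 < (?T + 2) * (?V + 2)" by (intro mult_pos_pos) simp_all
  ultimately have "log 2 (real (records s + 4)) \<le> log 2 ((?T + 2) * (?V + 2))"
    by (subst log_le_cancel_iff) simp_all
  also have "\<dots> = lg (len s) + lg (card (verts s))" unfolding lg_def by (subst log_mult) auto
  finally show ?thesis .
qed

text \<open>\<open>log 2 (records s + 4)\<close> is at most the sum of the logarithms for the log
  and the vertices. The summand for the spin values is at least 1, so its multiple by
  \<open>K\<close> pays for the four bits of the factor 16.\<close>

lemma word_length_large:
  assumes "word_length_ok K s w" "8 \<le> K"
  shows "16 * (records s + 4) \<le> 2 ^ w"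
proof -
  let ?T = "len s" and ?V = "card (verts s)"
  let ?x = "real (records s + 4)"
  have x: "log 2 ?x \<le> lg ?T + lg ?V" by (rule log_records)
  have "0 \<le> lg ?T" "0 \<le> lg ?V" "1 \<le> lg (card (spins s))"
    using lg_ge_1[of ?T] lg_ge_1[of ?V] lg_ge_1[of "card (spins s)"] by linarith+
  then have "8 * (lg ?T + lg ?V + lg (card (spins s))) \<le> real K * (lg ?T + lg ?V + lg (card (spins s)))"
    using assms(2) by (intro mult_right_mono) auto
  also have "\<dots> \<le> real w" using assms(1) by (simp add: word_length_ok_def)
  finally have "log 2 ?x + 4 \<le> real w"
    using x \<open>0 \<le> lg ?T\<close> \<open>0 \<le> lg ?V\<close> \<open>1 \<le> lg (card (spins s))\<close> by argo
  then have "2 powr (log 2 ?x + 4) \<le> 2 powr real w" by (intro powr_mono) auto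
  then have "16 * ?x \<le> 2 ^ w" by (simp add: powr_add powr_realpow)
  then have "real (16 * (records s + 4)) \<le> real (2 ^ w)" by simp
  then show ?thesis by (simp only: of_nat_le_iff)
qed

lemma hbound_le: "real (hbound n) \<le> 3 * log 2 (real n + 1)"
  unfolding hbound_def by (rule of_nat_floor) simp

text \<open>The number of expensive comparisons and the cost of a rank are both linear in
  \<open>lg (len s)\<close>, which gives the square. The height of the tree of all records adds only
  \<open>lg (len s) + lg (card (verts s))\<close>, and since \<open>lg\<close> is at least 1, lower
  order terms are absorbed.\<close>

lemma op_cost_le: "real (op_cost (len s) (records s)) \<le> time_budget 20000 s"
proof -
  let ?T = "len s" and ?V = "card (verts s)" and ?n = "records s"
  let ?L = "lg ?T" and ?W = "lg ?V"
  have L: "1 \<le> ?L" "1 \<le> ?W" by (rule lg_ge_1)+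
  have T: "real (hbound ?T) \<le> 3 * ?L"
  proof -
    have "log 2 (real ?T + 1) \<le> ?L" unfolding lg_def by simp
    then show ?thesis using hbound_le[of ?T] by linarith
  qed
  have F: "real (hbound (4 * (?T + 1))) \<le> 9 * ?L"
  proof -
    have "log 2 (real (4 * (?T + 1)) + 1) \<le> log 2 (4 * (real ?T + 2))"
      by (subst log_le_cancel_iff) auto
    also have "\<dots> = log 2 (2 ^ 2) + ?L" unfolding lg_def by (subst log_mult) auto
    also have "log 2 (2 ^ 2 :: real) = 2" by (subst log_nat_power) auto
    finally show ?thesis using hbound_le[of "4 * (?T + 1)"] L by linarith
  qed
  have n: "real (hbound ?n) \<le> 3 * ?L + 3 * ?W"
  proof -
    have "log 2 (real ?n + 1) \<le> log 2 (real (?n + 4))" by (subst log_le_cancel_iff) simp_all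
    also note log_records
    finally show ?thesis using hbound_le[of ?n] by linarith
  qed
  \<comment> \<open>The factors come from \<open>1 + 9 * L <= 10 * L\<close> and
    \<open>70 * 3 * L + 120 <= 330 * L\<close> for \<open>L >= 1\<close>.\<close>
  have "(1 + real (hbound (4 * (?T + 1)))) * (real (hbound ?T) * 70 + 120) \<le> (10 * ?L) * (330 * ?L)"
    using F T L by (intro mult_mono) auto
  then have 1: "(1 + real (hbound (4 * (?T + 1)))) * (real (hbound ?T) * 70 + 120) \<le> 3300 * ?L\<^sup>2"
    by (simp add: power2_eq_square)
  have 2: "?L \<le> ?L\<^sup>2" using L(1) by (simp add: power2_eq_square)
  have "real (op_cost ?T ?n) = (1 + real (hbound (4 * (?T + 1)))) * (real (hbound ?T) * 70 + 120) +
      real (hbound ?n) * 2100 + 2060"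
    by (simp add: op_cost_def search_cost_def algebra_simps)
  also have "\<dots> \<le> 3300 * ?L\<^sup>2 + ?L * 6300 + ?W * 6300 + 2060"
    using 1 n by linarith
  also have "\<dots> \<le> 20000 * ?L\<^sup>2 + 20000 * ?W" using L 2 by linarith
  finally show ?thesis by (simp add: time_budget_def distrib_left)
qed

lemma wp_run:
  assumes "ram w m N" "ram.wp w m c k Q R h"
  shows "\<exists>k' R' R1 h'. exec w m (compC c) (R, flat h) k' (R1, flat h') \<and> k' \<le> k \<and> R1 0 = R' 0 \<and> Q R' h'"
  using assms(2) unfolding ram.wp_def[OF assms(1)] ram.agree_def[OF assms(1)]
  by (metis zero_less_numeral)

section \<open>Existence of representations\<close>

lemma invar_start:
  "invar \<lparr>spins = Q, verts = {}, init = \<lambda>_. undefined, entries = []\<rparr> (\<lambda>a f. if f = 8 then 1 else 0)"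
  (is "invar ?s ?h")
proof -
  have "seq 0 ?h []" "seq 4 ?h []"
    unfolding seq_def by (auto intro!: exI[of _ Leaf])
  then have "repr ?s ?h [] []" by (simp add: repr_def store_def)
  then show ?thesis unfolding invar_def layout_def by (auto simp: records_def len_def intro!: exI[of _ "[]"])
qed

text \<open>The program itself provides the new heap: it is run on a machine that is large enough,
  with word length \<open>16 * N\<close>. This word length need not accommodate the names of
  vertices and spins, since \<open>wp_program\<close> makes no such demand.\<close>

lemma invar_perform:
  assumes "valid s" "admissible s p" "invar s h"
  shows "\<exists>h'. invar (perform p s) h'"
proof -
  let ?N = "records s + 2"
  have "16 * ?N \<le> 2 ^ (16 * ?N)" using less_exp[of "16 * ?N"] by linarith
  then have r: "ram (16 * ?N) (10 * ?N) ?N" by unfold_locales auto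
  show ?thesis
    using wp_run[OF r ram.wp_program[OF r assms(3) order_refl assms(1,2)]] by blast
qed

text \<open>Any instance is reached from the empty one by adding its vertices with their initial
  values and then appending the log entries one by one.\<close>

lemma invar_exists:
  assumes val: "valid s"
  shows "\<exists>h. invar s h"
proof -
  obtain Q V X xs where s: "s = \<lparr>spins = Q, verts = V, init = X, entries = xs\<rparr>"
    by (cases s) auto
  have v: "finite Q" "finite V" "X \<in> V \<rightarrow>\<^sub>E Q" "set xs \<subseteq> V \<times> Q" using val by (simp_all add: valid_def s)
  \<comment> \<open>Restricting \<open>X\<close> makes the initial state extensional on the vertices
    added so far, so the intermediate instances are valid.\<close>
  let ?s = "\<lambda>V. \<lparr>spins = Q, verts = V, init = restrict X V, entries = []\<rparr>"
  have "U \<subseteq> V \<Longrightarrow> \<exists>h. invar (?s U) h" if "finite U" for U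
    using that
  proof (induction U rule: finite_induct)
    case empty
    have "restrict X {} = (\<lambda>_. undefined)" by auto
    then show ?case using invar_start[of Q] by auto
  next
    case (insert x U)
    then obtain h where h: "invar (?s U) h" by blast
    have "finite U" "restrict X U \<in> U \<rightarrow>\<^sub>E Q" using insert v by (auto simp: PiE_iff)
    then have "valid (?s U)" "admissible (?s U) (AddVertex x (X x))"
      using insert v by (auto simp: valid_def PiE_iff)
    from invar_perform[OF this h] have ex: "\<exists>h'. invar (perform (AddVertex x (X x)) (?s U)) h'" .
    have eq: "restrict X (insert x U) = (restrict X U)(x := X x)" by (auto simp: restrict_def)
    have "perform (AddVertex x (X x)) (?s U) = ?s (insert x U)" unfolding eq by simp
    then show ?case using ex by metis
  qed
  from this[OF v(2)] have start: "\<exists>h. invar (?s V) h" by simp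
  have X: "restrict X V = X" using v(3) by (simp add: PiE_restrict)
  let ?t = "\<lambda>ys. \<lparr>spins = Q, verts = V, init = X, entries = ys\<rparr>"
  have "set ys \<subseteq> V \<times> Q \<Longrightarrow> \<exists>h. invar (?t ys) h" for ys
  proof (induction ys rule: rev_induct)
    case Nil
    then show ?case using start X by simp
  next
    case (snoc y ys)
    obtain v c where y: "y = (v, c)" by (cases y)
    obtain h where h: "invar (?t ys) h" using snoc by auto
    have "valid (?t ys)" "admissible (?t ys) (Insert (length ys + 1) v c)"
      using snoc.prems v y by (auto simp: valid_def len_def)
    from invar_perform[OF this h] show ?case by (simp add: y)
  qed
  then show ?thesis using v(4) s by simp
qed

theorem theorem6p12:
  "\<exists>(prog :: opkind \<Rightarrow> com) (rep :: instance_data \<Rightarrow> nat list \<Rightarrow> bool) (K :: nat).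
     stores_within K rep \<and> performs_within K rep prog"
proof (intro exI conjI)
  let ?K = "20000 :: nat" and ?prog = "\<lambda>o'. compC (program o')"
  show "stores_within ?K represents"
    unfolding stores_within_def
  proof (intro conjI allI impI)
    fix s assume "valid s"
    then show "\<exists>ws. represents s ws" using invar_exists unfolding represents_def by blast
  next
    fix s ws assume "valid s" "represents s ws"
    then show "length ws \<le> word_budget ?K s"
      by (auto simp: represents_def word_budget_def records_def)
  next
    fix s ws w assume val: "valid s" and rep: "represents s ws" and w: "word_length_ok ?K s w"
    obtain h where h: "invar s h" "ws = map (flat h) [0..<10 * (records s + 1)]"
      using rep by (auto simp: represents_def)
    have l: "16 * (records s + 4) \<le> 2 ^ w" using word_length_large[OF w] by simp
    show "set ws \<subseteq> {..<2 ^ w}"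
    proof
      fix x assume "x \<in> set ws"
      then obtain i where i: "i < 10 * (records s + 1)" "x = h (i div 10) (i mod 10)"
        unfolding h(2) by (auto simp: flat_def)
      have "i div 10 < records s + 1" using i(1) by (intro less_mult_imp_div_less) simp
      then have "i div 10 \<le> records s" by simp
      then have "x \<le> records s + 1 \<or> x \<in> verts s \<union> spins s"
        unfolding i(2) by (intro invar_word_bound[OF h(1) val]) simp_all
      moreover have "verts s \<union> spins s \<subseteq> {..<2 ^ w}" using w by (simp add: word_length_ok_def)
      ultimately show "x \<in> {..<2 ^ w}" using l by auto
    qed
  qed
  show "performs_within ?K represents ?prog"
    unfolding performs_within_def Let_def
  proof (intro allI impI)
    fix s p w ws M
    let ?s = "perform p s"
    assume val: "valid s" and adm: "admissible s p"
      and w: "word_length_ok ?K s w" "word_length_ok ?K ?s w"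
      and rep: "represents s ws" and st: "stored ws M"
    \<comment> \<open>The \<open>2\<close> in \<open>?N\<close> leaves room for record 0 and for one
      new record. Ten words per record fit into the budget of the larger of the two
      instances.\<close>
    let ?m = "max (word_budget ?K s) (word_budget ?K ?s)" and ?N = "max (records s) (records ?s) + 2"
    obtain h0 where h0: "invar s h0" "ws = map (flat h0) [0..<10 * (records s + 1)]"
      using rep by (auto simp: represents_def)
    \<comment> \<open>The run starts from the actual memory, read as a heap, which agrees with
      \<open>h0\<close> only on the stored words.\<close>
    define h where "h a f = M (a * 10 + f)" for a f
    have M: "M = flat h" by (auto simp: flat_def h_def)
    have h: "invar s h"
    proof (rule invar_cong[OF h0(1)])
      fix a f :: nat assume af: "a \<le> records s" "f < 10"
      then have l: "a * 10 + f < 10 * (records s + 1)" by simp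
      then have "M (a * 10 + f) = ws ! (a * 10 + f)" using st unfolding stored_def h0(2) by simp
      then show "h a f = h0 a f" using l af by (simp add: h_def h0(2) flat_at)
    qed
    have "16 * ?N \<le> 2 ^ w" using word_length_large[OF w(1)] word_length_large[OF w(2)] by (simp add: max_def)
    then have r: "ram w ?m ?N"
      by unfold_locales (auto simp: word_budget_def records_def max_def)
    obtain k R' R1 h' where e: "exec w ?m (compC (program (kind p))) (input_regs p, flat h) k (R1, flat h')"
      "k \<le> op_cost (len s) (records s)" "R1 0 = R' 0" "invar ?s h'" "\<forall>y. answer p s = Some y \<longrightarrow> R' 0 = y"
      using wp_run[OF r ram.wp_program[OF r h _ val adm]] by auto
    have "real k \<le> time_budget ?K s" using e(2) op_cost_le[of s] by linarith
    moreover have "represents ?s (map (flat h') [0..<10 * (records ?s + 1)])"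
      using e(4) by (auto simp: represents_def)
    moreover have "stored (map (flat h') [0..<10 * (records ?s + 1)]) (flat h')"
      by (simp add: stored_def)
    ultimately show "\<exists>k R' M' ws'.
        exec w ?m (?prog (kind p)) (input_regs p, M) k (R', M') \<and> real k \<le> time_budget ?K s \<and>
        represents ?s ws' \<and> stored ws' M' \<and> (\<forall>y. answer p s = Some y \<longrightarrow> R' 0 = y)"
      using e(1,3,5) unfolding M by metis
  qed
qed

end
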